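(* Let $n\ge1$, let $\Gamma_n$ be a connected graph on $[n]$, and let $V\subseteq[n]$ be a nonempty subset inducing a complete subgraph of $\Gamma_n$. Let $\Gamma_{n+1}$ be the graph on $[n+1]$ obtained from $\Gamma_n$ by adding the new vertex $n+1$ and joining it by edges to exactly the vertices of $V$. Put $$\mathcal{S}=\{S\in B(\Gamma_n)\setminus\{[n]\} : S\cap V\ne\emptyset\}.$$ Then the polytope $P_{\Gamma_{n+1}}$ is (combinatorially) obtained from the cylinder $P_{\Gamma_n}\times I$, where $I$ is an interval, by sequentially shaving off the intersections of the top base with the side facets $F_S\times I$, $S\in\mathcal{S}$ (in an order in which $S$ precedes $S'$ whenever $S\supsetneq S'$); the faces shaved off are combinatorially equivalent to $P_{\Gamma_n|_S}\times P_{\Gamma_n/S}$, $S\in\mathcal{S}$. Consequently $$\gamma(P_{\Gamma_{n+1}})=\gamma(P_{\Gamma_n})+\tau\sum_{S\in\mathcal{S}}\gamma(P_{\Gamma_n|_S})\,\gamma(P_{\Gamma_n/S}),$$ $$H(P_{\Gamma_{n+1}})=(\alpha+t)H(P_{\Gamma_n})+\alpha t\sum_{S\in\mathcal{S}}H(P_{\Gamma_n|_S})\,H(P_{\Gamma_n/S}).$$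
   Context: Notation: $[m]=\{1,\ldots,m\}$. Graphs are finite, with no loops or multiple edges. For a graph $\Gamma$ on a finite node set $N$, the graphical building set $B(\Gamma)$ is the collection of nonempty $S\subseteq N$ such that the induced subgraph $\Gamma|_S$ is connected. The graph-associahedron is the Minkowski sum $P_\Gamma=\sum_{S\in B(\Gamma)}\Delta^S\subset\mathbb{R}^{N}$, where $\Delta^S=\mathrm{conv}\{e_i : i\in S\}$ and $e_i$ are the standard basis vectors. For connected $\Gamma$, $P_\Gamma$ is a simple polytope of dimension $|N|-1$, and its facets are in bijection with $S\in B(\Gamma)\setminus\{N\}$; the facet corresponding to $S$ is denoted $F_S$. For connected $\Gamma$ on $N$ and $S\in B(\Gamma)$, $S\neq N$, the contraction of $B=B(\Gamma)$ along $S$ is $B/S=\{S'\subseteq N\setminus S : S'\neq\emptyset,\ S'\in B\text{ or }S'\cup S\in B\}$; it is the graphical building set of a connected graph on $N\setminus S$, denoted $\Gamma/S$ (two nodes of $N\setminus S$ are adjacent in $\Gamma/S$ iff they are adjacent in $\Gamma$ or both are adjacent in $\Gamma$ to nodes of $S$). Shaving a face $G$ of a simple polytope $P$ means cutting off $G$ by a hyperplane that strictly separates the vertices of $G$ from the remaining vertices of $P$, and keeping the part not containing $G$. After each shaving, facets of the original polytope are identified with their remaining parts. The top base of $P_{\Gamma_n}\times I$ is one of the two facets $P_{\Gamma_n}\times\{\text{endpoint}\}$. For a $d$-dimensional simple polytope $P$, let $f_i$ be the number of its $i$-dimensional faces ($f_d=1$), $F(P)(\alpha,t)=\sum_{i=0}^d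 f_i\alpha^i t^{d-i}$ and $H(P)(\alpha,t)=F(P)(\alpha-t,t)$. By the Dehn–Sommerville equations $H(P)$ is symmetric, so it is uniquely written as $H(P)=\sum_{i=0}^{\lfloor d/2\rfloor}\gamma_i(\alpha t)^i(\alpha+t)^{d-2i}$; the $\gamma$-polynomial is $\gamma(P)(\tau)=\sum_{i=0}^{\lfloor d/2\rfloor}\gamma_i\tau^i$. For a point, $H=\gamma=1$. *)

theory Defs
  imports "HOL-Analysis.Analysis" "HOL-Computational_Algebra.Polynomial"
begin

section \<open>Finite simple graphs and graphical building sets\<close>

record 'v ugraph =
  nodes :: "'v set"
  edges :: "('v \<times> 'v) set"

definition simple_graph :: "'v ugraph \<Rightarrow> bool" where
  "simple_graph \<Gamma> \<longleftrightarrow>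
     finite (nodes \<Gamma>) \<and> edges \<Gamma> \<subseteq> nodes \<Gamma> \<times> nodes \<Gamma> \<and> sym (edges \<Gamma>) \<and> irrefl (edges \<Gamma>)"

definition connected_graph :: "'v ugraph \<Rightarrow> bool" where
  "connected_graph \<Gamma> \<longleftrightarrow>
     nodes \<Gamma> \<noteq> {} \<and> (\<forall>x\<in>nodes \<Gamma>. \<forall>y\<in>nodes \<Gamma>. (x, y) \<in> (edges \<Gamma>)\<^sup>*)"

definition induced :: "'v ugraph \<Rightarrow> 'v set \<Rightarrow> 'v ugraph" where
  "induced \<Gamma> S = \<lparr>nodes = S, edges = edges \<Gamma> \<inter> S \<times> S\<rparr>"

definition building_set :: "'v ugraph \<Rightarrow> 'v set set" where
  "building_set \<Gamma> = {S. S \<subseteq> nodes \<Gamma> \<and> S \<noteq> {} \<and> connected_graph (induced \<Gamma> S)}"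

definition contraction :: "'v ugraph \<Rightarrow> 'v set \<Rightarrow> 'v ugraph" where
  "contraction \<Gamma> S =
     \<lparr>nodes = nodes \<Gamma> - S,
      edges = {(x, y). x \<in> nodes \<Gamma> - S \<and> y \<in> nodes \<Gamma> - S \<and> x \<noteq> y \<and>
                 ((x, y) \<in> edges \<Gamma> \<or>
                  (\<exists>s\<in>S. (x, s) \<in> edges \<Gamma>) \<and> (\<exists>s\<in>S. (y, s) \<in> edges \<Gamma>))}\<rparr>"

definition is_clique :: "'v ugraph \<Rightarrow> 'v set \<Rightarrow> bool" where
  "is_clique \<Gamma> V \<longleftrightarrow> V \<subseteq> nodes \<Gamma> \<and> (\<forall>x\<in>V. \<forall>y\<in>V. x \<noteq> y \<longrightarrow> (x, y) \<in> edges \<Gamma>)"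

definition add_node :: "'v ugraph \<Rightarrow> 'v \<Rightarrow> 'v set \<Rightarrow> 'v ugraph" where
  "add_node \<Gamma> w V =
     \<lparr>nodes = insert w (nodes \<Gamma>), edges = edges \<Gamma> \<union> {w} \<times> V \<union> V \<times> {w}\<rparr>"

definition tubes_meeting :: "'v ugraph \<Rightarrow> 'v set \<Rightarrow> 'v set set" where
  "tubes_meeting \<Gamma> V = {S \<in> building_set \<Gamma> - {nodes \<Gamma>}. S \<inter> V \<noteq> {}}"

lemma mem_building_set:
  "S \<in> building_set \<Gamma> \<longleftrightarrow>
     S \<subseteq> nodes \<Gamma> \<and> S \<noteq> {} \<and> (\<forall>x\<in>S. \<forall>y\<in>S. (x, y) \<in> (edges \<Gamma> \<inter> S \<times> S)\<^sup>*)"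
  by (auto simp: building_set_def connected_graph_def induced_def)

lemma building_set_contraction:
  assumes \<Gamma>: "simple_graph \<Gamma>" and S: "S \<in> building_set \<Gamma>"
  shows "building_set (contraction \<Gamma> S) =
    {S'. S' \<subseteq> nodes \<Gamma> - S \<and> S' \<noteq> {} \<and> (S' \<in> building_set \<Gamma> \<or> S' \<union> S \<in> building_set \<Gamma>)}"
proof (intro set_eqI iffI)
  let ?E = "edges \<Gamma>" and ?C = "edges (contraction \<Gamma> S)"
  have symE: "(y, x) \<in> ?E" if "(x, y) \<in> ?E" for x y
    using \<Gamma> that by (auto simp: simple_graph_def sym_def)
  have irrE: "x \<noteq> y" if "(x, y) \<in> ?E" for x y
    using \<Gamma> that by (auto simp: simple_graph_def irrefl_def)
  have Sconn: "(x, y) \<in> (?E \<inter> S \<times> S)\<^sup>*" if "x \<in> S" "y \<in> S" for x y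
    using S that by (auto simp: mem_building_set)
  have SN: "S \<subseteq> nodes \<Gamma>" "S \<noteq> {}"
    using S by (auto simp: mem_building_set)
  fix T
  let ?U = "T \<union> S"
  show "T \<in> {S'. S' \<subseteq> nodes \<Gamma> - S \<and> S' \<noteq> {} \<and>
           (S' \<in> building_set \<Gamma> \<or> S' \<union> S \<in> building_set \<Gamma>)}"
    if "T \<in> building_set (contraction \<Gamma> S)"
  proof -
    have T': "T \<subseteq> nodes \<Gamma> - S" "T \<noteq> {}"
      using that by (auto simp: mem_building_set contraction_def)
    have Tconn: "(x, y) \<in> (?C \<inter> T \<times> T)\<^sup>*" if "x \<in> T" "y \<in> T" for x y
      using \<open>T \<in> building_set (contraction \<Gamma> S)\<close> that unfolding mem_building_set by blast
    have "T \<in> building_set \<Gamma> \<or> ?U \<in> building_set \<Gamma>"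
    proof (cases "\<exists>x\<in>T. \<exists>s\<in>S. (x, s) \<in> ?E")
      case False
      then have "?C \<inter> T \<times> T \<subseteq> ?E \<inter> T \<times> T"
        by (auto simp: contraction_def)
      from rtrancl_mono[OF this] have "(x, y) \<in> (?E \<inter> T \<times> T)\<^sup>*" if "x \<in> T" "y \<in> T" for x y
        using Tconn[OF that] by blast
      then have "T \<in> building_set \<Gamma>"
        unfolding mem_building_set using T' by blast
      then show ?thesis ..
    next
      case True
      then obtain x s where xs: "x \<in> T" "s \<in> S" "(x, s) \<in> ?E" by blast
      let ?R = "?E \<inter> ?U \<times> ?U"
      have SU: "(p, q) \<in> ?R\<^sup>*" if "p \<in> S" "q \<in> S" for p q
        using Sconn[OF that] rtrancl_mono[of "?E \<inter> S \<times> S" ?R] by blast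
      have step: "(p, q) \<in> ?R\<^sup>*" if pq: "(p, q) \<in> ?C \<inter> T \<times> T" for p q
      proof (cases "(p, q) \<in> ?E")
        case True
        then show ?thesis using pq by blast
      next
        case False
        then obtain u v where uv: "u \<in> S" "v \<in> S" "(p, u) \<in> ?E" "(q, v) \<in> ?E"
          using pq by (auto simp: contraction_def)
        then have "(p, u) \<in> ?R" "(v, q) \<in> ?R"
          using pq symE by auto
        then show ?thesis
          using SU[OF uv(1,2)] by (meson converse_rtrancl_into_rtrancl rtrancl.rtrancl_into_rtrancl)
      qed
      have TU: "(p, q) \<in> ?R\<^sup>*" if "p \<in> T" "q \<in> T" for p q
        using Tconn[OF that] rtrancl_subset_rtrancl[of "?C \<inter> T \<times> T" ?R] step by auto
      have link: "(x, s) \<in> ?R\<^sup>*" "(s, x) \<in> ?R\<^sup>*"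
        using xs symE by auto
      have "(p, q) \<in> ?R\<^sup>*" if "p \<in> ?U" "q \<in> ?U" for p q
      proof -
        have "(p, s) \<in> ?R\<^sup>*"
          using that(1) TU[OF _ xs(1), of p] SU[OF _ xs(2), of p] link(1)
          by (auto intro: rtrancl_trans)
        moreover have "(s, q) \<in> ?R\<^sup>*"
          using that(2) TU[OF xs(1), of q] SU[OF xs(2), of q] link(2)
          by (auto intro: rtrancl_trans)
        ultimately show ?thesis by (rule rtrancl_trans)
      qed
      then have "?U \<in> building_set \<Gamma>"
        unfolding mem_building_set using T' SN by blast
      then show ?thesis ..
    qed
    then show ?thesis using T' by blast
  qed
  show "T \<in> building_set (contraction \<Gamma> S)"
    if "T \<in> {S'. S' \<subseteq> nodes \<Gamma> - S \<and> S' \<noteq> {} \<and>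
           (S' \<in> building_set \<Gamma> \<or> S' \<union> S \<in> building_set \<Gamma>)}"
  proof -
    have T: "T \<subseteq> nodes \<Gamma> - S" "T \<noteq> {}" and
      TT: "T \<in> building_set \<Gamma> \<or> ?U \<in> building_set \<Gamma>"
      using that by auto
    let ?R = "?C \<inter> T \<times> T"
    have inC: "(p, q) \<in> ?R" if "p \<in> T" "q \<in> T" "(p, q) \<in> ?E" for p q
      using that T irrE by (auto simp: contraction_def)
    have viaS: "(p, q) \<in> ?R\<^sup>*"
      if "p \<in> T" "q \<in> T" "u \<in> S" "v \<in> S" "(p, u) \<in> ?E" "(q, v) \<in> ?E" for p q u v
      using that T by (cases "p = q") (auto simp: contraction_def intro!: r_into_rtrancl)
    have "(p, q) \<in> ?R\<^sup>*" if pq: "p \<in> T" "q \<in> T" for p q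
      using TT
    proof
      assume "T \<in> building_set \<Gamma>"
      then have "(p, q) \<in> (?E \<inter> T \<times> T)\<^sup>*"
        using pq by (auto simp: mem_building_set)
      then show ?thesis
        using rtrancl_mono[of "?E \<inter> T \<times> T" ?R] inC by blast
    next
      assume "?U \<in> building_set \<Gamma>"
      then have "(p, q) \<in> (?E \<inter> ?U \<times> ?U)\<^sup>*"
        using pq by (auto simp: mem_building_set)
      then have "(q \<in> T \<longrightarrow> (p, q) \<in> ?R\<^sup>*) \<and>
          (q \<in> S \<longrightarrow> (\<exists>z\<in>T. \<exists>u\<in>S. (p, z) \<in> ?R\<^sup>* \<and> (z, u) \<in> ?E))"
      proof (induction rule: rtrancl_induct)
        case base
        then show ?case using pq T by auto
      next
        case (step y z)
        from step.hyps(2) have yz: "(y, z) \<in> ?E" "y \<in> ?U" "z \<in> ?U" by auto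
        show ?case
        proof (cases "y \<in> T")
          case True
          then have py: "(p, y) \<in> ?R\<^sup>*" using step.IH by blast
          have "(p, z) \<in> ?R\<^sup>*" if "z \<in> T"
            using py inC[OF True that yz(1)] by (rule rtrancl_into_rtrancl)
          then show ?thesis using py True yz(1) by blast
        next
          case False
          then have "y \<in> S" using yz by blast
          then obtain c u where c: "c \<in> T" "u \<in> S" "(p, c) \<in> ?R\<^sup>*" "(c, u) \<in> ?E"
            using step.IH by blast
          have "(p, z) \<in> ?R\<^sup>*" if "z \<in> T"
            using viaS[OF c(1) that c(2) \<open>y \<in> S\<close> c(4) symE[OF yz(1)]] c(3)
            by (blast intro: rtrancl_trans)
          then show ?thesis using c by blast
        qed
      qed
      then show ?thesis using pq by blast
    qed
    then show ?thesis
      using T by (auto simp: mem_building_set contraction_def)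
  qed
qed

section \<open>Polytopes up to combinatorial equivalence\<close>

definition combinatorially_equivalent ::
    "'a::real_vector set \<Rightarrow> 'b::real_vector set \<Rightarrow> bool" where
  "combinatorially_equivalent P Q \<longleftrightarrow>
     (\<exists>\<phi>. bij_betw \<phi> {F. F face_of P} {F. F face_of Q} \<and>
          (\<forall>F G. F face_of P \<longrightarrow> G face_of P \<longrightarrow> (\<phi> F \<subseteq> \<phi> G \<longleftrightarrow> F \<subseteq> G)))"

definition simple_polytope :: "'a::euclidean_space set \<Rightarrow> bool" where
  "simple_polytope P \<longleftrightarrow>
     polytope P \<and>
     (\<forall>v. v extreme_point_of P \<longrightarrow> int (card {F. F facet_of P \<and> v \<in> F}) = aff_dim P)"

text \<open>\<open>shaving P G P'\<close>: the polytope \<open>P'\<close> results from the simple polytope \<open>P\<close> by cutting off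
  its proper nonempty face \<open>G\<close>.  The result depends on the cutting hyperplane, hence a relation.\<close>

definition shaving ::
    "'a::euclidean_space set \<Rightarrow> 'a set \<Rightarrow> 'a set \<Rightarrow> bool" where
  "shaving P G P' \<longleftrightarrow>
     simple_polytope P \<and> G face_of P \<and> G \<noteq> {} \<and> G \<noteq> P \<and>
     (\<exists>a b. (\<forall>v. v extreme_point_of P \<and> v \<in> G \<longrightarrow> a \<bullet> v > b) \<and>
            (\<forall>v. v extreme_point_of P \<and> v \<notin> G \<longrightarrow> a \<bullet> v < b) \<and>
            P' = P \<inter> {x. a \<bullet> x \<le> b})"

text \<open>\<open>shaving_sequence P Gs Q\<close>: starting from \<open>Q 0 = P\<close>, the faces \<open>Gs\<close> of \<open>P\<close> are shaved off
  one after the other; step \<open>i\<close> shaves off what remains of \<open>Gs ! i\<close> in \<open>Q i\<close>.  The final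
  polytope is \<open>Q (length Gs)\<close>.\<close>

definition shaving_sequence ::
    "'a::euclidean_space set \<Rightarrow> 'a set list \<Rightarrow> (nat \<Rightarrow> 'a set) \<Rightarrow> bool" where
  "shaving_sequence P Gs Q \<longleftrightarrow>
     Q 0 = P \<and> (\<forall>i<length Gs. shaving (Q i) (Gs ! i \<inter> Q i) (Q (Suc i)))"

section \<open>Face polynomials\<close>

text \<open>Polynomials in the two variables \<open>\<alpha>, t\<close> are rendered as functions on the reals.\<close>

definition pdim :: "'a::euclidean_space set \<Rightarrow> nat" where
  "pdim P = nat (aff_dim P)"

definition face_number :: "'a::euclidean_space set \<Rightarrow> nat \<Rightarrow> nat" where
  "face_number P i = card {F. F face_of P \<and> aff_dim F = int i}"

definition F_poly :: "'a::euclidean_space set \<Rightarrow> real \<Rightarrow> real \<Rightarrow> real" where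
  "F_poly P \<alpha> t = (\<Sum>i\<le>pdim P. real (face_number P i) * \<alpha> ^ i * t ^ (pdim P - i))"

definition H_poly :: "'a::euclidean_space set \<Rightarrow> real \<Rightarrow> real \<Rightarrow> real" where
  "H_poly P \<alpha> t = F_poly P (\<alpha> - t) t"

definition gamma_poly :: "'a::euclidean_space set \<Rightarrow> real poly" where
  "gamma_poly P =
     (THE g. degree g \<le> pdim P div 2 \<and>
        (\<forall>\<alpha> t. H_poly P \<alpha> t =
           (\<Sum>i\<le>pdim P div 2. coeff g i * (\<alpha> * t) ^ i * (\<alpha> + t) ^ (pdim P - 2 * i))))"

section \<open>Graph-associahedra\<close>

text \<open>Nodes are elements of an arbitrary finite type \<open>'v\<close>, so that the graphs on \<open>N\<close>, on
  \<open>insert w N\<close>, on \<open>S\<close> and on \<open>N - S\<close> can occur side by side; for a graph with node set \<open>N\<close>,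
  the space \<open>\<real>\<^sup>N\<close> is the coordinate subspace of \<open>real ^ 'v\<close> of vectors supported on \<open>N\<close>.
  The sum of sets below is the Minkowski sum.\<close>

definition std_simplex :: "'v::finite set \<Rightarrow> (real ^ 'v) set" where
  "std_simplex S = convex hull ((\<lambda>i. axis i 1) ` S)"

definition graph_assoc :: "'v::finite ugraph \<Rightarrow> (real ^ 'v) set" where
  "graph_assoc \<Gamma> = (\<Sum>S\<in>building_set \<Gamma>. std_simplex S)"

text \<open>The facet \<open>F\<^sub>S\<close> is the one on which the coordinate sum over \<open>S\<close> attains its minimum,
  according to the facet description of the graph-associahedron by the inequalities
  \<open>(\<Sum>i\<in>S. x $ i) \<ge> card {T \<in> building_set \<Gamma>. T \<subseteq> S}\<close>.\<close>

definition assoc_facet :: "'v::finite ugraph \<Rightarrow> 'v set \<Rightarrow> (real ^ 'v) set" where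
  "assoc_facet \<Gamma> S =
     {x \<in> graph_assoc \<Gamma>. \<forall>y\<in>graph_assoc \<Gamma>. (\<Sum>i\<in>S. x $ i) \<le> (\<Sum>i\<in>S. y $ i)}"

end

theory Submission
  imports Defs
begin

text \<open>A simple polytope is determined combinatorially by the simplicial complex on its facets whose
simplices are the sets of facets with a common point.  The whole proof is a comparison of such
complexes, made possible by three geometric facts.

\<^item> For a graph-associahedron the complex consists of the nested families of tubes: sets of
  connected node sets, pairwise nested or apart from each other.  A face of the Minkowski sum is
  where a linear function \<open>c\<close> is minimal, and it depends only on the connected components of the sets
  \<open>{i. c i \<ge> r}\<close>, which form a nested family (\<open>realization_and_dim\<close>).
\<^item> Shaving a face subdivides the complex stellarly at the simplex of that face
  (\<open>realization_shave\<close>).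
\<^item> The complex of a product is the join of the complexes (\<open>realization_Times\<close>).

The facets met during the shaving process are labelled by tubes of the extended graph: the top base
by \<open>{w}\<close>, the bottom base by the old node set \<open>N\<close>, the side facets by the old tubes \<open>S\<close>, and
the facet created by shaving the intersection of the top base with the side facet of \<open>S\<close> by
\<open>insert w S\<close>.  Since \<open>V\<close> is a clique these are all the tubes of the extended graph.  All complexes
that occur are flag complexes, and stellar subdivision at an edge preserves this
(\<open>stellar_cliques\<close>), so only pairs of labels have to be followed.  A tube \<open>S\<close> meeting \<open>V\<close> is
incompatible with \<open>{w}\<close>, whereas in the cylinder the two facets intersect; every shaving destroys
one of these intersections, and when all are gone the relation is that of the extended graph
(\<open>complex_final\<close>).  That larger tubes come first ensures that the new facet meets exactly the
facets it has to (\<open>compatible_new_iff\<close>).  The link of the shaved edge is the join of the nested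
complexes of the restriction and of the contraction (\<open>link_complex\<close>), which identifies the shaved
faces.

Counting simplices, subdivision at an edge changes \<open>H\<close> by \<open>\<alpha> t\<close> times the \<open>H\<close>-polynomial of
the link, and passing to the cylinder multiplies it by \<open>\<alpha> + t\<close>; this yields the formula for \<open>H\<close>.
The formula for \<open>\<gamma>\<close> follows because \<open>\<gamma>\<close>-expansions are unique and multiplicative and because they exist,
which amounts to the Dehn--Sommerville equations.  The latter are proved by sweeping the polytope with a
generic linear function and with its negative.\<close>

section \<open>Simple polytopes and their facet complexes\<close>

text \<open>Intersecting with \<open>P\<close> allows \<open>f X\<close> to be any set that cuts \<open>P\<close> in the facet labelled \<open>X\<close>, so
that labels can keep their sets when \<open>P\<close> is replaced by a shaved polytope.\<close>

definition cell :: "'a set \<Rightarrow> ('l \<Rightarrow> 'a set) \<Rightarrow> 'l set \<Rightarrow> 'a set" where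
  "cell P f A = P \<inter> (\<Inter>X\<in>A. f X)"

lemma cell_empty [simp]: "cell P f {} = P"
  by (simp add: cell_def)

lemma cell_Un: "cell P f (A \<union> B) = cell P f A \<inter> cell P f B"
  by (auto simp: cell_def)

lemma cell_insert: "cell P f (insert X A) = f X \<inter> cell P f A"
  by (auto simp: cell_def)

lemma cell_antimono: "A \<subseteq> B \<Longrightarrow> cell P f B \<subseteq> cell P f A"
  by (auto simp: cell_def)

text \<open>The dual description of a simple polytope: reversing inclusion, nonempty faces correspond to the
simplices of \<open>K\<close>, with \<open>{}\<close> standing for \<open>P\<close> itself.  That a face of codimension \<open>k\<close> lies in
exactly \<open>k\<close> facets is what makes \<open>P\<close> simple.\<close>

locale realization =
  fixes P :: "'a::euclidean_space set" and f :: "'l \<Rightarrow> 'a set" and K :: "'l set set"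
  assumes polytope: "polytope P"
    and finite_complex: "finite K"
    and finite_simplex: "A \<in> K \<Longrightarrow> finite A"
    and empty_simplex: "{} \<in> K"
    and subset_simplex: "A \<in> K \<Longrightarrow> B \<subseteq> A \<Longrightarrow> B \<in> K"
    and cell_face: "A \<in> K \<Longrightarrow> cell P f A face_of P"
    and cell_nonempty: "A \<in> K \<Longrightarrow> cell P f A \<noteq> {}"
    and face_is_cell: "F face_of P \<Longrightarrow> F \<noteq> {} \<Longrightarrow> \<exists>A\<in>K. F = cell P f A"
    and cell_reflect: "A \<in> K \<Longrightarrow> B \<in> K \<Longrightarrow> cell P f A \<subseteq> cell P f B \<Longrightarrow> B \<subseteq> A"
    and cell_aff_dim: "A \<in> K \<Longrightarrow> aff_dim (cell P f A) + int (card A) = aff_dim P"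
begin

lemma convex: "convex P"
  using polytope by (rule polytope_imp_convex)

lemma nonempty: "P \<noteq> {}"
  using cell_nonempty[OF empty_simplex] by simp

lemma int_pdim: "int (pdim P) = aff_dim P"
proof -
  have "0 \<le> aff_dim P" using nonempty aff_dim_negative_iff[of P] by linarith
  then show ?thesis by (simp add: pdim_def)
qed

lemma cell_subset_iff: "A \<in> K \<Longrightarrow> B \<in> K \<Longrightarrow> cell P f A \<subseteq> cell P f B \<longleftrightarrow> B \<subseteq> A"
  using cell_reflect[of A B] cell_antimono[of B A P f] by blast

lemma cell_eq_iff: "A \<in> K \<Longrightarrow> B \<in> K \<Longrightarrow> cell P f A = cell P f B \<longleftrightarrow> A = B"
  using cell_reflect[of A B] cell_reflect[of B A] by blast

lemma card_le_pdim: "A \<in> K \<Longrightarrow> card A \<le> pdim P"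
proof -
  assume A: "A \<in> K"
  have "aff_dim (cell P f A) \<ge> 0"
    using cell_nonempty[OF A] aff_dim_negative_iff[of "cell P f A"] by linarith
  then show ?thesis
    using cell_aff_dim[OF A] int_pdim by linarith
qed

text \<open>A nonempty intersection of facets is a face, hence the cell of some simplex, and this simplex
contains every label of the intersection.\<close>

lemma simplex_if_cell_nonempty:
  assumes "A \<subseteq> \<Union>K" "cell P f A \<noteq> {}"
  shows "A \<in> K"
proof (cases "A = {}")
  case False
  have sing: "{X} \<in> K" if "X \<in> A" for X
    using assms(1) that subset_simplex[of _ "{X}"] by blast
  have "cell P f A = (\<Inter>X\<in>A. cell P f {X})"
    using False by (auto simp: cell_def)
  also have "\<dots> face_of P"
    using False sing cell_face by (intro face_of_Inter) auto
  finally obtain B where B: "B \<in> K" "cell P f A = cell P f B"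
    using face_is_cell assms(2) by metis
  have "{X} \<subseteq> B" if "X \<in> A" for X
    using cell_reflect[OF B(1) sing[OF that]] B(2) cell_antimono[of "{X}" A P f] that by auto
  then have "A \<subseteq> B" by auto
  then show ?thesis using B subset_simplex by blast
qed (simp add: empty_simplex)

lemma extreme_point_iff:
  "v extreme_point_of P \<longleftrightarrow> (\<exists>M\<in>K. card M = pdim P \<and> cell P f M = {v})"
proof
  assume "v extreme_point_of P"
  then have v: "{v} face_of P" by (simp add: face_of_singleton)
  then obtain M where M: "M \<in> K" "cell P f M = {v}" using face_is_cell by (metis insert_not_empty)
  then have "int (card M) = aff_dim P" using cell_aff_dim[OF M(1)] by simp
  then show "\<exists>M\<in>K. card M = pdim P \<and> cell P f M = {v}"
    using M int_pdim by (intro bexI[of _ M]) auto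
next
  assume "\<exists>M\<in>K. card M = pdim P \<and> cell P f M = {v}"
  then show "v extreme_point_of P" using cell_face by (metis face_of_singleton)
qed

lemma vertex_cell:
  assumes "M \<in> K" "card M = pdim P"
  obtains v where "cell P f M = {v}" "v extreme_point_of P"
proof -
  have "aff_dim (cell P f M) = 0"
    using cell_aff_dim[OF assms(1)] assms(2) int_pdim by simp
  then obtain v where "cell P f M = {v}" by (auto simp: aff_dim_eq_0)
  then show ?thesis using that assms extreme_point_iff by blast
qed

lemma simplex_in_facet:
  assumes "A \<in> K" obtains M where "M \<in> K" "A \<subseteq> M" "card M = pdim P"
proof -
  have F: "cell P f A face_of P" "cell P f A \<noteq> {}" using assms cell_face cell_nonempty by auto
  then have "compact (cell P f A)" "convex (cell P f A)"
    using polytope_imp_compact[OF polytope] face_of_imp_compact convex face_of_imp_convex by blast+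
  then obtain v where v: "v extreme_point_of (cell P f A)"
    using F(2) extreme_point_exists_convex by blast
  then have "v extreme_point_of P" "v \<in> cell P f A"
    using F(1) extreme_point_of_face by blast+
  then obtain M where M: "M \<in> K" "card M = pdim P" "cell P f M = {v}"
    using extreme_point_iff by blast
  then have "A \<subseteq> M" using \<open>v \<in> cell P f A\<close> cell_reflect[OF M(1) assms] by auto
  then show ?thesis using M that by blast
qed

lemma facet_iff: "F facet_of P \<longleftrightarrow> (\<exists>X. {X} \<in> K \<and> F = cell P f {X})"
proof
  assume F: "F facet_of P"
  then obtain A where A: "A \<in> K" "F = cell P f A"
    using face_is_cell unfolding facet_of_def by blast
  then have "card A = 1"
    using cell_aff_dim[OF A(1)] F by (simp add: facet_of_def)
  then show "\<exists>X. {X} \<in> K \<and> F = cell P f {X}" using A by (metis card_1_singletonE)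
next
  assume "\<exists>X. {X} \<in> K \<and> F = cell P f {X}"
  then obtain X where X: "{X} \<in> K" "F = cell P f {X}" by blast
  then show "F facet_of P"
    using cell_face[OF X(1)] cell_nonempty[OF X(1)] cell_aff_dim[OF X(1)] by (simp add: facet_of_def)
qed

lemma simple: "simple_polytope P"
  unfolding simple_polytope_def
proof (intro conjI allI impI polytope)
  fix v assume "v extreme_point_of P"
  then obtain M where M: "M \<in> K" "card M = pdim P" "cell P f M = {v}"
    using extreme_point_iff by blast
  have sing: "{X} \<in> K" if "X \<in> M" for X using M(1) that subset_simplex by auto
  have "{F. F facet_of P \<and> v \<in> F} = (\<lambda>X. cell P f {X}) ` M"
  proof (intro equalityI subsetI)
    fix F assume "F \<in> {F. F facet_of P \<and> v \<in> F}"
    then obtain X where X: "{X} \<in> K" "F = cell P f {X}" "v \<in> F" using facet_iff by blast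
    then have "{X} \<subseteq> M" using cell_reflect[OF M(1) X(1)] M(3) by auto
    then show "F \<in> (\<lambda>X. cell P f {X}) ` M" using X by auto
  next
    fix F assume "F \<in> (\<lambda>X. cell P f {X}) ` M"
    then obtain X where X: "X \<in> M" "F = cell P f {X}" by blast
    then have "v \<in> F" using cell_antimono[of "{X}" M P f] M(3) by auto
    then show "F \<in> {F. F facet_of P \<and> v \<in> F}" using X facet_iff sing by blast
  qed
  moreover have "inj_on (\<lambda>X. cell P f {X}) M"
    using sing cell_eq_iff by (auto intro!: inj_onI)
  ultimately show "int (card {F. F facet_of P \<and> v \<in> F}) = aff_dim P"
    using M(2) int_pdim by (simp add: card_image)
qed

end

text \<open>The dimensions are forced by purity: from \<open>P\<close> down to the cell of a simplex with \<open>d\<close> elements the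
dimension drops strictly at each of the \<open>d\<close> steps, starting from at most \<open>d\<close> and ending with at
least \<open>0\<close>.\<close>

lemma realizationI:
  fixes P :: "'a::euclidean_space set"
  assumes polytope: "polytope P" and finK: "finite K"
    and finite_simplex: "\<And>A. A \<in> K \<Longrightarrow> finite A"
    and empty_simplex: "{} \<in> K"
    and subset_simplex: "\<And>A B. A \<in> K \<Longrightarrow> B \<subseteq> A \<Longrightarrow> B \<in> K"
    and cell_face: "\<And>A. A \<in> K \<Longrightarrow> cell P f A face_of P"
    and cell_nonempty: "\<And>A. A \<in> K \<Longrightarrow> cell P f A \<noteq> {}"
    and face_is_cell: "\<And>F. F face_of P \<Longrightarrow> F \<noteq> {} \<Longrightarrow> \<exists>A\<in>K. F = cell P f A"
    and cell_reflect: "\<And>A B. A \<in> K \<Longrightarrow> B \<in> K \<Longrightarrow> cell P f A \<subseteq> cell P f B \<Longrightarrow> B \<subseteq> A"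
    and dim_le: "aff_dim P \<le> int d"
    and pure: "\<And>A. A \<in> K \<Longrightarrow> \<exists>M\<in>K. A \<subseteq> M \<and> card M = d"
  shows "realization P f K \<and> aff_dim P = int d"
proof -
  have step: "aff_dim (cell P f (A \<union> C)) + int (card C) \<le> aff_dim (cell P f A)"
    if "finite C" "A \<union> C \<in> K" "A \<inter> C = {}" for A C
    using that
  proof (induction C rule: finite_induct)
    case empty
    then show ?case by simp
  next
    case (insert X C)
    have AC: "A \<union> C \<in> K" using insert.prems(1) subset_simplex by (rule_tac subset_simplex) auto
    have IH: "aff_dim (cell P f (A \<union> C)) + int (card C) \<le> aff_dim (cell P f A)"
      using insert AC by auto
    have sub: "cell P f (A \<union> insert X C) \<subseteq> cell P f (A \<union> C)" by (rule cell_antimono) auto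
    have "cell P f (A \<union> insert X C) \<noteq> cell P f (A \<union> C)"
      using cell_reflect[OF AC insert.prems(1)] insert.hyps insert.prems by auto
    moreover have "cell P f (A \<union> insert X C) face_of cell P f (A \<union> C)"
      using face_of_subset[OF cell_face[OF insert.prems(1)] sub] cell_face[OF AC] face_of_imp_subset
      by blast
    moreover have "convex (cell P f (A \<union> C))" using cell_face[OF AC] face_of_imp_convex by blast
    ultimately have "aff_dim (cell P f (A \<union> insert X C)) < aff_dim (cell P f (A \<union> C))"
      using face_of_aff_dim_lt by blast
    then show ?case using IH insert.hyps by simp
  qed
  have dims: "aff_dim (cell P f A) + int (card A) = int d \<and> aff_dim P = int d" if A: "A \<in> K" for A
  proof -
    obtain M where M: "M \<in> K" "A \<subseteq> M" "card M = d" using pure[OF A] by blast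
    have finM: "finite M" using finite_simplex M by blast
    have "aff_dim (cell P f M) \<ge> 0"
      using cell_nonempty[OF M(1)] aff_dim_negative_iff[of "cell P f M"] by linarith
    moreover have "aff_dim (cell P f M) + int (card (M - A)) \<le> aff_dim (cell P f A)"
      using step[of "M - A" A] M finM by (simp add: Un_absorb1)
    moreover have "card (M - A) = card M - card A" "card A \<le> card M"
      using M finM by (auto simp: card_Diff_subset card_mono finite_subset)
    moreover have "aff_dim (cell P f A) + int (card A) \<le> aff_dim P"
      using step[of A "{}"] A finite_simplex by simp
    ultimately show ?thesis using dim_le M by linarith
  qed
  have "realization P f K"
  proof
    show "aff_dim (cell P f A) + int (card A) = aff_dim P" if "A \<in> K" for A
      using dims[OF that] dims[OF empty_simplex] by simp
  qed (fact polytope finK finite_simplex empty_simplex subset_simplex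
        cell_face cell_nonempty face_is_cell cell_reflect)+
  then show ?thesis using dims[OF empty_simplex] by blast
qed

definition link :: "'l set set \<Rightarrow> 'l set \<Rightarrow> 'l set set" where
  "link K A = {B. A \<inter> B = {} \<and> A \<union> B \<in> K}"

lemma (in realization) realization_link:
  assumes A: "A \<in> K"
  shows "realization (cell P f A) f (link K A)"
    and "aff_dim (cell P f A) = aff_dim P - int (card A)"
proof -
  have cc: "cell (cell P f A) f B = cell P f (A \<union> B)" for B
    by (auto simp: cell_def)
  have FA: "cell P f A face_of P" using cell_face[OF A] .
  have sub: "link K A \<subseteq> K" using subset_simplex by (auto simp: link_def)
  show "realization (cell P f A) f (link K A)"
  proof (unfold_locales, unfold cc)
    show "polytope (cell P f A)" using FA polytope face_of_polytope_polytope by blast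
    show "finite (link K A)" using sub finite_complex finite_subset by blast
    show "finite B" if "B \<in> link K A" for B using that sub finite_simplex by blast
    show "{} \<in> link K A" using A by (simp add: link_def)
    show "C \<in> link K A" if "B \<in> link K A" "C \<subseteq> B" for B C
      using that subset_simplex[of "A \<union> B" "A \<union> C"] by (auto simp: link_def)
    show "cell P f (A \<union> B) face_of cell P f A" if "B \<in> link K A" for B
      using that face_of_subset[OF cell_face[of "A \<union> B"], of "cell P f A"]
        cell_antimono[of A "A \<union> B" P f] face_of_imp_subset[OF FA]
      by (simp add: link_def)
    show "cell P f (A \<union> B) \<noteq> {}" if "B \<in> link K A" for B
      using that cell_nonempty by (auto simp: link_def)
    show "\<exists>B\<in>link K A. F = cell P f (A \<union> B)" if F: "F face_of cell P f A" "F \<noteq> {}" for F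
    proof -
      have "F face_of P" using F(1) FA by (rule face_of_trans)
      then obtain B where B: "B \<in> K" "F = cell P f B" using face_is_cell F(2) by blast
      have "F \<subseteq> cell P f A" using F(1) by (rule face_of_imp_subset)
      then have "A \<subseteq> B" using cell_reflect[OF B(1) A] B(2) by simp
      then have AB: "A \<union> (B - A) = B" by blast
      then have "B - A \<in> link K A" using B(1) by (simp add: link_def)
      then show ?thesis using B(2) AB by metis
    qed
    show "C \<subseteq> B" if "B \<in> link K A" "C \<in> link K A" "cell P f (A \<union> B) \<subseteq> cell P f (A \<union> C)" for B C
      using that cell_reflect[of "A \<union> B" "A \<union> C"] by (auto simp: link_def)
    show "aff_dim (cell P f (A \<union> B)) + int (card B) = aff_dim (cell P f A)" if "B \<in> link K A" for B
    proof -
      have "card (A \<union> B) = card A + card B"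
        using that finite_simplex[OF A] finite_simplex[of B] sub
        by (auto simp: link_def intro!: card_Un_disjoint)
      then show ?thesis using that cell_aff_dim[of "A \<union> B"] cell_aff_dim[OF A] by (auto simp: link_def)
    qed
  qed
  show "aff_dim (cell P f A) = aff_dim P - int (card A)"
    using cell_aff_dim[OF A] by simp
qed

lemma realization_relabel:
  assumes "realization P f K" and inj: "inj_on \<sigma> (\<Union>K)"
    and eq: "\<And>X. X \<in> \<Union>K \<Longrightarrow> P \<inter> g (\<sigma> X) = P \<inter> f X"
  shows "realization P g ((`) \<sigma> ` K)"
proof -
  interpret realization P f K by fact
  have cc: "cell P g (\<sigma> ` A) = cell P f A" if "A \<in> K" for A
    using that eq by (fastforce simp: cell_def)
  have sub: "A \<subseteq> \<Union>K" if "A \<in> K" for A using that by blast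
  show ?thesis
  proof
    show "polytope P" "finite ((`) \<sigma> ` K)" "{} \<in> (`) \<sigma> ` K"
      using polytope finite_complex empty_simplex by auto
    fix A assume "A \<in> (`) \<sigma> ` K"
    then obtain A' where A': "A' \<in> K" "A = \<sigma> ` A'" by blast
    show "finite A" "cell P g A face_of P" "cell P g A \<noteq> {}"
      using A' cc cell_face cell_nonempty finite_simplex by auto
    show "B \<in> (`) \<sigma> ` K" if "B \<subseteq> A" for B
      using that A' subset_simplex by (auto simp: subset_image_iff)
    show "B \<subseteq> A" if B: "B \<in> (`) \<sigma> ` K" "cell P g A \<subseteq> cell P g B" for B
    proof -
      obtain B' where B': "B' \<in> K" "B = \<sigma> ` B'" using B(1) by blast
      then have "B' \<subseteq> A'" using B(2) A' cc cell_reflect by metis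
      then show ?thesis using A' B' by blast
    qed
    have "card A = card A'" using A' sub inj by (metis card_image inj_on_subset)
    then show "aff_dim (cell P g A) + int (card A) = aff_dim P"
      using A' cc cell_aff_dim by auto
  next
    fix F assume "F face_of P" "F \<noteq> {}"
    then obtain A where "A \<in> K" "F = cell P f A" using face_is_cell by blast
    then show "\<exists>A\<in>(`) \<sigma> ` K. F = cell P g A" using cc[of A] by (intro bexI[of _ "\<sigma> ` A"]) auto
  qed
qed

lemma combinatorially_equivalentI:
  assumes "realization P f K" "realization Q g L"
    and bij: "bij_betw \<tau> K L" and mono: "\<And>A B. A \<in> K \<Longrightarrow> B \<in> K \<Longrightarrow> \<tau> A \<subseteq> \<tau> B \<longleftrightarrow> A \<subseteq> B"
  shows "combinatorially_equivalent P Q"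
proof -
  interpret P: realization P f K by fact
  interpret Q: realization Q g L by fact
  define lab where "lab F = (THE A. A \<in> K \<and> cell P f A = F)" for F
  have lab: "lab (cell P f A) = A" if "A \<in> K" for A
    unfolding lab_def using that P.cell_eq_iff by (intro the_equality) auto
  define \<phi> where "\<phi> F = (if F = {} then {} else cell Q g (\<tau> (lab F)))" for F
  have \<phi>: "\<phi> (cell P f A) = cell Q g (\<tau> A)" if "A \<in> K" for A
    using that P.cell_nonempty lab by (auto simp: \<phi>_def)
  have facesP: "{F. F face_of P} = insert {} (cell P f ` K)"
    using P.face_is_cell P.cell_face by blast
  have facesQ: "{F. F face_of Q} = insert {} (cell Q g ` L)"
    using Q.face_is_cell Q.cell_face by blast
  have \<tau>: "\<tau> A \<in> L" if "A \<in> K" for A using bij that by (auto simp: bij_betw_def)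
  have 0: "\<phi> {} = {}" by (simp add: \<phi>_def)
  have ord: "\<phi> F \<subseteq> \<phi> G \<longleftrightarrow> F \<subseteq> G" if "F face_of P" "G face_of P" for F G
  proof -
    have F: "F = {} \<or> (\<exists>A\<in>K. F = cell P f A)" and G: "G = {} \<or> (\<exists>A\<in>K. G = cell P f A)"
      using that P.face_is_cell by blast+
    then show ?thesis
      using \<tau> 0 \<phi> P.cell_nonempty Q.cell_nonempty
      by (elim disjE bexE) (auto simp: P.cell_subset_iff Q.cell_subset_iff mono)
  qed
  have "bij_betw \<phi> {F. F face_of P} {F. F face_of Q}"
  proof (rule bij_betw_imageI)
    show "inj_on \<phi> {F. F face_of P}" using ord by (intro inj_onI) blast
    have "L = \<tau> ` K" using bij by (simp add: bij_betw_def)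
    then show "\<phi> ` {F. F face_of P} = {F. F face_of Q}"
      unfolding facesP facesQ using \<phi> 0 by (auto simp: image_image)
  qed
  then show ?thesis using ord unfolding combinatorially_equivalent_def by blast
qed

section \<open>Shaving is stellar subdivision\<close>

lemma open_meets_rel_interior:
  fixes F :: "'a::euclidean_space set"
  assumes "convex F" "open U" "F \<inter> U \<noteq> {}"
  shows "rel_interior F \<inter> U \<noteq> {}"
proof -
  have "U \<inter> closure (rel_interior F) \<noteq> {}"
    using assms(3) closure_subset[of F] by (auto simp: convex_closure_rel_interior[OF assms(1)])
  then show ?thesis using open_Int_closure_eq_empty[OF assms(2)] by blast
qed

lemma hyperplane_meets_rel_interior:
  fixes F :: "'a::euclidean_space set"
  assumes "convex F" "x \<in> F" "a \<bullet> x < b" "y \<in> F" "b < a \<bullet> y"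
  shows "\<exists>z\<in>rel_interior F. a \<bullet> z = b"
proof -
  obtain u where "u \<in> rel_interior F" "a \<bullet> u < b"
    using open_meets_rel_interior[OF assms(1) open_halfspace_lt[of a b]] assms by blast
  moreover obtain v where "v \<in> rel_interior F" "b < a \<bullet> v"
    using open_meets_rel_interior[OF assms(1) open_halfspace_gt[of b a]] assms by blast
  moreover have "connected (rel_interior F)"
    using assms(1) convex_rel_interior convex_connected by blast
  ultimately show ?thesis
    using connected_ivt_hyperplane[of "rel_interior F" u v a b] by auto
qed

lemma polytope_subset_convex:
  fixes F :: "'a::euclidean_space set"
  assumes "polytope F" "convex C" "\<And>v. v extreme_point_of F \<Longrightarrow> v \<in> C"
  shows "F \<subseteq> C"
proof -
  have "F = convex hull {v. v extreme_point_of F}"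
    by (rule Krein_Milman_Minkowski) (use assms(1) polytope_imp_compact polytope_imp_convex in auto)
  then show ?thesis using assms(2,3) hull_minimal[of "{v. v extreme_point_of F}" C convex] by auto
qed

lemma separating_hyperplane_of_face:
  fixes P :: "'a::euclidean_space set"
  assumes "polytope P" "G face_of P"
  obtains a b where "\<And>v. v \<in> G \<Longrightarrow> b < a \<bullet> v"
    and "\<And>v. v extreme_point_of P \<Longrightarrow> v \<notin> G \<Longrightarrow> a \<bullet> v < b"
proof -
  have poly: "polyhedron P" using assms(1) by (rule polytope_imp_polyhedron)
  have "G exposed_face_of P" using exposed_face_of_polyhedron[OF poly] assms(2) by simp
  then obtain a c where P: "P \<subseteq> {x. a \<bullet> x \<le> c}" and G: "G = P \<inter> {x. a \<bullet> x = c}"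
    unfolding exposed_face_of_def by (elim conjE exE)
  define V where "V = insert (c - 1) ((\<lambda>v. a \<bullet> v) ` {v. v extreme_point_of P \<and> v \<notin> G})"
  have fin: "finite V" using finite_polyhedron_extreme_points[OF poly] by (simp add: V_def)
  have lt: "r < c" if r: "r \<in> V" for r
  proof -
    consider "r = c - 1" | v where "v extreme_point_of P" "v \<notin> G" "r = a \<bullet> v"
      using r by (auto simp: V_def)
    then show ?thesis
    proof cases
      case 2
      then have "v \<in> P" by (simp add: extreme_point_of_def)
      then show ?thesis using 2 P G by force
    qed simp
  qed
  then have "Max V < c" using fin by (simp add: V_def)
  then have mid: "Max V < (Max V + c) / 2" "(Max V + c) / 2 < c" by auto
  show ?thesis
  proof (rule that[of "(Max V + c) / 2" a])
    show "(Max V + c) / 2 < a \<bullet> v" if "v \<in> G" for v using that G mid(2) by simp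
    show "a \<bullet> v < (Max V + c) / 2" if "v extreme_point_of P" "v \<notin> G" for v
      using that mid(1) Max_ge[OF fin, of "a \<bullet> v"] by (auto simp: V_def)
  qed
qed

text \<open>The simplices of the stellar subdivision of \<open>K\<close> at \<open>A\<close>: those off the open star of \<open>A\<close>, and the
cones with apex \<open>n\<close> over those of them that lie in the closed star.\<close>

definition stellar :: "'l set set \<Rightarrow> 'l set \<Rightarrow> 'l \<Rightarrow> 'l set set" where
  "stellar K A n = {B \<in> K. \<not> A \<subseteq> B} \<union> insert n ` {B \<in> K. \<not> A \<subseteq> B \<and> A \<union> B \<in> K}"

text \<open>Among the cells through \<open>x\<close> one of least dimension has \<open>x\<close> in its relative interior, since otherwise
\<open>x\<close> would lie in one of its facets.\<close>

lemma (in realization) face_rel_interior: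
  assumes "x \<in> P"
  obtains B where "B \<in> K" "x \<in> rel_interior (cell P f B)"
proof -
  have "{} \<in> K \<and> x \<in> cell P f {}" using assms empty_simplex by simp
  moreover have "card B < Suc (pdim P)" if "B \<in> K \<and> x \<in> cell P f B" for B
    using that card_le_pdim[of B] by simp
  ultimately obtain B where B: "B \<in> K" "x \<in> cell P f B"
    and max: "\<And>C. C \<in> K \<and> x \<in> cell P f C \<Longrightarrow> card C \<le> card B"
    using ex_has_greatest_nat[of "\<lambda>B. B \<in> K \<and> x \<in> cell P f B" "{}" card "Suc (pdim P)"] by blast
  have "x \<in> rel_interior (cell P f B)"
  proof (rule ccontr)
    assume "x \<notin> rel_interior (cell P f B)"
    moreover have "polyhedron (cell P f B)"
      using cell_face[OF B(1)] polytope face_of_polytope_polytope polytope_imp_polyhedron by blast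
    ultimately obtain F where F: "F facet_of cell P f B" "x \<in> F"
      using rel_boundary_of_polyhedron B(2) by blast
    then have "F face_of P" using cell_face[OF B(1)] face_of_trans facet_of_imp_face_of by blast
    then obtain C where C: "C \<in> K" "F = cell P f C" using face_is_cell F(2) by blast
    have "aff_dim F = aff_dim (cell P f B) - 1" using F(1) by (simp add: facet_of_def)
    then have "card C = card B + 1" using cell_aff_dim[OF B(1)] cell_aff_dim[OF C(1)] C(2) by simp
    then show False using max[of C] C F(2) by simp
  qed
  then show ?thesis using B(1) that by blast
qed

text \<open>A face of the shaved polytope is the trace of the face \<open>F\<close> of \<open>P\<close> containing one of its relatively
interior points in its own relative interior: the trace on the half-space if that point is strictly
inside, on the hyperplane otherwise.  The first trace is a new face if \<open>F\<close> has a vertex outside the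
shaved face, that is, if its simplex does not contain \<open>A\<close>; the second one if in addition \<open>F\<close> meets
the shaved face, that is, if its simplex spans a simplex together with \<open>A\<close>.  These are the two parts of
the stellar subdivision.\<close>

lemma (in realization) realization_shave:
  fixes a :: 'a and b :: real
  assumes A: "A \<in> K" and n: "n \<notin> \<Union>K"
    and above: "\<And>v. v extreme_point_of P \<Longrightarrow> v \<in> cell P f A \<Longrightarrow> b < a \<bullet> v"
    and below: "\<And>v. v extreme_point_of P \<Longrightarrow> v \<notin> cell P f A \<Longrightarrow> a \<bullet> v < b"
    and A0: "A \<noteq> {}"
  shows "realization (P \<inter> {x. a \<bullet> x \<le> b}) (f(n := {x. a \<bullet> x = b})) (stellar K A n)"
    and "aff_dim (P \<inter> {x. a \<bullet> x \<le> b}) = aff_dim P"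
proof -
  define H where "H = {x. a \<bullet> x \<le> b}"
  define E where "E = {x. a \<bullet> x = b}"
  define g where "g = f(n := E)"
  have polyB: "polytope (cell P f B)" and convB: "convex (cell P f B)" if "B \<in> K" for B
    using cell_face[OF that] face_of_polytope_polytope[OF polytope] polytope_imp_convex by blast+
  have ext: "v extreme_point_of P" "v \<in> cell P f B" if "v extreme_point_of (cell P f B)" "B \<in> K" for v B
    using that extreme_point_of_face[OF cell_face] by blast+
  have vert: "\<exists>v. v extreme_point_of P \<and> v \<in> cell P f B" if B: "B \<in> K" for B
  proof -
    obtain M where M: "M \<in> K" "B \<subseteq> M" "card M = pdim P" using simplex_in_facet[OF B] .
    then obtain v where "cell P f M = {v}" "v extreme_point_of P" using vertex_cell by blast
    then show ?thesis using cell_antimono[OF M(2), of P f] by auto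
  qed
  have lt: "\<exists>x\<in>cell P f B. a \<bullet> x < b" if "B \<in> K" "\<not> A \<subseteq> B" for B
  proof (rule ccontr)
    assume *: "\<not> (\<exists>x\<in>cell P f B. a \<bullet> x < b)"
    have "cell P f B \<subseteq> cell P f A"
    proof (rule polytope_subset_convex)
      show "v \<in> cell P f A" if "v extreme_point_of cell P f B" for v
        using ext[OF that \<open>B \<in> K\<close>] below[of v] * by blast
    qed (use polyB convB that A in auto)
    then show False using cell_reflect[OF that(1) A] that(2) by blast
  qed
  have gt: "\<exists>x\<in>cell P f B. b < a \<bullet> x" if AB: "A \<union> B \<in> K" for B
  proof -
    obtain v where "v extreme_point_of P" "v \<in> cell P f (A \<union> B)" using vert[OF AB] by blast
    then show ?thesis using above[of v] by (auto simp: cell_Un)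
  qed
  have all_gt: "cell P f B \<subseteq> {x. b < a \<bullet> x}" if "B \<in> K" "A \<subseteq> B" for B
  proof (rule polytope_subset_convex)
    show "v \<in> {x. b < a \<bullet> x}" if "v extreme_point_of cell P f B" for v
      using ext[OF that \<open>B \<in> K\<close>] above[of v] cell_antimono[OF \<open>A \<subseteq> B\<close>, of P f] by blast
  qed (use polyB that convex_halfspace_gt in auto)
  have all_lt: "cell P f B \<subseteq> {x. a \<bullet> x < b}" if "B \<in> K" "A \<union> B \<notin> K" for B
  proof (rule polytope_subset_convex)
    have "A \<union> B \<subseteq> \<Union>K" using A that(1) by blast
    then have "cell P f (A \<union> B) = {}" using simplex_if_cell_nonempty that(2) by blast
    then show "v \<in> {x. a \<bullet> x < b}" if "v extreme_point_of cell P f B" for v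
      using ext[OF that \<open>B \<in> K\<close>] below[of v] by (auto simp: cell_Un)
  qed (use polyB that convex_halfspace_lt in auto)
  have ri_lt: "\<exists>x\<in>rel_interior (cell P f B). a \<bullet> x < b" if "B \<in> K" "\<not> A \<subseteq> B" for B
    using open_meets_rel_interior[OF convB[OF that(1)] open_halfspace_lt[of a b]] lt[OF that] by blast
  have ri_eq: "\<exists>x\<in>rel_interior (cell P f B). a \<bullet> x = b" if "B \<in> K" "\<not> A \<subseteq> B" "A \<union> B \<in> K" for B
    using hyperplane_meets_rel_interior[OF convB[OF that(1)]] lt[OF that(1,2)] gt[OF that(3)] by blast
  have cell_old: "cell (P \<inter> H) g B = cell P f B \<inter> H" if "B \<in> K" for B
    using that n by (auto simp: cell_def g_def)
  have cell_new: "cell (P \<inter> H) g (insert n B) = cell P f B \<inter> E" if "B \<in> K" for B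
    using cell_old[OF that] by (auto simp: cell_insert g_def H_def E_def)
  have ri_sub: "A' \<subseteq> B" if "B \<in> K" "A' \<in> K" "x \<in> rel_interior (cell P f B)" "x \<in> cell P f A'" for A' B x
    using subset_of_face_of[OF cell_face[OF that(2)] face_of_imp_subset[OF cell_face[OF that(1)]]]
      cell_reflect[OF that(1,2)] that(3,4) by blast
  define L where "L = stellar K A n"
  have L: "C \<in> L \<longleftrightarrow> (C \<in> K \<and> \<not> A \<subseteq> C) \<or> (\<exists>B\<in>K. C = insert n B \<and> \<not> A \<subseteq> B \<and> A \<union> B \<in> K)" for C
    by (auto simp: L_def stellar_def)
  have face_old: "cell P f B \<inter> H face_of P \<inter> H" if "B \<in> K" for B
    using face_of_slice[OF cell_face[OF that]] by (simp add: H_def convex_halfspace_le)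
  have face_new: "cell P f B \<inter> E face_of P \<inter> H" if "B \<in> K" for B
    unfolding H_def E_def using face_of_Int_Int[OF cell_face[OF that] hyperplane_face_of_halfspace_le] .
  have R: "realization (P \<inter> H) g L \<and> aff_dim (P \<inter> H) = int (pdim P)"
  proof (rule realizationI[where d = "pdim P"])
    show "polytope (P \<inter> H)"
      unfolding H_def using polytope polyhedron_halfspace_le by (rule polytope_Int_polyhedron)
    show "finite L" using finite_complex by (simp add: L_def stellar_def)
    show "finite C" if "C \<in> L" for C using that by (auto simp: L finite_simplex)
    show "{} \<in> L" using A0 empty_simplex by (simp add: L)
    show "D \<in> L" if CD: "C \<in> L" "D \<subseteq> C" for C D
    proof (cases "C \<in> K")
      case True
      then show ?thesis using CD n subset_simplex[OF True CD(2)] by (auto simp: L)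
    next
      case False
      then obtain B where B: "B \<in> K" "C = insert n B" "\<not> A \<subseteq> B" "A \<union> B \<in> K" using CD(1) by (auto simp: L)
      have D': "D - {n} \<subseteq> B" using CD(2) B(2) by blast
      have K': "D - {n} \<in> K" "A \<union> (D - {n}) \<in> K"
        using subset_simplex[OF B(1) D'] subset_simplex[OF B(4), of "A \<union> (D - {n})"] D' by blast+
      have "\<not> A \<subseteq> D - {n}" using D' B(3) by blast
      then show ?thesis using K' by (cases "n \<in> D") (auto simp: L insert_absorb intro!: bexI[of _ "D - {n}"])
    qed
    show "cell (P \<inter> H) g C face_of P \<inter> H" if "C \<in> L" for C
      using that face_old face_new by (auto simp: L cell_old cell_new)
    show "cell (P \<inter> H) g C \<noteq> {}" if "C \<in> L" for C
      using that unfolding L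
    proof
      assume "C \<in> K \<and> \<not> A \<subseteq> C"
      then show ?thesis using lt[of C] cell_old[of C] by (force simp: H_def)
    next
      assume "\<exists>B\<in>K. C = insert n B \<and> \<not> A \<subseteq> B \<and> A \<union> B \<in> K"
      then obtain B where B: "B \<in> K" "C = insert n B" "\<not> A \<subseteq> B" "A \<union> B \<in> K" by blast
      then show ?thesis
        using ri_eq[OF B(1,3,4)] rel_interior_subset[of "cell P f B"] by (auto simp: cell_new E_def)
    qed
    show "\<exists>C\<in>L. F = cell (P \<inter> H) g C" if F: "F face_of P \<inter> H" "F \<noteq> {}" for F
    proof -
      have "rel_interior F \<noteq> {}" using F face_of_imp_convex rel_interior_eq_empty by blast
      then obtain x where x: "x \<in> rel_interior F" by blast
      then have xP: "x \<in> P" "x \<in> H"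
        using rel_interior_subset[of F] face_of_imp_subset[OF F(1)] by blast+
      then obtain B where B: "B \<in> K" "x \<in> rel_interior (cell P f B)" using face_rel_interior by blast
      have xB: "x \<in> cell P f B" using B(2) rel_interior_subset by blast
      have nA: "\<not> A \<subseteq> B" using all_gt[OF B(1)] xB xP(2) by (force simp: H_def)
      show ?thesis
      proof (cases "a \<bullet> x = b")
        case True
        have AB: "A \<union> B \<in> K" using all_lt[OF B(1)] xB True by force
        have "x \<in> rel_interior (cell P f B \<inter> E)"
          using B(2) True convex_affine_rel_interior_Int[OF convB[OF B(1)], of E]
          by (auto simp: E_def affine_hyperplane)
        then have "F = cell P f B \<inter> E" using face_of_eq[OF F(1) face_new[OF B(1)]] x by blast
        then show ?thesis using B(1) nA AB cell_new[OF B(1)] L by metis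
      next
        case False
        then have "x \<in> interior H" using xP(2) open_halfspace_lt[of a b]
          unfolding H_def interior_def by force
        then have "x \<in> rel_interior (cell P f B) \<inter> rel_interior H"
          using B(2) interior_subset_rel_interior by blast
        then have "x \<in> rel_interior (cell P f B \<inter> H)"
          using convex_rel_interior_inter_two[OF convB[OF B(1)], of H]
          by (auto simp: H_def convex_halfspace_le)
        then have "F = cell P f B \<inter> H" using face_of_eq[OF F(1) face_old[OF B(1)]] x by blast
        then show ?thesis using B(1) nA cell_old[OF B(1)] L by metis
      qed
    qed
    show "D \<subseteq> C" if C: "C \<in> L" and D: "D \<in> L" and CD: "cell (P \<inter> H) g C \<subseteq> cell (P \<inter> H) g D" for C D
    proof -
      obtain D' where D': "D' \<in> K" "D = D' \<or> D = insert n D'"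
        "cell (P \<inter> H) g D \<subseteq> cell P f D'" "n \<in> D \<Longrightarrow> cell (P \<inter> H) g D \<subseteq> E"
        using D n unfolding L by (elim disjE bexE) (auto simp: cell_old cell_new)
      show ?thesis
        using C unfolding L
      proof (elim disjE bexE)
        assume C: "C \<in> K \<and> \<not> A \<subseteq> C"
        then obtain x where x: "x \<in> rel_interior (cell P f C)" "a \<bullet> x < b" using ri_lt by blast
        then have "x \<in> cell P f C \<inter> H"
          using rel_interior_subset[of "cell P f C"] by (auto simp: H_def)
        then have "x \<in> cell (P \<inter> H) g C" using C by (simp add: cell_old)
        then have "x \<in> cell (P \<inter> H) g D" using CD by blast
        then have "n \<notin> D" "D' \<subseteq> C"
          using D' ri_sub[OF _ D'(1) x(1)] x(2) C by (auto simp: E_def)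
        then show "D \<subseteq> C" using D'(2) by blast
      next
        fix B assume B: "B \<in> K" "C = insert n B \<and> \<not> A \<subseteq> B \<and> A \<union> B \<in> K"
        then obtain x where x: "x \<in> rel_interior (cell P f B)" "a \<bullet> x = b" using ri_eq by blast
        then have "x \<in> cell (P \<inter> H) g C"
          using B rel_interior_subset[of "cell P f B"] by (auto simp: cell_new E_def)
        then have "x \<in> cell P f D'" using CD D'(3) by blast
        then have "D' \<subseteq> B" using ri_sub[OF B(1) D'(1) x(1)] by blast
        then show "D \<subseteq> C" using D'(2) B(2) by blast
      qed
    qed
    show "aff_dim (P \<inter> H) \<le> int (pdim P)" using aff_dim_subset[of "P \<inter> H" P] int_pdim by simp
    show "\<exists>M\<in>L. C \<subseteq> M \<and> card M = pdim P" if "C \<in> L" for C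
      using that unfolding L
    proof (elim disjE bexE)
      assume C: "C \<in> K \<and> \<not> A \<subseteq> C"
      then obtain M where M: "M \<in> K" "C \<subseteq> M" "card M = pdim P" using simplex_in_facet by blast
      show ?thesis
      proof (cases "A \<subseteq> M")
        case True
        obtain p where p: "p \<in> A" "p \<notin> C" using C by blast
        have "M - {p} \<in> K" "A \<union> (M - {p}) \<in> K" "\<not> A \<subseteq> M - {p}"
          using subset_simplex[OF M(1)] True p M(1) by (auto simp: Un_absorb1 insert_absorb)
        then have "insert n (M - {p}) \<in> L" unfolding L by blast
        moreover have "card (insert n (M - {p})) = pdim P"
        proof -
          have "p \<in> M" "n \<notin> M" "finite M" using p True M n finite_simplex[OF M(1)] by auto
          then show ?thesis using M(3)
            by (metis DiffD1 card.remove card_insert_disjoint finite_Diff)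
        qed
        moreover have "C \<subseteq> insert n (M - {p})" using M(2) p(2) by auto
        ultimately show ?thesis by (intro bexI conjI)
      next
        case False
        then show ?thesis using M L by blast
      qed
    next
      fix B assume B: "B \<in> K" "C = insert n B \<and> \<not> A \<subseteq> B \<and> A \<union> B \<in> K"
      then obtain M where M: "M \<in> K" "A \<union> B \<subseteq> M" "card M = pdim P" using simplex_in_facet by metis
      obtain p where p: "p \<in> A" "p \<notin> B" using B by blast
      have AM: "A \<union> (M - {p}) = M" using p M(2) by blast
      then have "M - {p} \<in> K" "A \<union> (M - {p}) \<in> K" "\<not> A \<subseteq> M - {p}"
        using subset_simplex[OF M(1)] p M(1) by auto
      then have "insert n (M - {p}) \<in> L" unfolding L by blast
      moreover have "card (insert n (M - {p})) = pdim P"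
      proof -
        have "p \<in> M" "n \<notin> M" "finite M" using p M n finite_simplex[OF M(1)] by auto
        then show ?thesis using M(3)
            by (metis DiffD1 card.remove card_insert_disjoint finite_Diff)
      qed
      moreover have "C \<subseteq> insert n (M - {p})" using M(2) p(2) B(2) by auto
      ultimately show ?thesis by (intro bexI conjI)
    qed
  qed
  then show "realization (P \<inter> {x. a \<bullet> x \<le> b}) (f(n := {x. a \<bullet> x = b})) (stellar K A n)"
    "aff_dim (P \<inter> {x. a \<bullet> x \<le> b}) = aff_dim P"
    using int_pdim by (simp_all add: H_def g_def E_def L_def)
qed

section \<open>Products\<close>

lemma aff_dim_Times_le:
  fixes P :: "'a::euclidean_space set" and Q :: "'b::euclidean_space set"
  assumes "P \<noteq> {}" "Q \<noteq> {}"
  shows "aff_dim (P \<times> Q) \<le> aff_dim P + aff_dim Q"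
proof -
  obtain p q where pq: "p \<in> P" "q \<in> Q" using assms by blast
  define P0 where "P0 = (\<lambda>x. x - p) ` P"
  define Q0 where "Q0 = (\<lambda>x. x - q) ` Q"
  have "0 \<in> P0" "0 \<in> Q0" using pq by (auto simp: P0_def Q0_def)
  then have "0 \<in> affine hull P0" "0 \<in> affine hull Q0" using hull_inc by metis+
  then have dims: "aff_dim P = int (dim P0)" "aff_dim Q = int (dim Q0)"
    using aff_dim_zero aff_dim_translation_eq_subtract unfolding P0_def Q0_def by metis+
  have "(\<lambda>z. z - (p, q)) ` (P \<times> Q) \<subseteq> span P0 \<times> span Q0"
    by (auto simp: P0_def Q0_def intro: span_base)
  then have "aff_dim (P \<times> Q) \<le> aff_dim (span P0 \<times> span Q0)"
    using aff_dim_subset aff_dim_translation_eq_subtract by metis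
  also have "\<dots> = int (dim (span P0 \<times> span Q0))"
    by (intro aff_dim_subspace subspace_Times subspace_span)
  also have "\<dots> = int (dim P0) + int (dim Q0)"
    by (simp add: dim_Times)
  finally show ?thesis using dims by simp
qed

definition join :: "'l set set \<Rightarrow> 'm set set \<Rightarrow> ('l + 'm) set set" where
  "join K L = (\<lambda>(A, B). A <+> B) ` (K \<times> L)"

lemma mem_join: "C \<in> join K L \<longleftrightarrow> (\<exists>A\<in>K. \<exists>B\<in>L. C = A <+> B)"
  by (auto simp: join_def)

lemma Plus_subset_iff: "A <+> B \<subseteq> C <+> D \<longleftrightarrow> A \<subseteq> C \<and> B \<subseteq> D"
  by (auto simp: subset_iff)

lemma subset_PlusE:
  assumes "C \<subseteq> A <+> B" obtains A' B' where "A' \<subseteq> A" "B' \<subseteq> B" "C = A' <+> B'"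
proof (rule that[of "Inl -` C" "Inr -` C"])
  show "C = Inl -` C <+> Inr -` C"
  proof (intro equalityI subsetI)
    fix x assume "x \<in> C" then show "x \<in> Inl -` C <+> Inr -` C" by (cases x) auto
  qed auto
qed (use assms in auto)

lemma realization_Times:
  assumes "realization P f K" "realization Q g L"
  shows "realization (P \<times> Q) (case_sum (\<lambda>X. f X \<times> UNIV) (\<lambda>Y. UNIV \<times> g Y)) (join K L)"
    and "pdim (P \<times> Q) = pdim P + pdim Q"
proof -
  interpret P: realization P f K by fact
  interpret Q: realization Q g L by fact
  let ?h = "case_sum (\<lambda>X. f X \<times> UNIV) (\<lambda>Y. UNIV \<times> g Y)"
  have c: "cell (P \<times> Q) ?h (A <+> B) = cell P f A \<times> cell Q g B" for A B
    unfolding cell_def Plus_def INT_Un by auto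
  have R: "realization (P \<times> Q) ?h (join K L) \<and> aff_dim (P \<times> Q) = int (pdim P + pdim Q)"
  proof (rule realizationI[where d = "pdim P + pdim Q"])
    show "polytope (P \<times> Q)" using P.polytope Q.polytope by (rule polytope_Times)
    show "finite (join K L)" using P.finite_complex Q.finite_complex by (simp add: join_def)
    show "finite C" if "C \<in> join K L" for C
      using that P.finite_simplex Q.finite_simplex by (auto simp: mem_join)
    have "{} <+> {} \<in> join K L" using P.empty_simplex Q.empty_simplex unfolding mem_join by blast
    then show "{} \<in> join K L" by (simp only: Plus_eq_empty_conv[THEN iffD2] simp_thms)
    show "D \<in> join K L" if C: "C \<in> join K L" and D: "D \<subseteq> C" for C D
    proof -
      obtain A B where AB: "A \<in> K" "B \<in> L" "C = A <+> B" using C by (auto simp: mem_join)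
      then obtain A' B' where D': "A' \<subseteq> A" "B' \<subseteq> B" "D = A' <+> B'"
        using D subset_PlusE by metis
      then have "A' \<in> K" "B' \<in> L"
        using P.subset_simplex[OF AB(1)] Q.subset_simplex[OF AB(2)] by simp_all
      then show ?thesis unfolding mem_join using D'(3) by (intro bexI)
    qed
    show "cell (P \<times> Q) ?h C face_of P \<times> Q" if "C \<in> join K L" for C
      using that P.cell_face Q.cell_face unfolding mem_join by (auto simp: c face_of_Times)
    show "cell (P \<times> Q) ?h C \<noteq> {}" if "C \<in> join K L" for C
      using that P.cell_nonempty Q.cell_nonempty unfolding mem_join by (auto simp: c)
    show "\<exists>C\<in>join K L. F = cell (P \<times> Q) ?h C" if F: "F face_of P \<times> Q" "F \<noteq> {}" for F
    proof -
      obtain F1 F2 where F12: "F1 face_of P" "F2 face_of Q" "F = F1 \<times> F2"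
        using F(1) unfolding face_of_Times_decomp by (elim exE conjE)
      then have "F1 \<noteq> {}" "F2 \<noteq> {}" using F(2) by auto
      then obtain A B where AB: "A \<in> K" "F1 = cell P f A" "B \<in> L" "F2 = cell Q g B"
        using F12 P.face_is_cell[of F1] Q.face_is_cell[of F2] by blast
      have "A <+> B \<in> join K L" using AB(1,3) unfolding join_def by force
      moreover have "F = cell (P \<times> Q) ?h (A <+> B)" using F12(3) AB(2,4) c[of A B] by simp
      ultimately show ?thesis by (intro bexI)
    qed
    show "D \<subseteq> C" if C: "C \<in> join K L" and D: "D \<in> join K L"
      and sub: "cell (P \<times> Q) ?h C \<subseteq> cell (P \<times> Q) ?h D" for C D
    proof -
      obtain A B A' B' where AB: "A \<in> K" "B \<in> L" "C = A <+> B" "A' \<in> K" "B' \<in> L" "D = A' <+> B'"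
        using C D unfolding mem_join by blast
      then have "cell P f A \<subseteq> cell P f A'" "cell Q g B \<subseteq> cell Q g B'"
        using sub P.cell_nonempty[OF AB(1)] Q.cell_nonempty[OF AB(2)]
        by (simp_all add: c times_subset_iff)
      then show ?thesis using AB P.cell_reflect Q.cell_reflect by (simp add: Plus_subset_iff)
    qed
    show "aff_dim (P \<times> Q) \<le> int (pdim P + pdim Q)"
      using aff_dim_Times_le[OF P.nonempty Q.nonempty] by (simp add: P.int_pdim Q.int_pdim)
    show "\<exists>M\<in>join K L. C \<subseteq> M \<and> card M = pdim P + pdim Q" if C: "C \<in> join K L" for C
    proof -
      obtain A B where AB: "A \<in> K" "B \<in> L" "C = A <+> B" using C unfolding mem_join by blast
      obtain M where M: "M \<in> K" "A \<subseteq> M" "card M = pdim P" using P.simplex_in_facet[OF AB(1)] .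
      obtain N where N: "N \<in> L" "B \<subseteq> N" "card N = pdim Q" using Q.simplex_in_facet[OF AB(2)] .
      have "card (M <+> N) = pdim P + pdim Q"
        using M N P.finite_simplex Q.finite_simplex by (simp add: card_Plus)
      moreover have "M <+> N \<in> join K L" using M(1) N(1) unfolding join_def by force
      moreover have "C \<subseteq> M <+> N" using AB(3) M(2) N(2) by (simp add: Plus_subset_iff)
      ultimately show ?thesis by (intro bexI conjI)
    qed
  qed
  then show "realization (P \<times> Q) ?h (join K L)" by blast
  show "pdim (P \<times> Q) = pdim P + pdim Q"
    using R unfolding pdim_def[of "P \<times> Q"] by (metis nat_int)
qed

text \<open>The two end points are disjoint facets, so the complex of a segment consists of two points.\<close>

lemma realization_segment:
  fixes a b :: real
  assumes "a \<noteq> b"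
  shows "realization (closed_segment a b) (\<lambda>s. if s then {b} else {a}) {{}, {True}, {False}}"
    and "pdim (closed_segment a b) = 1"
proof -
  let ?f = "\<lambda>s. if s then {b} else {a}"
  have faces: "F face_of closed_segment a b \<longleftrightarrow> F \<in> {{}, {a}, {b}, closed_segment a b}" for F
  proof -
    have subs: "C \<subseteq> {a, b} \<longleftrightarrow> C = {} \<or> C = {a} \<or> C = {b} \<or> C = {a, b}" for C
      by (rule subset_insert_iff[THEN trans]) (auto simp: subset_singleton_iff)
    have "F face_of closed_segment a b \<longleftrightarrow> (\<exists>C. C \<subseteq> {a, b} \<and> F = convex hull C)"
      unfolding segment_convex_hull using face_of_convex_hull_affine_independent[of "{a, b}"]
      by simp
    also have "\<dots> \<longleftrightarrow> F \<in> {{}, {a}, {b}, closed_segment a b}"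
      unfolding subs conj_disj_distribR ex_disj_distrib by (simp add: segment_convex_hull)
    finally show ?thesis .
  qed
  have c: "cell (closed_segment a b) ?f {} = closed_segment a b"
    "cell (closed_segment a b) ?f {True} = {b}" "cell (closed_segment a b) ?f {False} = {a}"
    by (auto simp: cell_def)
  have dim: "aff_dim (closed_segment a b) = 1"
    using assms by (simp add: segment_convex_hull aff_dim_convex_hull aff_dim_2)
  have ne: "a \<in> closed_segment a b" "b \<in> closed_segment a b" by auto
  show "realization (closed_segment a b) ?f {{}, {True}, {False}}"
  proof
    show "polytope (closed_segment a b)" unfolding segment_convex_hull by (simp add: polytope_convex_hull)
  qed (use assms ne in \<open>auto simp: faces c dim subset_singleton_iff\<close>)
  show "pdim (closed_segment a b) = 1" by (simp add: pdim_def dim)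
qed

section \<open>The face polynomial of a complex\<close>

text \<open>For the complex of a simple \<open>d\<close>-polytope this is \<open>F(x, t)\<close>, a face of codimension \<open>k\<close> being a simplex
with \<open>k\<close> elements.\<close>

definition simplex_sum :: "nat \<Rightarrow> 'l set set \<Rightarrow> real \<Rightarrow> real \<Rightarrow> real" where
  "simplex_sum d K x t = (\<Sum>A\<in>K. x ^ (d - card A) * t ^ card A)"

lemma (in realization) F_poly_eq: "F_poly P x t = simplex_sum (pdim P) K x t"
proof -
  let ?d = "pdim P"
  have fn: "face_number P i = card {A \<in> K. ?d - card A = i}" if "i \<le> ?d" for i
  proof -
    have "{F. F face_of P \<and> aff_dim F = int i} = cell P f ` {A \<in> K. ?d - card A = i}"
    proof (intro equalityI subsetI)
      fix F assume F: "F \<in> {F. F face_of P \<and> aff_dim F = int i}"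
      then have "F \<noteq> {}" by auto
      then obtain A where A: "A \<in> K" "F = cell P f A" using F face_is_cell by auto
      then have "?d - card A = i"
        using cell_aff_dim[OF A(1)] int_pdim F by auto
      then show "F \<in> cell P f ` {A \<in> K. ?d - card A = i}" using A by auto
    next
      fix F assume "F \<in> cell P f ` {A \<in> K. ?d - card A = i}"
      then obtain A where A: "A \<in> K" "?d - card A = i" "F = cell P f A" by auto
      then have "aff_dim F = int i"
        using cell_aff_dim[OF A(1)] int_pdim card_le_pdim[OF A(1)] by auto
      then show "F \<in> {F. F face_of P \<and> aff_dim F = int i}" using A cell_face by auto
    qed
    moreover have "inj_on (cell P f) {A \<in> K. ?d - card A = i}"
      using cell_eq_iff by (auto intro!: inj_onI)
    ultimately show ?thesis by (simp add: face_number_def card_image)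
  qed
  have "simplex_sum ?d K x t
      = (\<Sum>i\<in>{..?d}. \<Sum>A\<in>{A. A \<in> K \<and> ?d - card A = i}. x ^ (?d - card A) * t ^ card A)"
    unfolding simplex_sum_def using finite_complex by (subst sum.group) auto
  also have "\<dots> = (\<Sum>i\<le>?d. real (face_number P i) * x ^ i * t ^ (?d - i))"
  proof (rule sum.cong[OF refl])
    fix i assume i: "i \<in> {..?d}"
    have "(\<Sum>A\<in>{A. A \<in> K \<and> ?d - card A = i}. x ^ (?d - card A) * t ^ card A)
        = (\<Sum>A\<in>{A. A \<in> K \<and> ?d - card A = i}. x ^ i * t ^ (?d - i))"
      using card_le_pdim by (intro sum.cong) (auto intro!: arg_cong[where f = "\<lambda>k. t ^ k"])
    then show "(\<Sum>A\<in>{A. A \<in> K \<and> ?d - card A = i}. x ^ (?d - card A) * t ^ card A)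
        = real (face_number P i) * x ^ i * t ^ (?d - i)"
      using fn[of i] i by simp
  qed
  finally show ?thesis by (simp add: F_poly_def)
qed

lemma (in realization) H_poly_eq: "H_poly P \<alpha> t = simplex_sum (pdim P) K (\<alpha> - t) t"
  by (simp add: H_poly_def F_poly_eq)

lemma simplex_sum_relabel:
  assumes "inj_on \<sigma> (\<Union>K)"
  shows "simplex_sum d ((`) \<sigma> ` K) x t = simplex_sum d K x t"
proof -
  have sub: "A \<subseteq> \<Union>K" if "A \<in> K" for A using that by blast
  have inj: "inj_on ((`) \<sigma>) K"
    using assms sub by (intro inj_onI) (metis inj_on_image_eq_iff)
  have "card (\<sigma> ` A) = card A" if "A \<in> K" for A
    using assms sub[OF that] by (metis card_image inj_on_subset)
  then show ?thesis by (simp add: simplex_sum_def sum.reindex[OF inj])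
qed

lemma Plus_eq_iff: "A <+> B = C <+> D \<longleftrightarrow> A = C \<and> B = D"
  unfolding set_eq_subset Plus_subset_iff by blast

lemma simplex_sum_join:
  assumes "finite K" "finite L" "\<And>A. A \<in> K \<Longrightarrow> finite A \<and> card A \<le> d"
    "\<And>B. B \<in> L \<Longrightarrow> finite B \<and> card B \<le> e"
  shows "simplex_sum (d + e) (join K L) x t = simplex_sum d K x t * simplex_sum e L x t"
proof -
  have inj: "inj_on (\<lambda>(A, B). A <+> B) (K \<times> L)"
  proof (rule inj_onI)
    fix u v assume "(case u of (A, B) \<Rightarrow> A <+> B) = (case v of (A, B) \<Rightarrow> A <+> B)"
    then show "u = v" by (cases u; cases v) (simp add: Plus_eq_iff)
  qed
  have *: "x ^ (d + e - card (A <+> B)) * t ^ card (A <+> B)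
      = (x ^ (d - card A) * t ^ card A) * (x ^ (e - card B) * t ^ card B)"
    if "A \<in> K" "B \<in> L" for A B
  proof -
    have "card (A <+> B) = card A + card B" using assms(3)[OF that(1)] assms(4)[OF that(2)]
      by (simp add: card_Plus)
    moreover have "d + e - (card A + card B) = (d - card A) + (e - card B)"
      using assms(3)[OF that(1)] assms(4)[OF that(2)] by simp
    ultimately show ?thesis by (simp add: power_add)
  qed
  have "simplex_sum (d + e) (join K L) x t
      = (\<Sum>(A, B)\<in>K \<times> L. x ^ (d + e - card (A <+> B)) * t ^ card (A <+> B))"
    unfolding simplex_sum_def join_def by (subst sum.reindex[OF inj]) (simp add: case_prod_unfold)
  also have "\<dots> = (\<Sum>(A, B)\<in>K \<times> L. (x ^ (d - card A) * t ^ card A) * (x ^ (e - card B) * t ^ card B))"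
    using * by (intro sum.cong) auto
  finally show ?thesis
    by (simp add: simplex_sum_def sum_product sum.cartesian_product)
qed

text \<open>Every simplex \<open>C\<close> of the link loses the simplex it spans with both \<open>p\<close> and \<open>q\<close>, of weight \<open>t\<^sup>2\<close>
relative to \<open>C\<close>, and gains its cones over \<open>n\<close>, over \<open>n, p\<close> and over \<open>n, q\<close>, of weights \<open>x t\<close>,
\<open>t\<^sup>2\<close> and \<open>t\<^sup>2\<close>.\<close>

lemma simplex_sum_stellar_edge:
  assumes K: "finite K" "\<And>A. A \<in> K \<Longrightarrow> finite A \<and> card A \<le> d"
    and down: "\<And>A B. A \<in> K \<Longrightarrow> B \<subseteq> A \<Longrightarrow> B \<in> K"
    and pq: "p \<noteq> q" "{p, q} \<in> K" and n: "n \<notin> \<Union>K"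
  shows "simplex_sum d (stellar K {p, q} n) x t
    = simplex_sum d K x t + t * (x + t) * simplex_sum (d - 2) (link K {p, q}) x t"
proof -
  define h where "h B = x ^ (d - card B) * t ^ card B" for B :: "'a set"
  define L where "L = link K {p, q}"
  define K1 where "K1 = {B \<in> K. \<not> {p, q} \<subseteq> B}"
  have LK: "C \<in> L \<longleftrightarrow> p \<notin> C \<and> q \<notin> C \<and> {p, q} \<union> C \<in> K" for C
    by (auto simp: L_def link_def)
  have LinK: "L \<subseteq> K"
  proof
    fix C assume "C \<in> L"
    then have "{p, q} \<union> C \<in> K" by (simp add: LK)
    then show "C \<in> K" by (rule down) blast
  qed
  have finL: "finite L" using LinK K(1) finite_subset by blast
  have np: "n \<noteq> p" "n \<noteq> q" using n pq by auto
  have nC: "n \<notin> C" "p \<notin> C" "q \<notin> C" "finite C" "card C + 2 \<le> d" if "C \<in> L" for C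
  proof -
    show C: "n \<notin> C" "p \<notin> C" "q \<notin> C" "finite C" using that LinK n K(2) by (auto simp: LK)
    have "card ({p, q} \<union> C) \<le> d" using that K(2) by (auto simp: LK)
    then show "card C + 2 \<le> d" using C pq by simp
  qed
  have big: "{B \<in> K. {p, q} \<subseteq> B} = (\<union>) {p, q} ` L"
  proof (intro equalityI subsetI)
    fix B assume B: "B \<in> {B \<in> K. {p, q} \<subseteq> B}"
    then have "B = {p, q} \<union> (B - {p, q})" by blast
    moreover from this B have "B - {p, q} \<in> L" by (simp add: LK insert_absorb)
    ultimately show "B \<in> (\<union>) {p, q} ` L" by (rule image_eqI)
  qed (auto simp: LK)
  have new: "{B \<in> K. \<not> {p, q} \<subseteq> B \<and> {p, q} \<union> B \<in> K} = L \<union> (insert p ` L \<union> insert q ` L)"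
  proof (intro equalityI subsetI)
    fix B assume B: "B \<in> {B \<in> K. \<not> {p, q} \<subseteq> B \<and> {p, q} \<union> B \<in> K}"
    then have L': "B - {p, q} \<in> L" by (auto simp: LK insert_commute)
    consider "p \<notin> B" "q \<notin> B" | "p \<in> B" "q \<notin> B" | "p \<notin> B" "q \<in> B" using B by auto
    then show "B \<in> L \<union> (insert p ` L \<union> insert q ` L)"
    proof cases
      case 1
      then show ?thesis using L' by simp
    next
      case 2
      then have "B = insert p (B - {p, q})" by auto
      then show ?thesis using L' by blast
    next
      case 3
      then have "B = insert q (B - {p, q})" by auto
      then show ?thesis using L' by blast
    qed
  next
    fix B assume "B \<in> L \<union> (insert p ` L \<union> insert q ` L)"
    then obtain C where C: "C \<in> L" "B = C \<or> B = insert p C \<or> B = insert q C" by blast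
    then have u: "{p, q} \<union> B = {p, q} \<union> C" by auto
    then have "{p, q} \<union> B \<in> K" using C by (simp add: LK)
    moreover from this have "B \<in> K" by (rule down) auto
    moreover have "\<not> {p, q} \<subseteq> B" using C pq by (auto simp: LK)
    ultimately show "B \<in> {B \<in> K. \<not> {p, q} \<subseteq> B \<and> {p, q} \<union> B \<in> K}" by blast
  qed
  have injs: "inj_on (insert p) L" "inj_on (insert q) L" "inj_on ((\<union>) {p, q}) L"
  proof -
    have "insert p C - {p} = C" "insert q C - {q} = C" "{p, q} \<union> C - {p, q} = C" if "C \<in> L" for C
      using nC(2,3)[OF that] by auto
    then show "inj_on (insert p) L" "inj_on (insert q) L" "inj_on ((\<union>) {p, q}) L"
      by (metis inj_onI)+
  qed
  have sumU: "sum g (L \<union> (insert p ` L \<union> insert q ` L)) = (\<Sum>C\<in>L. g C + g (insert p C) + g (insert q C))"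
    for g :: "'a set \<Rightarrow> real"
  proof -
    have "L \<inter> (insert p ` L \<union> insert q ` L) = {}" "insert p ` L \<inter> insert q ` L = {}"
      using nC pq by auto
    then show ?thesis
      using finL by (simp add: sum.union_disjoint sum.reindex[OF injs(1)] sum.reindex[OF injs(2)]
          sum.distrib)
  qed
  have 1: "simplex_sum d K x t = sum h K1 + (\<Sum>C\<in>L. h ({p, q} \<union> C))"
  proof -
    have "K = K1 \<union> {B \<in> K. {p, q} \<subseteq> B}" by (auto simp: K1_def)
    moreover have "K1 \<inter> {B \<in> K. {p, q} \<subseteq> B} = {}" by (auto simp: K1_def)
    moreover have "finite K1" using K(1) by (simp add: K1_def)
    ultimately have "sum h K = sum h K1 + sum h {B \<in> K. {p, q} \<subseteq> B}"
      using K(1) by (metis finite_Un sum.union_disjoint)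
    moreover have "sum h ((\<union>) {p, q} ` L) = (\<Sum>C\<in>L. h ({p, q} \<union> C))"
      by (subst sum.reindex[OF injs(3)]) (simp add: o_def)
    moreover have "simplex_sum d K x t = sum h K" by (simp add: simplex_sum_def h_def)
    ultimately show ?thesis unfolding big by simp
  qed
  have 2: "simplex_sum d (stellar K {p, q} n) x t = sum h K1
     + (\<Sum>C\<in>L. h (insert n C) + h (insert n (insert p C)) + h (insert n (insert q C)))"
  proof -
    let ?K2 = "{B \<in> K. \<not> {p, q} \<subseteq> B \<and> {p, q} \<union> B \<in> K}"
    have "insert n B - {n} = B" if "B \<in> K" for B
      using n that by auto
    then have "inj_on (insert n) ?K2" by (intro inj_onI) (metis (lifting) mem_Collect_eq)
    moreover have "K1 \<inter> insert n ` ?K2 = {}" using n by (auto simp: K1_def)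
    moreover have "finite K1" "finite ?K2" using K(1) by (simp_all add: K1_def)
    ultimately have "sum h (K1 \<union> insert n ` ?K2) = sum h K1 + (\<Sum>B\<in>?K2. h (insert n B))"
      by (simp add: sum.union_disjoint sum.reindex)
    moreover have "stellar K {p, q} n = K1 \<union> insert n ` ?K2" by (simp add: stellar_def K1_def)
    ultimately show ?thesis unfolding new sumU by (simp add: simplex_sum_def h_def)
  qed
  have 3: "h (insert n C) + h (insert n (insert p C)) + h (insert n (insert q C)) - h ({p, q} \<union> C)
      = t * (x + t) * (x ^ (d - 2 - card C) * t ^ card C)" if C: "C \<in> L" for C
  proof -
    have "d = (d - (card C + 2)) + card C + 2" using nC(5)[OF C] by simp
    then obtain m where m: "d = m + card C + 2" by blast
    show ?thesis
      using nC[OF C] np pq(1) unfolding h_def m by (simp add: algebra_simps)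
  qed
  have "simplex_sum d (stellar K {p, q} n) x t - simplex_sum d K x t
     = (\<Sum>C\<in>L. h (insert n C) + h (insert n (insert p C)) + h (insert n (insert q C)) - h ({p, q} \<union> C))"
    unfolding 1 2 by (simp add: sum_subtractf)
  also have "\<dots> = t * (x + t) * simplex_sum (d - 2) L x t"
    unfolding simplex_sum_def sum_distrib_left by (rule sum.cong[OF refl]) (rule 3)
  finally show ?thesis by (simp add: L_def)
qed

lemma simplex_sum_interval:
  fixes W :: "'l set" and x t :: real
  assumes "finite A" "W \<subseteq> A" "card A = d"
  shows "(\<Sum>B\<in>{B. A - W \<subseteq> B \<and> B \<subseteq> A}. x ^ (d - card B) * t ^ card B)
    = (x + t) ^ card W * t ^ (d - card W)"
proof -
  have fin: "finite W" using assms finite_subset by blast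
  have bij: "bij_betw (\<lambda>D. A - D) (Pow W) {B. A - W \<subseteq> B \<and> B \<subseteq> A}"
    by (rule bij_betw_byWitness[where f' = "\<lambda>B. A - B"]) (use assms(2) in auto)
  have "(\<Sum>B\<in>{B. A - W \<subseteq> B \<and> B \<subseteq> A}. x ^ (d - card B) * t ^ card B)
      = (\<Sum>D\<in>Pow W. x ^ (d - card (A - D)) * t ^ card (A - D))"
    by (rule sum.reindex_bij_betw[OF bij, symmetric])
  also have "\<dots> = (\<Sum>D\<in>Pow W. x ^ card D * t ^ card (W - D) * t ^ (d - card W))"
  proof (rule sum.cong[OF refl])
    fix D assume "D \<in> Pow W"
    then have D: "D \<subseteq> W" "D \<subseteq> A" "finite D" using assms fin finite_subset by auto
    have c: "card D \<le> card W" "card W \<le> d" using D fin assms card_mono by metis+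
    have "card (A - D) = d - card D" "card (W - D) = card W - card D"
      using D assms fin by (simp_all add: card_Diff_subset)
    then show "x ^ (d - card (A - D)) * t ^ card (A - D) = x ^ card D * t ^ card (W - D) * t ^ (d - card W)"
      using c by (simp flip: power_add)
  qed
  also have "\<dots> = (\<Sum>D\<in>Pow W. (\<Prod>i\<in>D. x) * (\<Prod>i\<in>W - D. t)) * t ^ (d - card W)"
    by (simp add: sum_distrib_right)
  also have "\<dots> = (\<Prod>i\<in>W. x + t) * t ^ (d - card W)"
    using prod_add[OF fin, of "\<lambda>_. x" "\<lambda>_. t"] by simp
  finally show ?thesis by simp
qed

section \<open>The Dehn--Sommerville equations\<close>

text \<open>The directions that identify two given points form a hyperplane, and finitely many hyperplanes do
not cover the space.\<close>

lemma generic_functional: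
  fixes V :: "'a::euclidean_space set"
  assumes "finite V"
  obtains c where "inj_on (\<lambda>v. c \<bullet> v) V"
proof -
  let ?B = "(\<lambda>(u, v). {c. (u - v) \<bullet> c = 0}) ` {(u, v). u \<in> V \<and> v \<in> V \<and> u \<noteq> v}"
  have "finite {(u, v). u \<in> V \<and> v \<in> V \<and> u \<noteq> v}"
    by (rule finite_subset[of _ "V \<times> V"]) (use assms in auto)
  then have "negligible (\<Union>?B)"
    by (intro negligible_Union) (auto intro!: negligible_hyperplane)
  then have "\<Union>?B \<noteq> UNIV" using non_negligible_UNIV by metis
  then obtain c where "c \<notin> \<Union>?B" by blast
  then have "inj_on (\<lambda>v. c \<bullet> v) V"
    by (intro inj_onI) (force simp: inner_diff_left inner_commute[of c])
  then show ?thesis by (rule that)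
qed

context realization
begin

definition vertices :: "'l set set" where
  "vertices = {A \<in> K. card A = pdim P}"

definition vertex :: "'l set \<Rightarrow> 'a" where
  "vertex A = (THE v. cell P f A = {v})"

lemma cell_vertex: "A \<in> vertices \<Longrightarrow> cell P f A = {vertex A}"
proof -
  assume "A \<in> vertices"
  then obtain v where v: "cell P f A = {v}" using vertex_cell[of A] by (auto simp: vertices_def)
  then have "vertex A = v" unfolding vertex_def by (intro the_equality) auto
  then show ?thesis using v by simp
qed

lemma vertexE:
  assumes "v extreme_point_of P" obtains A where "A \<in> vertices" "vertex A = v"
proof -
  obtain A where "A \<in> K" "card A = pdim P" "cell P f A = {v}"
    using assms extreme_point_iff by blast
  then show ?thesis using that[of A] cell_vertex[of A] by (auto simp: vertices_def)
qed

lemma vertex_extreme: "A \<in> vertices \<Longrightarrow> vertex A extreme_point_of P"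
  using extreme_point_iff cell_vertex by (auto simp: vertices_def)

lemma vertex_mem_cell: "A \<in> vertices \<Longrightarrow> B \<subseteq> A \<Longrightarrow> vertex A \<in> cell P f B"
  using cell_antimono[of B A P f] cell_vertex[of A] by auto

lemma vertex_mem_cell_iff: "A \<in> vertices \<Longrightarrow> B \<in> K \<Longrightarrow> vertex A \<in> cell P f B \<longleftrightarrow> B \<subseteq> A"
  using cell_subset_iff[of A B] cell_vertex[of A] by (auto simp: vertices_def)

lemma inj_on_vertex: "inj_on vertex vertices"
proof (rule inj_onI)
  fix A B assume AB: "A \<in> vertices" "B \<in> vertices" "vertex A = vertex B"
  then have "cell P f A = cell P f B" by (simp add: cell_vertex)
  then show "A = B" using AB cell_eq_iff by (simp add: vertices_def)
qed

lemma cell_subset_convex: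
  assumes "B \<in> K" "convex C" "\<And>A. A \<in> vertices \<Longrightarrow> B \<subseteq> A \<Longrightarrow> vertex A \<in> C"
  shows "cell P f B \<subseteq> C"
proof (rule polytope_subset_convex[OF _ assms(2)])
  show "polytope (cell P f B)"
    using face_of_polytope_polytope[OF polytope cell_face[OF assms(1)]] .
  fix v assume "v extreme_point_of cell P f B"
  then have v: "v extreme_point_of P" "v \<in> cell P f B"
    using extreme_point_of_face[OF cell_face[OF assms(1)]] by auto
  then obtain A where A: "A \<in> vertices" "vertex A = v" using vertexE by blast
  then have "B \<subseteq> A" using vertex_mem_cell_iff[OF A(1) assms(1)] v(2) by simp
  then show "v \<in> C" using assms(3) A by blast
qed

text \<open>Dropping \<open>p\<close> from the simplex of a vertex gives an edge; it descends if the vertex is its upper end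
with respect to \<open>c\<close>.\<close>

definition descends :: "'a \<Rightarrow> 'l set \<Rightarrow> 'l \<Rightarrow> bool" where
  "descends c A p \<longleftrightarrow> (\<forall>y\<in>cell P f (A - {p}). c \<bullet> y \<le> c \<bullet> vertex A)"

lemma edge_segment:
  assumes A: "A \<in> vertices" and p: "p \<in> A"
  obtains u where "cell P f (A - {p}) = closed_segment (vertex A) u" "u \<noteq> vertex A"
    "u extreme_point_of P"
proof -
  have E: "A - {p} \<in> K" using A subset_simplex[of A "A - {p}"] by (auto simp: vertices_def)
  have finA: "finite A" "card A = pdim P" "A \<in> K" using A finite_simplex by (auto simp: vertices_def)
  have "card A > 0" using p finA(1) card_gt_0_iff by blast
  then have dim1: "aff_dim (cell P f (A - {p})) = 1"
    using cell_aff_dim[OF E] p finA int_pdim by (simp add: card_Diff_singleton)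
  have face: "cell P f (A - {p}) face_of P" using cell_face[OF E] .
  have "compact (cell P f (A - {p}))" "convex (cell P f (A - {p}))"
    using face polytope face_of_polytope_polytope polytope_imp_compact polytope_imp_convex by blast+
  moreover have "collinear (cell P f (A - {p}))" using dim1 by (simp add: collinear_aff_dim)
  ultimately obtain x y where xy: "cell P f (A - {p}) = closed_segment x y"
    using compact_convex_collinear_segment cell_nonempty[OF E] by blast
  have "x \<noteq> y" using dim1 xy by auto
  have ext: "v extreme_point_of P \<and> v \<in> closed_segment x y \<longleftrightarrow> v = x \<or> v = y" for v
    using extreme_point_of_face[OF face, of v] extreme_point_of_segment[of v x y] unfolding xy by blast
  have "vertex A = x \<or> vertex A = y"
    using ext vertex_extreme[OF A] vertex_mem_cell[OF A, of "A - {p}"] xy by auto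
  then show ?thesis
  proof
    assume "vertex A = x"
    then show ?thesis using that[of y] xy ext[of y] \<open>x \<noteq> y\<close> by simp
  next
    assume "vertex A = y"
    then show ?thesis using that[of x] xy ext[of x] \<open>x \<noteq> y\<close> by (simp add: closed_segment_commute)
  qed
qed

text \<open>An edge is a segment whose two ends have different values under a generic \<open>c\<close>, so it descends for
exactly one of \<open>c\<close> and \<open>- c\<close>.\<close>

lemma descends_uminus:
  assumes A: "A \<in> vertices" and p: "p \<in> A"
    and inj: "inj_on (\<lambda>v. c \<bullet> v) {v. v extreme_point_of P}"
  shows "descends (- c) A p \<longleftrightarrow> \<not> descends c A p"
proof -
  obtain u where u: "cell P f (A - {p}) = closed_segment (vertex A) u" "u \<noteq> vertex A"
    "u extreme_point_of P" using edge_segment[OF A p] .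
  have ne: "c \<bullet> u \<noteq> c \<bullet> vertex A"
    using inj_onD[OF inj, of u "vertex A"] u vertex_extreme[OF A] by auto
  have seg: "(\<forall>y\<in>closed_segment (vertex A) u. e \<bullet> y \<le> e \<bullet> vertex A) \<longleftrightarrow> e \<bullet> u \<le> e \<bullet> vertex A" for e
  proof
    assume *: "e \<bullet> u \<le> e \<bullet> vertex A"
    have "closed_segment (vertex A) u \<subseteq> {y. e \<bullet> y \<le> e \<bullet> vertex A}"
      by (rule closed_segment_subset) (use * in \<open>auto simp: convex_halfspace_le\<close>)
    then show "\<forall>y\<in>closed_segment (vertex A) u. e \<bullet> y \<le> e \<bullet> vertex A" by blast
  qed auto
  show ?thesis unfolding descends_def u(1) seg using ne by auto
qed

text \<open>The principle behind the simplex algorithm: a vertex above all its neighbours in a face is the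
maximum of the face.  Shaving off the vertex produces a facet whose vertices lie on the edges at the
vertex, so \<open>c\<close> is bounded by its value at the vertex on the slice of the face by the cutting
hyperplane.  The segment to any other vertex of the face crosses this slice, and \<open>c\<close> is linear on it.\<close>

lemma locally_maximal_vertex:
  assumes A: "A \<in> vertices" and B: "B \<subseteq> A" and desc: "\<And>p. p \<in> A - B \<Longrightarrow> descends c A p"
    and y: "y \<in> cell P f B"
  shows "c \<bullet> y \<le> c \<bullet> vertex A"
proof -
  let ?v = "vertex A"
  have AK: "A \<in> K" "card A = pdim P" and BK: "B \<in> K"
    using A B subset_simplex by (auto simp: vertices_def)
  obtain b a where above: "\<And>v. v \<in> cell P f A \<Longrightarrow> b < a \<bullet> v"
    and below: "\<And>v. v extreme_point_of P \<Longrightarrow> v \<notin> cell P f A \<Longrightarrow> a \<bullet> v < b"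
    by (rule separating_hyperplane_of_face[OF polytope cell_face[OF AK(1)]]) (rule that; blast)
  have bv: "b < a \<bullet> ?v" using above cell_vertex[OF A] by simp
  have at_vertex: "c \<bullet> vertex M \<le> c \<bullet> ?v" if M: "M \<in> vertices" "B \<subseteq> M" for M
  proof (cases "M = A")
    case False
    then have "vertex M \<noteq> ?v" using inj_on_vertex M(1) A by (auto dest: inj_onD)
    then have y_below: "a \<bullet> vertex M < b"
      using below[OF vertex_extreme[OF M(1)]] cell_vertex[OF A] by auto
    have "A \<noteq> {}"
    proof
      assume "A = {}"
      then have "pdim P = 0" using AK by simp
      then have "M = {}" using M(1) finite_simplex by (auto simp: vertices_def)
      then show False using False \<open>A = {}\<close> by simp
    qed
    \<comment> \<open>The type of labels may have no element left for the new facet, hence the detour over options.\<close>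
    let ?\<sigma> = "Some :: 'l \<Rightarrow> 'l option" let ?g = "\<lambda>X. f (the X)"
    have R: "realization P ?g ((`) ?\<sigma> ` K)"
      by (rule realization_relabel[OF realization_axioms]) auto
    interpret S: realization P ?g "(`) ?\<sigma> ` K" by (rule R)
    have cS: "cell P ?g (?\<sigma> ` C) = cell P f C" for C by (simp add: cell_def)
    have T: "realization (P \<inter> {x. a \<bullet> x \<le> b}) (?g(None := {x. a \<bullet> x = b}))
        (stellar ((`) ?\<sigma> ` K) (?\<sigma> ` A) None)"
      by (rule S.realization_shave(1)) (use above below AK(1) \<open>A \<noteq> {}\<close> in \<open>auto simp: cS\<close>)
    have dimT: "pdim (P \<inter> {x. a \<bullet> x \<le> b}) = pdim P"
      unfolding pdim_def
      by (subst S.realization_shave(2)[of "?\<sigma> ` A" None])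
        (use above below AK(1) \<open>A \<noteq> {}\<close> in \<open>auto simp: cS\<close>)
    interpret T: realization "P \<inter> {x. a \<bullet> x \<le> b}" "?g(None := {x. a \<bullet> x = b})"
      "stellar ((`) ?\<sigma> ` K) (?\<sigma> ` A) None" by (rule T)
    let ?Q = "P \<inter> {x. a \<bullet> x \<le> b}" let ?h = "?g(None := {x. a \<bullet> x = b})"
    have ch: "cell ?Q ?h (insert None (?\<sigma> ` C)) = cell P f C \<inter> {x. a \<bullet> x = b}" for C
    proof -
      have "(\<Inter>X\<in>?\<sigma> ` C. ?h X) = (\<Inter>X\<in>C. f X)"
        unfolding image_image by (simp del: fun_upd_apply add: fun_upd_other)
      then show ?thesis unfolding cell_insert unfolding cell_def by auto
    qed
    have "B \<noteq> A" using M(1,2) False A finite_simplex card_subset_eq[of M A]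
      by (auto simp: vertices_def)
    then have "\<not> A \<subseteq> B" using B by blast
    then have nB: "insert None (?\<sigma> ` B) \<in> stellar ((`) ?\<sigma> ` K) (?\<sigma> ` A) None"
      unfolding stellar_def using BK B AK(1)
      by (intro UnI2 imageI) (auto simp: image_Un[symmetric] Un_absorb2 inj_image_subset_iff)
    have "cell ?Q ?h (insert None (?\<sigma> ` B)) \<subseteq> {z. c \<bullet> z \<le> c \<bullet> ?v}"
    proof (rule T.cell_subset_convex[OF nB])
      show "convex {z. c \<bullet> z \<le> c \<bullet> ?v}" by (rule convex_halfspace_le)
      fix N assume N: "N \<in> T.vertices" "insert None (?\<sigma> ` B) \<subseteq> N"
      then have "None \<in> N" "N \<in> stellar ((`) ?\<sigma> ` K) (?\<sigma> ` A) None" "card N = pdim P"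
        by (auto simp: T.vertices_def dimT)
      then obtain C where C: "C \<in> K" "N = insert None (?\<sigma> ` C)" "?\<sigma> ` A \<union> ?\<sigma> ` C \<in> (`) ?\<sigma> ` K"
        by (auto simp: stellar_def)
      then have AC: "A \<union> C \<in> K" by (auto simp: image_Un[symmetric] inj_image_eq_iff)
      have finC: "finite C" using finite_simplex C(1) .
      have "card (A \<union> C) \<le> card A" using card_le_pdim[OF AC] AK(2) by simp
      then have "A \<union> C = A"
        using card_seteq[of "A \<union> C" A] finite_simplex[OF AC] by auto
      then have CA: "C \<subseteq> A" by blast
      have "card N = Suc (card C)" using C(2) finC by (simp add: card_image)
      then have "card (A - C) = 1"
        using CA finC \<open>card N = pdim P\<close> AK(2) by (simp add: card_Diff_subset)
      then obtain p where p: "A - C = {p}" by (metis card_1_singletonE)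
      then have Cp: "C = A - {p}" "p \<in> A" using CA by auto
      have "p \<notin> B" using N(2) C(2) p by auto
      then have "descends c A p" using desc Cp(2) by blast
      moreover have "T.vertex N \<in> cell P f C"
        using T.cell_vertex[OF N(1)] ch[of C] C(2) by auto
      ultimately show "T.vertex N \<in> {z. c \<bullet> z \<le> c \<bullet> ?v}" by (simp add: descends_def Cp(1))
    qed
    then have slice: "cell P f B \<inter> {x. a \<bullet> x = b} \<subseteq> {z. c \<bullet> z \<le> c \<bullet> ?v}" by (simp add: ch)
    have mem: "?v \<in> cell P f B" "vertex M \<in> cell P f B"
      using vertex_mem_cell A B M by auto
    define s where "s = (a \<bullet> ?v - b) / (a \<bullet> ?v - a \<bullet> vertex M)"
    have s: "0 < s" "s \<le> 1" using bv y_below by (simp_all add: s_def divide_simps)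
    define z where "z = (1 - s) *\<^sub>R ?v + s *\<^sub>R vertex M"
    have "a \<bullet> z = a \<bullet> ?v - s * (a \<bullet> ?v - a \<bullet> vertex M)"
      by (simp add: z_def inner_add_right algebra_simps)
    also have "\<dots> = b" using bv y_below by (simp add: s_def)
    finally have "a \<bullet> z = b" .
    moreover have "z \<in> cell P f B"
      unfolding z_def using cell_face[OF BK] face_of_imp_convex mem s by (intro convexD_alt) auto
    ultimately have "c \<bullet> z \<le> c \<bullet> ?v" using slice by blast
    then have "s * (c \<bullet> vertex M) \<le> s * (c \<bullet> ?v)"
      by (simp add: z_def inner_add_right algebra_simps)
    then show ?thesis using s(1) by simp
  qed simp
  have "cell P f B \<subseteq> {z. c \<bullet> z \<le> c \<bullet> ?v}"
    by (rule cell_subset_convex[OF BK]) (use at_vertex in \<open>auto simp: convex_halfspace_le\<close>)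
  then show ?thesis using y by blast
qed

lemma unique_top_vertex:
  assumes inj: "inj_on (\<lambda>v. c \<bullet> v) {v. v extreme_point_of P}" and B: "B \<in> K"
  shows "\<exists>!A. A \<in> vertices \<and> B \<subseteq> A \<and> (\<forall>y\<in>cell P f B. c \<bullet> y \<le> c \<bullet> vertex A)"
proof (rule ex_ex1I)
  let ?S = "{A \<in> vertices. B \<subseteq> A}"
  have "finite ?S" using finite_complex by (simp add: vertices_def)
  moreover have "?S \<noteq> {}" using simplex_in_facet[OF B] by (auto simp: vertices_def)
  ultimately have S: "finite ((\<lambda>A. c \<bullet> vertex A) ` ?S)" "(\<lambda>A. c \<bullet> vertex A) ` ?S \<noteq> {}" by simp_all
  obtain A where A: "A \<in> ?S" "Max ((\<lambda>A. c \<bullet> vertex A) ` ?S) = c \<bullet> vertex A"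
    using Max_in[OF S] by (rule imageE)
  have A': "c \<bullet> vertex M \<le> c \<bullet> vertex A" if "M \<in> ?S" for M
    using Max_ge[OF S(1) imageI[OF that]] A(2) by simp
  have "cell P f B \<subseteq> {y. c \<bullet> y \<le> c \<bullet> vertex A}"
    by (rule cell_subset_convex[OF B]) (use A' in \<open>auto simp: convex_halfspace_le\<close>)
  then show "\<exists>A. A \<in> vertices \<and> B \<subseteq> A \<and> (\<forall>y\<in>cell P f B. c \<bullet> y \<le> c \<bullet> vertex A)"
    using A(1) by (intro exI[of _ A]) auto
next
  fix A A'
  assume A: "A \<in> vertices \<and> B \<subseteq> A \<and> (\<forall>y\<in>cell P f B. c \<bullet> y \<le> c \<bullet> vertex A)"
    and A': "A' \<in> vertices \<and> B \<subseteq> A' \<and> (\<forall>y\<in>cell P f B. c \<bullet> y \<le> c \<bullet> vertex A')"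
  then have "c \<bullet> vertex A = c \<bullet> vertex A'"
    using vertex_mem_cell[of A B] vertex_mem_cell[of A' B] by (intro antisym) auto
  then have "vertex A = vertex A'"
    using inj_onD[OF inj] vertex_extreme A A' by blast
  then show "A = A'" using inj_onD[OF inj_on_vertex] A A' by blast
qed

text \<open>Faces are grouped by their highest vertex.  Those with highest vertex \<open>A\<close> are the ones all of whose
edges at \<open>A\<close> descend, so their simplices are obtained from \<open>A\<close> by dropping descending labels.\<close>

lemma simplex_sum_by_vertices:
  assumes inj: "inj_on (\<lambda>v. c \<bullet> v) {v. v extreme_point_of P}"
  shows "simplex_sum (pdim P) K x t = (\<Sum>A\<in>vertices.
    (x + t) ^ card {p \<in> A. descends c A p} * t ^ (pdim P - card {p \<in> A. descends c A p}))"
proof -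
  let ?top = "\<lambda>A B. A \<in> vertices \<and> B \<subseteq> A \<and> (\<forall>y\<in>cell P f B. c \<bullet> y \<le> c \<bullet> vertex A)"
  define top where "top B = (THE A. ?top A B)" for B
  have top: "?top (top B) B" if "B \<in> K" for B
    unfolding top_def by (rule theI'[OF unique_top_vertex[OF inj that]])
  have top_eq: "top B = A" if "?top A B" "B \<in> K" for A B
    unfolding top_def using unique_top_vertex[OF inj that(2)] that(1) by (rule the1_equality)
  have fin: "finite vertices" using finite_complex by (simp add: vertices_def)
  let ?h = "\<lambda>B. x ^ (pdim P - card B) * t ^ card B"
  have "simplex_sum (pdim P) K x t = (\<Sum>A\<in>vertices. \<Sum>B\<in>{B. B \<in> K \<and> top B = A}. ?h B)"
    unfolding simplex_sum_def
    by (rule sum.group[symmetric]) (use finite_complex fin top in auto)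
  also have "\<dots> = (\<Sum>A\<in>vertices.
    (x + t) ^ card {p \<in> A. descends c A p} * t ^ (pdim P - card {p \<in> A. descends c A p}))"
  proof (rule sum.cong[OF refl])
    fix A assume A: "A \<in> vertices"
    let ?W = "{p \<in> A. descends c A p}"
    have AK: "A \<in> K" "finite A" "card A = pdim P" using A finite_simplex by (auto simp: vertices_def)
    have "{B. B \<in> K \<and> top B = A} = {B. A - ?W \<subseteq> B \<and> B \<subseteq> A}"
    proof (intro equalityI subsetI)
      fix B assume "B \<in> {B. B \<in> K \<and> top B = A}"
      then have B: "B \<in> K" "?top A B" using top[of B] by auto
      have "p \<in> ?W" if "p \<in> A" "p \<notin> B" for p
      proof -
        have "cell P f (A - {p}) \<subseteq> cell P f B" by (rule cell_antimono) (use B that in blast)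
        then show ?thesis using B(2) that by (auto simp: descends_def)
      qed
      then show "B \<in> {B. A - ?W \<subseteq> B \<and> B \<subseteq> A}" using B(2) by blast
    next
      fix B assume B: "B \<in> {B. A - ?W \<subseteq> B \<and> B \<subseteq> A}"
      have "B \<in> K" using subset_simplex[OF AK(1)] B by auto
      moreover have "c \<bullet> y \<le> c \<bullet> vertex A" if y: "y \<in> cell P f B" for y
        by (rule locally_maximal_vertex[OF A _ _ y]) (use B in auto)
      ultimately show "B \<in> {B. B \<in> K \<and> top B = A}" using top_eq[of A B] A B by auto
    qed
    then show "(\<Sum>B\<in>{B. B \<in> K \<and> top B = A}. ?h B)
        = (x + t) ^ card ?W * t ^ (pdim P - card ?W)"
      using simplex_sum_interval[OF AK(2) _ AK(3), of ?W x t] by auto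
  qed
  finally show ?thesis .
qed

text \<open>In this form the equations express the symmetry of \<open>H\<close>: the second sum is the first one for \<open>- c\<close>,
which interchanges the ascending and the descending edges at each vertex.\<close>

theorem Dehn_Sommerville:
  "\<exists>(V :: 'l set set) u. finite V \<and> (\<forall>A\<in>V. u A \<le> pdim P) \<and>
    (\<forall>\<alpha> t. H_poly P \<alpha> t = (\<Sum>A\<in>V. \<alpha> ^ u A * t ^ (pdim P - u A))) \<and>
    (\<forall>\<alpha> t. H_poly P \<alpha> t = (\<Sum>A\<in>V. \<alpha> ^ (pdim P - u A) * t ^ u A))"
proof -
  have "finite {v. v extreme_point_of P}"
    using polytope polytope_imp_polyhedron finite_polyhedron_extreme_points by blast
  then obtain c where inj: "inj_on (\<lambda>v. c \<bullet> v) {v. v extreme_point_of P}"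
    using generic_functional by blast
  have inj': "inj_on (\<lambda>v. (- c) \<bullet> v) {v. v extreme_point_of P}"
    using inj by (simp add: inj_on_def)
  define u where "u A = card {p \<in> A. descends c A p}" for A
  have AK: "finite A" "card A = pdim P" if "A \<in> vertices" for A
    using that finite_simplex by (auto simp: vertices_def)
  have u: "u A \<le> pdim P" if "A \<in> vertices" for A
    using AK[OF that] unfolding u_def by (metis (no_types, lifting) card_mono mem_Collect_eq subsetI)
  have u': "card {p \<in> A. descends (- c) A p} = pdim P - u A" if "A \<in> vertices" for A
  proof -
    have "{p \<in> A. descends (- c) A p} = A - {p \<in> A. descends c A p}"
      using descends_uminus[OF that _ inj] by auto
    then show ?thesis using AK[OF that] by (simp add: u_def card_Diff_subset)
  qed
  show ?thesis
  proof (intro exI[of _ vertices] exI[of _ u] conjI ballI allI)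
    show "finite vertices" using finite_complex by (simp add: vertices_def)
    show "H_poly P \<alpha> t = (\<Sum>A\<in>vertices. \<alpha> ^ u A * t ^ (pdim P - u A))" for \<alpha> t
      using simplex_sum_by_vertices[OF inj, of "\<alpha> - t" t] by (simp add: H_poly_eq u_def)
    show "H_poly P \<alpha> t = (\<Sum>A\<in>vertices. \<alpha> ^ (pdim P - u A) * t ^ u A)" for \<alpha> t
      using simplex_sum_by_vertices[OF inj', of "\<alpha> - t" t] u by (simp add: H_poly_eq u')
  qed (rule u)
qed

end

section \<open>Gamma expansions\<close>

definition gamma_eval :: "nat \<Rightarrow> real poly \<Rightarrow> real \<Rightarrow> real \<Rightarrow> real" where
  "gamma_eval d g \<alpha> t = (\<Sum>i\<le>d div 2. coeff g i * (\<alpha> * t) ^ i * (\<alpha> + t) ^ (d - 2 * i))"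

definition gamma_expansion :: "nat \<Rightarrow> (real \<Rightarrow> real \<Rightarrow> real) \<Rightarrow> real poly \<Rightarrow> bool" where
  "gamma_expansion d \<phi> g \<longleftrightarrow> degree g \<le> d div 2 \<and> (\<forall>\<alpha> t. \<phi> \<alpha> t = gamma_eval d g \<alpha> t)"

lemma gamma_eval_add: "gamma_eval d (g + h) \<alpha> t = gamma_eval d g \<alpha> t + gamma_eval d h \<alpha> t"
  by (simp add: gamma_eval_def sum.distrib distrib_right)

lemma gamma_eval_smult: "gamma_eval d (smult c g) \<alpha> t = c * gamma_eval d g \<alpha> t"
  by (simp add: gamma_eval_def sum_distrib_left mult.assoc)

lemma gamma_eval_sum: "gamma_eval d (\<Sum>i\<in>I. g i) \<alpha> t = (\<Sum>i\<in>I. gamma_eval d (g i) \<alpha> t)"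
  by (induction I rule: infinite_finite_induct) (simp_all add: gamma_eval_add, simp_all add: gamma_eval_def)

lemma gamma_eval_monom:
  assumes "k \<le> d div 2"
  shows "gamma_eval d (monom c k) \<alpha> t = c * (\<alpha> * t) ^ k * (\<alpha> + t) ^ (d - 2 * k)"
proof -
  have "gamma_eval d (monom c k) \<alpha> t
      = (\<Sum>i\<le>d div 2. if i = k then c * (\<alpha> * t) ^ k * (\<alpha> + t) ^ (d - 2 * k) else 0)"
    unfolding gamma_eval_def by (rule sum.cong) auto
  then show ?thesis using assms by simp
qed

lemma gamma_expansion_add:
  assumes "gamma_expansion d \<phi> g" "gamma_expansion d \<psi> h"
  shows "gamma_expansion d (\<lambda>\<alpha> t. \<phi> \<alpha> t + \<psi> \<alpha> t) (g + h)"
  using assms degree_add_le[of g "d div 2" h] by (simp add: gamma_expansion_def gamma_eval_add)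

lemma gamma_expansion_smult:
  assumes "gamma_expansion d \<phi> g"
  shows "gamma_expansion d (\<lambda>\<alpha> t. c * \<phi> \<alpha> t) (smult c g)"
  using assms degree_smult_le[of c g] by (simp add: gamma_expansion_def gamma_eval_smult)

lemma gamma_expansion_zero: "gamma_expansion d (\<lambda>\<alpha> t. 0) 0"
  by (simp add: gamma_expansion_def gamma_eval_def)

lemma gamma_expansion_sum:
  assumes "finite I" "\<And>i. i \<in> I \<Longrightarrow> gamma_expansion d (\<phi> i) (g i)"
  shows "gamma_expansion d (\<lambda>\<alpha> t. \<Sum>i\<in>I. \<phi> i \<alpha> t) (\<Sum>i\<in>I. g i)"
  using assms
  by (induction I rule: finite_induct) (simp_all add: gamma_expansion_zero gamma_expansion_add)

lemma gamma_expansion_mult: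
  assumes g: "gamma_expansion d \<phi> g" and h: "gamma_expansion e \<psi> h"
  shows "gamma_expansion (d + e) (\<lambda>\<alpha> t. \<phi> \<alpha> t * \<psi> \<alpha> t) (g * h)"
proof -
  let ?m = "d div 2" and ?n = "e div 2"
  have deg: "degree g \<le> ?m" "degree h \<le> ?n" using g h by (simp_all add: gamma_expansion_def)
  have "degree (g * h) \<le> (d + e) div 2"
    using degree_mult_le[of g h] deg by simp
  moreover have "\<phi> \<alpha> t * \<psi> \<alpha> t = gamma_eval (d + e) (g * h) \<alpha> t" for \<alpha> t
  proof -
    have "g * h = (\<Sum>i\<le>?m. monom (coeff g i) i) * (\<Sum>j\<le>?n. monom (coeff h j) j)"
      using poly_as_sum_of_monoms'[OF deg(1)] poly_as_sum_of_monoms'[OF deg(2)] by simp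
    also have "\<dots> = (\<Sum>i\<le>?m. \<Sum>j\<le>?n. monom (coeff g i * coeff h j) (i + j))"
      by (simp add: sum_product mult_monom)
    finally have "gamma_eval (d + e) (g * h) \<alpha> t
        = (\<Sum>i\<le>?m. \<Sum>j\<le>?n. gamma_eval (d + e) (monom (coeff g i * coeff h j) (i + j)) \<alpha> t)"
      by (simp add: gamma_eval_sum)
    also have "\<dots> = (\<Sum>i\<le>?m. \<Sum>j\<le>?n. (coeff g i * (\<alpha> * t) ^ i * (\<alpha> + t) ^ (d - 2 * i))
        * (coeff h j * (\<alpha> * t) ^ j * (\<alpha> + t) ^ (e - 2 * j)))"
    proof (intro sum.cong refl)
      fix i j assume "i \<in> {..?m}" "j \<in> {..?n}"
      then have "i + j \<le> (d + e) div 2" "d + e - 2 * (i + j) = (d - 2 * i) + (e - 2 * j)" by auto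
      then show "gamma_eval (d + e) (monom (coeff g i * coeff h j) (i + j)) \<alpha> t
          = (coeff g i * (\<alpha> * t) ^ i * (\<alpha> + t) ^ (d - 2 * i))
          * (coeff h j * (\<alpha> * t) ^ j * (\<alpha> + t) ^ (e - 2 * j))"
        by (simp only: gamma_eval_monom power_add mult_ac)
    qed
    also have "\<dots> = gamma_eval d g \<alpha> t * gamma_eval e h \<alpha> t"
      by (simp add: gamma_eval_def sum_product)
    finally show ?thesis using g h by (simp add: gamma_expansion_def)
  qed
  ultimately show ?thesis by (simp add: gamma_expansion_def)
qed

lemma gamma_expansion_linear: "gamma_expansion 1 (\<lambda>\<alpha> t. \<alpha> + t) 1"
  by (simp add: gamma_expansion_def gamma_eval_def)

lemma gamma_expansion_product_power:
  "gamma_expansion (2 * k) (\<lambda>\<alpha> t. (\<alpha> * t) ^ k) (monom 1 k)"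
  by (simp add: gamma_expansion_def gamma_eval_monom degree_monom_le)

text \<open>On the line \<open>\<alpha> + t = 1\<close> the expansion reads off \<open>g\<close> at \<open>\<alpha> (1 - \<alpha>)\<close>, which takes all values in an
interval.\<close>

lemma gamma_expansion_unique:
  assumes g: "gamma_expansion d \<phi> g" and h: "gamma_expansion d \<phi> h"
  shows "g = h"
proof (rule ccontr)
  assume "g \<noteq> h"
  have ev: "poly p (\<alpha> * (1 - \<alpha>)) = \<phi> \<alpha> (1 - \<alpha>)" if "gamma_expansion d \<phi> p" for p \<alpha>
  proof -
    have "degree p \<le> d div 2" using that by (simp add: gamma_expansion_def)
    then have "p = (\<Sum>i\<le>d div 2. monom (coeff p i) i)" by (simp add: poly_as_sum_of_monoms')
    then have "poly p x = (\<Sum>i\<le>d div 2. coeff p i * x ^ i)" for x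
      by (metis (no_types, lifting) poly_monom poly_sum sum.cong)
    then show ?thesis using that by (simp add: gamma_expansion_def gamma_eval_def)
  qed
  have "{0..1/4} \<subseteq> {x. poly (g - h) x = 0}"
  proof
    fix s :: real assume s: "s \<in> {0..1/4}"
    \<comment> \<open>a solution of \<open>\<alpha> (1 - \<alpha>) = s\<close>\<close>
    define \<alpha> where "\<alpha> = (1 + sqrt (1 - 4 * s)) / 2"
    have "\<alpha> * (1 - \<alpha>) = (1 - (sqrt (1 - 4 * s))\<^sup>2) / 4"
      by (simp add: \<alpha>_def field_simps power2_eq_square)
    also have "\<dots> = s" using s by simp
    finally show "s \<in> {x. poly (g - h) x = 0}" using ev[OF g, of \<alpha>] ev[OF h, of \<alpha>] by simp
  qed
  moreover have "finite {x. poly (g - h) x = 0}" using \<open>g \<noteq> h\<close> by (intro poly_roots_finite) simp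
  ultimately have "finite {0..1/4::real}" by (rule finite_subset)
  then show False using infinite_Icc[of 0 "1/4::real"] by simp
qed

lemma gamma_poly_eqI:
  assumes "gamma_expansion (pdim P) (H_poly P) g"
  shows "gamma_poly P = g"
  unfolding gamma_poly_def
proof (rule the_equality)
  show "degree g \<le> pdim P div 2 \<and> (\<forall>\<alpha> t. H_poly P \<alpha> t =
      (\<Sum>i\<le>pdim P div 2. coeff g i * (\<alpha> * t) ^ i * (\<alpha> + t) ^ (pdim P - 2 * i)))"
    using assms by (simp add: gamma_expansion_def gamma_eval_def)
  fix h assume "degree h \<le> pdim P div 2 \<and> (\<forall>\<alpha> t. H_poly P \<alpha> t =
      (\<Sum>i\<le>pdim P div 2. coeff h i * (\<alpha> * t) ^ i * (\<alpha> + t) ^ (pdim P - 2 * i)))"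
  then have "gamma_expansion (pdim P) (H_poly P) h"
    by (simp add: gamma_expansion_def gamma_eval_def)
  then show "h = g" using assms by (rule gamma_expansion_unique)
qed

text \<open>Newton's recursion for power sums in terms of \<open>\<alpha> + t\<close> and \<open>\<alpha> t\<close>.\<close>

lemma gamma_expansion_power_sum: "\<exists>g. gamma_expansion m (\<lambda>\<alpha> t. \<alpha> ^ m + t ^ m) g"
proof (induction m rule: induct_nat_012)
  case 0
  then show ?case by (intro exI[of _ "[:2:]"]) (simp add: gamma_expansion_def gamma_eval_def)
next
  case 1
  then show ?case using gamma_expansion_linear by auto
next
  case (ge2 m)
  then obtain g h where g: "gamma_expansion m (\<lambda>\<alpha> t. \<alpha> ^ m + t ^ m) g"
    and h: "gamma_expansion (Suc m) (\<lambda>\<alpha> t. \<alpha> ^ Suc m + t ^ Suc m) h" by blast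
  have dims: "1 + Suc m = Suc (Suc m)" "2 * 1 + m = Suc (Suc m)" by simp_all
  have "gamma_expansion (1 + Suc m) (\<lambda>\<alpha> t. (\<alpha> + t) * (\<alpha> ^ Suc m + t ^ Suc m)) (1 * h)"
    by (rule gamma_expansion_mult[OF gamma_expansion_linear h])
  moreover have "gamma_expansion (2 * 1 + m) (\<lambda>\<alpha> t. -1 * ((\<alpha> * t) ^ 1 * (\<alpha> ^ m + t ^ m))) (smult (-1) (monom 1 1 * g))"
    by (intro gamma_expansion_smult gamma_expansion_mult gamma_expansion_product_power g)
  ultimately have "gamma_expansion (Suc (Suc m))
      (\<lambda>\<alpha> t. (\<alpha> + t) * (\<alpha> ^ Suc m + t ^ Suc m) + -1 * ((\<alpha> * t) ^ 1 * (\<alpha> ^ m + t ^ m)))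
      (1 * h + smult (-1) (monom 1 1 * g))"
    unfolding dims by (rule gamma_expansion_add)
  moreover have "(\<alpha> + t) * (\<alpha> ^ Suc m + t ^ Suc m) + -1 * ((\<alpha> * t) ^ 1 * (\<alpha> ^ m + t ^ m))
      = \<alpha> ^ Suc (Suc m) + t ^ Suc (Suc m)" for \<alpha> t :: real
    by (simp add: algebra_simps)
  ultimately show ?case by (intro exI) (simp only:)
qed

lemma gamma_expansion_symmetric_monomial:
  assumes "u \<le> d"
  shows "\<exists>g. gamma_expansion d (\<lambda>\<alpha> t. \<alpha> ^ u * t ^ (d - u) + \<alpha> ^ (d - u) * t ^ u) g"
proof -
  have *: "\<exists>g. gamma_expansion d (\<lambda>\<alpha> t. \<alpha> ^ k * t ^ (d - k) + \<alpha> ^ (d - k) * t ^ k) g"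
    if "2 * k \<le> d" for k
  proof -
    have "d = 2 * k + (d - 2 * k)" using that by simp
    then obtain m where m: "d = 2 * k + m" by (rule that)
    obtain g where "gamma_expansion m (\<lambda>\<alpha> t. \<alpha> ^ m + t ^ m) g"
      using gamma_expansion_power_sum by (rule exE)
    from gamma_expansion_mult[OF gamma_expansion_product_power[of k] this]
    have "gamma_expansion d (\<lambda>\<alpha> t. (\<alpha> * t) ^ k * (\<alpha> ^ m + t ^ m)) (monom 1 k * g)"
      by (simp add: m)
    moreover have "(\<alpha> * t) ^ k * (\<alpha> ^ m + t ^ m) = \<alpha> ^ k * t ^ (d - k) + \<alpha> ^ (d - k) * t ^ k"
      for \<alpha> t :: real
    proof -
      have "d - k = k + m" using m by simp
      then show ?thesis by (simp add: algebra_simps power_mult_distrib power_add)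
    qed
    ultimately show ?thesis by auto
  qed
  show ?thesis
  proof (cases "2 * u \<le> d")
    case True
    then show ?thesis by (rule *)
  next
    case False
    then have "2 * (d - u) \<le> d" "d - (d - u) = u" using assms by auto
    then show ?thesis using *[of "d - u"] by (simp add: add.commute)
  qed
qed

text \<open>By the Dehn--Sommerville equations \<open>H\<close> is half the sum of symmetrised monomials, each of which is a
power of \<open>\<alpha> t\<close> times a power sum.\<close>

theorem (in realization) gamma_expansion_gamma_poly:
  "gamma_expansion (pdim P) (H_poly P) (gamma_poly P)"
proof -
  obtain V :: "'l set set" and u where V: "finite V" "\<forall>A\<in>V. u A \<le> pdim P"
    and H1: "\<forall>\<alpha> t. H_poly P \<alpha> t = (\<Sum>A\<in>V. \<alpha> ^ u A * t ^ (pdim P - u A))"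
    and H2: "\<forall>\<alpha> t. H_poly P \<alpha> t = (\<Sum>A\<in>V. \<alpha> ^ (pdim P - u A) * t ^ u A)"
    using Dehn_Sommerville by (elim exE conjE)
  have "\<forall>A\<in>V. \<exists>g. gamma_expansion (pdim P)
      (\<lambda>\<alpha> t. \<alpha> ^ u A * t ^ (pdim P - u A) + \<alpha> ^ (pdim P - u A) * t ^ u A) g"
    using V(2) gamma_expansion_symmetric_monomial by blast
  then obtain g where "\<forall>A\<in>V. gamma_expansion (pdim P)
      (\<lambda>\<alpha> t. \<alpha> ^ u A * t ^ (pdim P - u A) + \<alpha> ^ (pdim P - u A) * t ^ u A) (g A)"
    by (rule bchoice[THEN exE])
  then have "gamma_expansion (pdim P) (\<lambda>\<alpha> t. \<Sum>A\<in>V.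
      \<alpha> ^ u A * t ^ (pdim P - u A) + \<alpha> ^ (pdim P - u A) * t ^ u A) (\<Sum>A\<in>V. g A)"
    using V(1) by (intro gamma_expansion_sum) auto
  then have "gamma_expansion (pdim P) (\<lambda>\<alpha> t. 1 / 2 * (\<Sum>A\<in>V.
      \<alpha> ^ u A * t ^ (pdim P - u A) + \<alpha> ^ (pdim P - u A) * t ^ u A)) (smult (1 / 2) (\<Sum>A\<in>V. g A))"
    by (rule gamma_expansion_smult)
  moreover have "1 / 2 * (\<Sum>A\<in>V. \<alpha> ^ u A * t ^ (pdim P - u A) + \<alpha> ^ (pdim P - u A) * t ^ u A)
      = H_poly P \<alpha> t" for \<alpha> t
    unfolding sum.distrib H1[rule_format, symmetric] H2[rule_format, symmetric] by simp
  ultimately have "gamma_expansion (pdim P) (\<lambda>\<alpha> t. H_poly P \<alpha> t) (smult (1 / 2) (\<Sum>A\<in>V. g A))"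
    by (simp only:)
  then show ?thesis using gamma_poly_eqI by metis
qed

section \<open>Tubes and nested families\<close>

text \<open>Disjoint tubes with no edge between them are precisely those whose union is not connected.  This
formulation refers to the building set alone, and so applies to contractions, whose building set
is known explicitly.\<close>

definition compatible :: "'v ugraph \<Rightarrow> 'v set \<Rightarrow> 'v set \<Rightarrow> bool" where
  "compatible \<Gamma> S T \<longleftrightarrow> S \<subseteq> T \<or> T \<subseteq> S \<or> S \<union> T \<notin> building_set \<Gamma>"

definition tubes :: "'v ugraph \<Rightarrow> 'v set set" where
  "tubes \<Gamma> = building_set \<Gamma> - {nodes \<Gamma>}"

text \<open>The flag complex of a relation; singletons are simplices if the relation is reflexive.\<close>

definition cliques :: "'l set \<Rightarrow> ('l \<Rightarrow> 'l \<Rightarrow> bool) \<Rightarrow> 'l set set" where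
  "cliques I R = {A. A \<subseteq> I \<and> (\<forall>x\<in>A. \<forall>y\<in>A. R x y)}"

lemma compatible_sym: "compatible \<Gamma> S T \<Longrightarrow> compatible \<Gamma> T S"
  by (auto simp: compatible_def Un_commute)

lemma compatible_refl: "compatible \<Gamma> S S"
  by (simp add: compatible_def)

locale simple_graph_loc =
  fixes \<Gamma> :: "'v ugraph"
  assumes is_simple: "simple_graph \<Gamma>"
begin

abbreviation "N \<equiv> nodes \<Gamma>"
abbreviation "E \<equiv> edges \<Gamma>"
abbreviation "B \<equiv> building_set \<Gamma>"

lemma finite_nodes: "finite N"
  and edge_nodes: "(x, y) \<in> E \<Longrightarrow> x \<in> N \<and> y \<in> N"
  and edge_sym: "(x, y) \<in> E \<Longrightarrow> (y, x) \<in> E"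
  and edge_irrefl: "(x, x) \<notin> E"
  using is_simple by (auto simp: simple_graph_def sym_def irrefl_def)

lemma building_subset: "S \<in> B \<Longrightarrow> S \<subseteq> N" and building_nonempty: "S \<in> B \<Longrightarrow> S \<noteq> {}"
  by (auto simp: mem_building_set)

lemma building_finite: "S \<in> B \<Longrightarrow> finite S"
  using building_subset finite_nodes finite_subset by blast

lemma finite_building_set: "finite B"
  using building_subset finite_nodes by (intro finite_subset[of B "Pow N"]) auto

lemma building_path:
  "S \<in> B \<Longrightarrow> x \<in> S \<Longrightarrow> y \<in> S \<Longrightarrow> (x, y) \<in> (E \<inter> S \<times> S)\<^sup>*"
  by (auto simp: mem_building_set)

lemma exit_edge:
  assumes S: "S \<in> B" and x: "x \<in> S" "x \<in> U" and z: "z \<in> S" "z \<notin> U"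
  obtains a b where "a \<in> S" "a \<in> U" "b \<in> S" "b \<notin> U" "(a, b) \<in> E"
proof -
  have "(x, z) \<in> (E \<inter> S \<times> S)\<^sup>*" using building_path S x z by blast
  then have "z \<in> U \<or> (\<exists>a b. a \<in> S \<and> a \<in> U \<and> b \<in> S \<and> b \<notin> U \<and> (a, b) \<in> E)"
  proof (induction rule: rtrancl_induct)
    case base
    then show ?case using x by simp
  next
    case (step y z)
    then show ?case by blast
  qed
  then show ?thesis using z that by blast
qed

lemma singleton_building: "i \<in> N \<Longrightarrow> {i} \<in> B"
  by (auto simp: mem_building_set)

definition touches :: "'v set \<Rightarrow> 'v set \<Rightarrow> bool" where
  "touches S T \<longleftrightarrow> (\<exists>x\<in>S. \<exists>y\<in>T. x = y \<or> (x, y) \<in> E)"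

lemma touches_mono: "touches S T \<Longrightarrow> S \<subseteq> S' \<Longrightarrow> T \<subseteq> T' \<Longrightarrow> touches S' T'"
  unfolding touches_def by blast

lemma touches_sym: "touches S T \<Longrightarrow> touches T S"
  unfolding touches_def using edge_sym by blast

lemma Un_building_iff:
  assumes S: "S \<in> B" and T: "T \<in> B"
  shows "S \<union> T \<in> B \<longleftrightarrow> touches S T"
proof
  assume U: "S \<union> T \<in> B"
  obtain x y where xy: "x \<in> S" "y \<in> T" using building_nonempty S T by blast
  show "touches S T"
  proof (cases "y \<in> S")
    case True
    then show ?thesis using xy unfolding touches_def by blast
  next
    case False
    show ?thesis
    proof (rule exit_edge[OF U, of x S y])
      fix a b assume "a \<in> S" "b \<in> S \<union> T" "b \<notin> S" "(a, b) \<in> E"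
      then show "touches S T" unfolding touches_def by blast
    qed (use xy False in auto)
  qed
next
  assume "touches S T"
  then obtain x y where xy: "x \<in> S" "y \<in> T" "x = y \<or> (x, y) \<in> E" unfolding touches_def by blast
  let ?R = "E \<inter> (S \<union> T) \<times> (S \<union> T)"
  have SR: "(p, q) \<in> ?R\<^sup>*" if "p \<in> S" "q \<in> S" for p q
    using building_path[OF S that] rtrancl_mono[of "E \<inter> S \<times> S" ?R] by blast
  have TR: "(p, q) \<in> ?R\<^sup>*" if "p \<in> T" "q \<in> T" for p q
    using building_path[OF T that] rtrancl_mono[of "E \<inter> T \<times> T" ?R] by blast
  have link: "(x, y) \<in> ?R\<^sup>*" "(y, x) \<in> ?R\<^sup>*"
    using xy edge_sym by auto
  have to: "(p, x) \<in> ?R\<^sup>*" "(x, p) \<in> ?R\<^sup>*" if "p \<in> S \<union> T" for p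
    using that SR[of p x] SR[of x p] TR[of p y] TR[of y p] xy link by (auto intro: rtrancl_trans)
  have "(p, q) \<in> ?R\<^sup>*" if "p \<in> S \<union> T" "q \<in> S \<union> T" for p q
    using to(1)[OF that(1)] to(2)[OF that(2)] by (rule rtrancl_trans)
  then show "S \<union> T \<in> B"
    unfolding mem_building_set using building_subset building_nonempty S T by blast
qed

definition component :: "'v set \<Rightarrow> 'v \<Rightarrow> 'v set" where
  "component U k = {j. (k, j) \<in> (E \<inter> U \<times> U)\<^sup>*}"

lemma component_self: "k \<in> component U k"
  by (simp add: component_def)

lemma component_subset: "k \<in> U \<Longrightarrow> component U k \<subseteq> U"
proof
  fix j assume "k \<in> U" "j \<in> component U k"
  then show "j \<in> U" unfolding component_def by (auto elim: rtranclE)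
qed

lemma component_building:
  assumes "U \<subseteq> N" "k \<in> U"
  shows "component U k \<in> B"
proof -
  let ?C = "component U k"
  let ?R = "E \<inter> ?C \<times> ?C"
  have from_k: "(k, j) \<in> ?R\<^sup>*" if "j \<in> ?C" for j
    using that unfolding component_def mem_Collect_eq
  proof (induction rule: rtrancl_induct)
    case (step y z)
    then have "y \<in> ?C" "z \<in> ?C"
      unfolding component_def using rtrancl_into_rtrancl[OF step.hyps] by simp_all
    then have "(y, z) \<in> ?R" using step.hyps by blast
    show ?case
      using step.IH \<open>(y, z) \<in> ?R\<close> unfolding component_def by (rule rtrancl_into_rtrancl)
  qed simp
  have "sym ?R" using edge_sym by (auto simp: sym_def)
  then have to_k: "(j, k) \<in> ?R\<^sup>*" if "j \<in> ?C" for j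
    using from_k[OF that] by (metis sym_rtrancl symD)
  have "(x, y) \<in> ?R\<^sup>*" if "x \<in> ?C" "y \<in> ?C" for x y
    using to_k[OF that(1)] from_k[OF that(2)] by (rule rtrancl_trans)
  moreover have "?C \<subseteq> N" using component_subset[OF assms(2)] assms(1) by blast
  ultimately show ?thesis unfolding mem_building_set using component_self by blast
qed

lemma component_absorbs:
  assumes S: "S \<in> B" "S \<subseteq> U" and C: "touches S (component U k)" and k: "k \<in> U"
  shows "S \<subseteq> component U k"
proof
  fix z assume z: "z \<in> S"
  obtain x y where xy: "x \<in> S" "y \<in> component U k" "x = y \<or> (x, y) \<in> E"
    using C unfolding touches_def by blast
  have yU: "y \<in> U" using xy(2) component_subset[OF k] by blast
  have "(k, y) \<in> (E \<inter> U \<times> U)\<^sup>*" using xy(2) by (simp add: component_def)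
  moreover have "(y, x) \<in> (E \<inter> U \<times> U)\<^sup>*" using xy yU S(2) edge_sym by auto
  moreover have "(x, z) \<in> (E \<inter> U \<times> U)\<^sup>*"
    using building_path[OF S(1) xy(1) z] rtrancl_mono[of "E \<inter> S \<times> S" "E \<inter> U \<times> U"] S(2) by blast
  ultimately show "z \<in> component U k" unfolding component_def by (auto intro: rtrancl_trans)
qed

lemma compatible_iff: "S \<in> B \<Longrightarrow> T \<in> B \<Longrightarrow> compatible \<Gamma> S T \<longleftrightarrow> S \<subseteq> T \<or> T \<subseteq> S \<or> \<not> touches S T"
  by (simp add: compatible_def Un_building_iff)

text \<open>Suppose \<open>T\<close> were covered.  An edge of \<open>T\<close> leaves a maximal member of \<open>C\<close> meeting \<open>T\<close>, and the member
containing the end of this edge touches that maximal one without being comparable to it.\<close>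

lemma nested_not_cover:
  assumes T: "T \<in> B" and CB: "C \<subseteq> B"
    and comp: "\<And>S S'. S \<in> C \<Longrightarrow> S' \<in> C \<Longrightarrow> compatible \<Gamma> S S'"
    and not: "\<And>S. S \<in> C \<Longrightarrow> \<not> T \<subseteq> S"
  obtains i where "i \<in> T" "i \<notin> \<Union>C"
proof -
  have "\<not> T \<subseteq> \<Union>C"
  proof
    assume cov: "T \<subseteq> \<Union>C"
    define D where "D = {S \<in> C. S \<inter> T \<noteq> {}}"
    have "finite D" using finite_subset[OF CB finite_building_set] by (simp add: D_def)
    moreover have "D \<noteq> {}" using cov building_nonempty[OF T] by (auto simp: D_def)
    ultimately obtain S where S: "S \<in> D" "\<forall>S'\<in>D. S \<subseteq> S' \<longrightarrow> S = S'"
      using finite_has_maximal[of D] by auto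
    then have SC: "S \<in> C" "S \<inter> T \<noteq> {}" by (auto simp: D_def)
    obtain x z where "x \<in> T" "x \<in> S" "z \<in> T" "z \<notin> S" using SC not[OF SC(1)] by blast
    then obtain a b where ab: "a \<in> T" "a \<in> S" "b \<in> T" "b \<notin> S" "(a, b) \<in> E"
      by (rule exit_edge[OF T])
    then obtain S' where S': "S' \<in> C" "b \<in> S'" using cov by blast
    then have "S' \<in> D" using ab by (auto simp: D_def)
    have "touches S S'" using ab S' unfolding touches_def by blast
    moreover have "compatible \<Gamma> S S'" using comp SC S' by blast
    ultimately have "S \<subseteq> S' \<or> S' \<subseteq> S" using compatible_iff SC S' CB by blast
    then show False
    proof
      assume "S \<subseteq> S'"
      then show False using S(2) \<open>S' \<in> D\<close> S'(2) ab(4) by blast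
    next
      assume "S' \<subseteq> S"
      then show False using S'(2) ab(4) by blast
    qed
  qed
  then show ?thesis using that by blast
qed

definition nested :: "'v set set set" where
  "nested = cliques (tubes \<Gamma>) (compatible \<Gamma>)"

lemma nestedD:
  assumes "A \<in> nested"
  shows "A \<subseteq> tubes \<Gamma>" "A \<subseteq> B" "S \<in> A \<Longrightarrow> S \<subset> N" "S \<in> A \<Longrightarrow> T \<in> A \<Longrightarrow> compatible \<Gamma> S T"
  using assms building_subset by (auto simp: nested_def cliques_def tubes_def)

lemma nested_subset: "A \<in> nested \<Longrightarrow> A' \<subseteq> A \<Longrightarrow> A' \<in> nested"
  by (auto simp: nested_def cliques_def)

lemma finite_nested: "finite nested" and nested_finite: "A \<in> nested \<Longrightarrow> finite A"
proof -
  have "nested \<subseteq> Pow B" using nestedD(2) by blast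
  then show "finite nested" using finite_building_set finite_subset by blast
  show "A \<in> nested \<Longrightarrow> finite A" using nestedD(2) finite_building_set finite_subset by blast
qed

text \<open>The summand of \<open>T\<close> contributes to the face of the nested family \<open>A\<close> the simplex on these nodes.\<close>

definition free_nodes :: "'v set set \<Rightarrow> 'v set \<Rightarrow> 'v set" where
  "free_nodes A T = T - \<Union>{S \<in> A. \<not> T \<subseteq> S}"

lemma free_nodes_nonempty:
  assumes "A \<in> nested" "T \<in> B"
  shows "free_nodes A T \<noteq> {}"
proof -
  obtain i where "i \<in> T" "i \<notin> \<Union>{S \<in> A. \<not> T \<subseteq> S}"
    using nested_not_cover[OF assms(2), of "{S \<in> A. \<not> T \<subseteq> S}"] nestedD[OF assms(1)] by blast
  then show ?thesis by (auto simp: free_nodes_def)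
qed

end

locale conn_graph_loc = simple_graph_loc \<Gamma> for \<Gamma> :: "'v ugraph" +
  assumes conn: "connected_graph \<Gamma>"
begin

lemma nodes_building: "N \<in> B"
proof -
  have "E \<inter> N \<times> N = E" using edge_nodes by auto
  then show ?thesis using conn by (auto simp: mem_building_set connected_graph_def)
qed

lemma compatible_insert_nodes:
  assumes "A \<in> nested" "S \<in> insert N A" "T \<in> insert N A"
  shows "compatible \<Gamma> S T"
proof (cases "S \<in> A \<and> T \<in> A")
  case True
  then show ?thesis using nestedD(4)[OF assms(1)] by blast
next
  case False
  moreover have "S \<subseteq> N" "T \<subseteq> N" using assms(2,3) nestedD(3)[OF assms(1)] by auto
  ultimately show ?thesis using assms(2,3) by (auto simp: compatible_def)
qed

text \<open>The summand witnessing that \<open>A\<close> does not force the facet of \<open>S\<close> belongs to the smallest member \<open>T\<close> of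
\<open>insert N A\<close> above \<open>S\<close>: a member of \<open>A\<close> meeting \<open>S\<close> and not containing \<open>T\<close> is properly contained in
\<open>S\<close>, and such members do not cover \<open>S\<close>.\<close>

lemma free_nodes_separate:
  assumes A: "A \<in> nested" and S: "insert S A \<in> nested" "S \<notin> A"
  obtains T i where "T \<in> B" "\<not> T \<subseteq> S" "i \<in> free_nodes A T" "i \<in> S"
proof -
  have AB: "A \<subseteq> B" using nestedD(2)[OF A] .
  have SB: "S \<in> B" "S \<subset> N" using nestedD[OF S(1)] by auto
  let ?U = "{T \<in> insert N A. S \<subset> T}"
  have "finite ?U" using nested_finite[OF A] by simp
  moreover have "N \<in> ?U" using SB by simp
  ultimately have "\<exists>T\<in>?U. T \<subseteq> N \<and> (\<forall>T'\<in>?U. T' \<subseteq> T \<longrightarrow> T = T')"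
    by (rule finite_has_minimal2)
  then obtain T where T: "T \<in> ?U" "\<forall>T'\<in>?U. T' \<subseteq> T \<longrightarrow> T = T'" by (elim bexE conjE)
  have TB: "T \<in> B" using T(1) AB nodes_building by auto
  let ?C = "{S' \<in> A. \<not> T \<subseteq> S' \<and> \<not> S \<subseteq> S'}"
  obtain i where i: "i \<in> S" "i \<notin> \<Union>?C"
    using nested_not_cover[OF SB(1), of ?C] AB nestedD(4)[OF A] by blast
  have "i \<notin> S'" if S': "S' \<in> A" "\<not> T \<subseteq> S'" for S'
  proof
    assume "i \<in> S'"
    then have "S \<subseteq> S'" using i S' by blast
    then have "S \<subset> S'" using S' S(2) by blast
    have "compatible \<Gamma> S' T" using compatible_insert_nodes[OF A] S' T(1) by blast
    moreover have "touches S' T" using \<open>i \<in> S'\<close> i T(1) unfolding touches_def by blast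
    ultimately have "S' \<subseteq> T" using compatible_iff[of S' T] S' AB TB by blast
    then show False using T(2) S' \<open>S \<subset> S'\<close> by blast
  qed
  then have "i \<in> free_nodes A T" using i T(1) by (auto simp: free_nodes_def)
  then show ?thesis using that TB T(1) i by blast
qed

text \<open>In a maximal nested family \<open>M\<close> each member of \<open>insert N M\<close> has exactly one node lying in no smaller
member: if there were two, a component of the member with one of them removed could be added to
\<open>M\<close>.  These nodes exhaust \<open>N\<close>.\<close>

lemma nested_in_maximal:
  assumes "A \<in> nested"
  obtains M where "M \<in> nested" "A \<subseteq> M" "card M = card N - 1"
proof -
  let ?X = "{M \<in> nested. A \<subseteq> M}"
  have "finite ?X" "?X \<noteq> {}" using assms finite_nested by auto
  then obtain M where "M \<in> ?X" "\<forall>M'\<in>?X. M \<subseteq> M' \<longrightarrow> M = M'"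
    using finite_has_maximal[of ?X] by auto
  then have M: "M \<in> nested" "A \<subseteq> M" and max: "\<And>M'. M' \<in> nested \<Longrightarrow> M \<subseteq> M' \<Longrightarrow> M = M'" by auto
  let ?M = "insert N M"
  have MB: "T \<in> B" if "T \<in> ?M" for T using that nestedD(2)[OF M(1)] nodes_building by auto
  have finM: "finite ?M" using nested_finite[OF M(1)] by simp
  have NM: "N \<notin> M" using nestedD(3)[OF M(1)] by blast
  define own where "own T = T - \<Union>{S \<in> M. S \<subset> T}" for T
  have own_ne: "own T \<noteq> {}" if T: "T \<in> ?M" for T
  proof -
    obtain i where "i \<in> T" "i \<notin> \<Union>{S \<in> M. S \<subset> T}"
      using nested_not_cover[OF MB[OF T], of "{S \<in> M. S \<subset> T}"] nestedD[OF M(1)] by blast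
    then show ?thesis by (auto simp: own_def)
  qed
  have own_disj: "own T \<inter> own T' = {}" if T: "T \<in> ?M" "T' \<in> ?M" "T \<noteq> T'" for T T'
  proof (rule ccontr)
    assume "own T \<inter> own T' \<noteq> {}"
    then obtain i where i: "i \<in> own T" "i \<in> own T'" by blast
    then have "touches T T'" by (auto simp: own_def touches_def)
    then have sub: "T \<subset> T' \<or> T' \<subset> T"
      using compatible_iff[OF MB[OF T(1)] MB[OF T(2)]] compatible_insert_nodes[OF M(1) T(1,2)] T(3) by blast
    have "T \<subset> T' \<Longrightarrow> T \<in> M" "T' \<subset> T \<Longrightarrow> T' \<in> M"
      using T building_subset[OF MB[OF T(1)]] building_subset[OF MB[OF T(2)]] by auto
    then show False using sub i by (auto simp: own_def)
  qed
  have own_single: "card (own T) = 1" if T: "T \<in> ?M" for T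
  proof (rule ccontr)
    assume not1: "card (own T) \<noteq> 1"
    obtain k where k: "k \<in> own T" using own_ne[OF T] by blast
    have "own T \<noteq> {k}" using not1 by auto
    then obtain i where ik: "i \<in> own T" "k \<in> own T" "i \<noteq> k" using k by blast
    define C where "C = component (T - {i}) k"
    have TN: "T \<subseteq> N" using building_subset[OF MB[OF T]] .
    have kT: "k \<in> T - {i}" "i \<in> T" using ik by (auto simp: own_def)
    have CB: "C \<in> B" unfolding C_def using TN kT by (intro component_building) auto
    have CT: "C \<subseteq> T - {i}" unfolding C_def using component_subset[OF kT(1)] .
    have kC: "k \<in> C" unfolding C_def by (rule component_self)
    have "C \<notin> M" using ik(2) kC CT kT(2) by (auto simp: own_def)
    have comp: "compatible \<Gamma> C S" if S: "S \<in> M" for S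
    proof -
      have SB: "S \<in> B" using MB S by blast
      consider "T \<subseteq> S" | "S \<subset> T" | "\<not> touches S T"
        using compatible_iff[OF SB MB[OF T]] compatible_insert_nodes[OF M(1) _ T, of S] S by blast
      then show ?thesis
      proof cases
        case 1
        then show ?thesis using CT by (auto simp: compatible_def)
      next
        case 2
        then have "i \<notin> S" using ik(1) S by (auto simp: own_def)
        then have "S \<subseteq> T - {i}" using 2 by blast
        then have "touches S C \<Longrightarrow> S \<subseteq> C" unfolding C_def using component_absorbs SB kT(1) by blast
        then show ?thesis using compatible_iff[OF CB SB] touches_sym by blast
      next
        case 3
        then have "\<not> touches C S" using touches_sym touches_mono[of S C S T] CT by blast
        then show ?thesis using compatible_iff[OF CB SB] by blast
      qed
    qed
    have "C \<in> tubes \<Gamma>" using CB CT TN kT by (auto simp: tubes_def)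
    then have "insert C M \<in> nested"
      using M(1) comp compatible_sym compatible_refl by (auto simp: nested_def cliques_def)
    then show False using max[of "insert C M"] \<open>C \<notin> M\<close> by blast
  qed
  have "(\<Union>T\<in>?M. own T) = N"
  proof (intro equalityI subsetI)
    fix i assume "i \<in> N"
    let ?Y = "{T \<in> ?M. i \<in> T}"
    have "finite ?Y" "N \<in> ?Y" using finM \<open>i \<in> N\<close> by auto
    then have "\<exists>T\<in>?Y. T \<subseteq> N \<and> (\<forall>T'\<in>?Y. T' \<subseteq> T \<longrightarrow> T = T')"
      by (rule finite_has_minimal2)
    then obtain T where T: "T \<in> ?Y" "\<forall>T'\<in>?Y. T' \<subseteq> T \<longrightarrow> T = T'" by (elim bexE conjE)
    then have "i \<notin> S" if "S \<in> M" "S \<subset> T" for S using that by blast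
    then have "i \<in> own T" using T(1) by (auto simp: own_def)
    then show "i \<in> (\<Union>T\<in>?M. own T)" using T(1) by blast
  next
    fix i assume "i \<in> (\<Union>T\<in>?M. own T)"
    then show "i \<in> N" using MB building_subset by (auto simp: own_def)
  qed
  then have "card N = (\<Sum>T\<in>?M. card (own T))"
    using card_UN_disjoint[of ?M own] finM own_disj building_finite MB by (auto simp: own_def)
  also have "\<dots> = card ?M" using own_single by simp
  finally have "card M = card N - 1" using NM nested_finite[OF M(1)] by simp
  then show ?thesis using that M by blast
qed

end

section \<open>The faces of a graph-associahedron\<close>

definition is_simplex_point :: "'v::finite set \<Rightarrow> real ^ 'v \<Rightarrow> bool" where
  "is_simplex_point S x \<longleftrightarrow> (\<forall>i. 0 \<le> x $ i) \<and> (\<forall>i. i \<notin> S \<longrightarrow> x $ i = 0) \<and> (\<Sum>i\<in>S. x $ i) = 1"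

lemma mem_std_simplex: "x \<in> std_simplex S \<longleftrightarrow> is_simplex_point S x"
proof
  let ?D = "{x. is_simplex_point S x}"
  have "convex ?D"
    by (auto simp: convex_def is_simplex_point_def sum.distrib sum_distrib_left[symmetric])
  moreover have "(\<lambda>i. axis i 1) ` S \<subseteq> ?D"
    by (auto simp: is_simplex_point_def axis_def)
  ultimately have "std_simplex S \<subseteq> ?D" unfolding std_simplex_def by (rule hull_minimal[rotated])
  then show "x \<in> std_simplex S \<Longrightarrow> is_simplex_point S x" by blast
next
  assume x: "is_simplex_point S x"
  have "(\<Sum>i\<in>S. x $ i *\<^sub>R axis i 1) \<in> std_simplex S"
    unfolding std_simplex_def
    by (rule convex_sum) (use x in \<open>auto simp: is_simplex_point_def intro: hull_inc\<close>)
  also have "(\<Sum>i\<in>S. x $ i *\<^sub>R axis i 1) = x"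
  proof (subst vec_eq_iff, intro allI)
    fix j
    have "(\<Sum>i\<in>S. x $ i *\<^sub>R axis i (1::real)) $ j = (\<Sum>i\<in>S. if i = j then x $ i else 0)"
      unfolding sum_component by (rule sum.cong) (auto simp: axis_def)
    also have "\<dots> = (if j \<in> S then x $ j else 0)" by simp
    also have "\<dots> = x $ j" using x by (simp add: is_simplex_point_def)
    finally show "(\<Sum>i\<in>S. x $ i *\<^sub>R axis i (1::real)) $ j = x $ j" .
  qed
  finally show "x \<in> std_simplex S" .
qed

lemma axis_in_std_simplex: "i \<in> S \<Longrightarrow> axis i 1 \<in> std_simplex S"
  unfolding std_simplex_def by (rule hull_inc) simp

lemma inner_simplex_point:
  assumes "is_simplex_point S x"
  shows "c \<bullet> x = (\<Sum>i\<in>S. c $ i * x $ i)"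
proof -
  have "c \<bullet> x = (\<Sum>i\<in>UNIV. c $ i * x $ i)" by (simp add: inner_vec_def)
  also have "\<dots> = (\<Sum>i\<in>S. c $ i * x $ i)"
    using assms by (intro sum.mono_neutral_right) (auto simp: is_simplex_point_def)
  finally show ?thesis .
qed

locale graph_assoc_loc = conn_graph_loc \<Gamma> for \<Gamma> :: "'v::finite ugraph"
begin

abbreviation "P \<equiv> graph_assoc \<Gamma>"
abbreviation "face \<equiv> cell P (assoc_facet \<Gamma>)"

definition splittings :: "('v set \<Rightarrow> real ^ 'v) set" where
  "splittings = {y. \<forall>T\<in>B. y T \<in> std_simplex T}"

lemma graph_assoc_alt: "P = {\<Sum>T\<in>B. y T | y. y \<in> splittings}"
  unfolding graph_assoc_def splittings_def using set_sum_alt[OF finite_building_set, of std_simplex]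
  by auto

lemma splitting_sum: "y \<in> splittings \<Longrightarrow> (\<Sum>T\<in>B. y T) \<in> P"
  unfolding graph_assoc_alt by blast

lemma splitting_point: "y \<in> splittings \<Longrightarrow> T \<in> B \<Longrightarrow> is_simplex_point T (y T)"
  by (simp add: splittings_def mem_std_simplex)

lemma graph_assocE:
  assumes "x \<in> P" obtains y where "y \<in> splittings" "x = (\<Sum>T\<in>B. y T)"
  using assms unfolding graph_assoc_alt by blast

lemma polytope_graph_assoc: "polytope P"
proof -
  have "P = convex hull (\<Sum>S\<in>B. (\<lambda>i. axis i 1) ` S)"
    unfolding graph_assoc_def std_simplex_def by (simp add: convex_hull_set_sum)
  moreover have "finite (\<Sum>S\<in>B. (\<lambda>i. axis i (1::real)) ` S)" by (rule finite_set_sum) simp_all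
  ultimately show ?thesis by (simp add: polytope_convex_hull)
qed

text \<open>The minimum of \<open>c\<close> on a Minkowski sum is the sum of the minima on the summands.\<close>

definition least_value :: "real ^ 'v \<Rightarrow> real" where
  "least_value c = (\<Sum>T\<in>B. Min ((\<lambda>i. c $ i) ` T))"

definition min_face :: "real ^ 'v \<Rightarrow> (real ^ 'v) set" where
  "min_face c = P \<inter> {x. c \<bullet> x = least_value c}"

lemma inner_simplex_ge:
  assumes T: "T \<in> B" and x: "is_simplex_point T x"
  shows "Min ((\<lambda>i. c $ i) ` T) \<le> c \<bullet> x"
    and "c \<bullet> x = Min ((\<lambda>i. c $ i) ` T) \<longleftrightarrow> (\<forall>i\<in>T. (\<exists>j\<in>T. c $ j < c $ i) \<longrightarrow> x $ i = 0)"
proof -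
  let ?m = "Min ((\<lambda>i. c $ i) ` T)"
  have fin: "finite T" "T \<noteq> {}" using T building_finite building_nonempty by auto
  have le: "?m \<le> c $ i" if "i \<in> T" for i using fin that by simp
  have pos: "0 \<le> (c $ i - ?m) * x $ i" if "i \<in> T" for i
    using le[OF that] x by (simp add: is_simplex_point_def)
  have one: "(\<Sum>i\<in>T. x $ i) = 1" using x by (simp add: is_simplex_point_def)
  have "(\<Sum>i\<in>T. (c $ i - ?m) * x $ i) = (\<Sum>i\<in>T. c $ i * x $ i) - ?m * (\<Sum>i\<in>T. x $ i)"
    by (simp add: left_diff_distrib sum_subtractf sum_distrib_left)
  then have diff: "c \<bullet> x - ?m = (\<Sum>i\<in>T. (c $ i - ?m) * x $ i)"
    using inner_simplex_point[OF x, of c] one by simp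
  moreover have "0 \<le> (\<Sum>i\<in>T. (c $ i - ?m) * x $ i)" using pos by (rule sum_nonneg)
  ultimately show "?m \<le> c \<bullet> x" by simp
  have "c \<bullet> x = ?m \<longleftrightarrow> (\<forall>i\<in>T. (c $ i - ?m) * x $ i = 0)"
    using diff sum_nonneg_eq_0_iff[OF fin(1) pos] by auto
  also have "\<dots> \<longleftrightarrow> (\<forall>i\<in>T. ?m < c $ i \<longrightarrow> x $ i = 0)" using le by fastforce
  also have "\<dots> \<longleftrightarrow> (\<forall>i\<in>T. (\<exists>j\<in>T. c $ j < c $ i) \<longrightarrow> x $ i = 0)"
    using fin by (simp add: Min_less_iff)
  finally show "c \<bullet> x = ?m \<longleftrightarrow> (\<forall>i\<in>T. (\<exists>j\<in>T. c $ j < c $ i) \<longrightarrow> x $ i = 0)" .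
qed

lemma least_value_le: "x \<in> P \<Longrightarrow> least_value c \<le> c \<bullet> x"
  by (elim graph_assocE)
    (auto simp: least_value_def inner_sum_right intro!: sum_mono inner_simplex_ge(1) splitting_point)

lemma mem_min_face:
  assumes y: "y \<in> splittings"
  shows "(\<Sum>T\<in>B. y T) \<in> min_face c \<longleftrightarrow>
    (\<forall>T\<in>B. \<forall>i\<in>T. (\<exists>j\<in>T. c $ j < c $ i) \<longrightarrow> y T $ i = 0)"
proof -
  let ?m = "\<lambda>T. Min ((\<lambda>i. c $ i) ` T)"
  have "(\<Sum>T\<in>B. y T) \<in> min_face c \<longleftrightarrow> (\<Sum>T\<in>B. c \<bullet> y T - ?m T) = 0"
    using splitting_sum[OF y] by (simp add: min_face_def least_value_def inner_sum_right sum_subtractf)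
  also have "\<dots> \<longleftrightarrow> (\<forall>T\<in>B. c \<bullet> y T - ?m T = 0)"
    using inner_simplex_ge(1)[OF _ splitting_point[OF y]]
    by (intro sum_nonneg_eq_0_iff finite_building_set) auto
  also have "\<dots> \<longleftrightarrow> (\<forall>T\<in>B. \<forall>i\<in>T. (\<exists>j\<in>T. c $ j < c $ i) \<longrightarrow> y T $ i = 0)"
    using inner_simplex_ge(2)[OF _ splitting_point[OF y]] by (intro ball_cong refl) simp
  finally show ?thesis .
qed

lemma min_face_face: "min_face c face_of P"
  unfolding min_face_def
  by (rule face_of_Int_supporting_hyperplane_ge)
    (use polytope_imp_convex[OF polytope_graph_assoc] least_value_le in auto)

lemma splitting_of_choice:
  assumes "\<And>T. T \<in> B \<Longrightarrow> e T \<in> T"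
  shows "(\<lambda>T. axis (e T) 1) \<in> splittings"
  using assms axis_in_std_simplex by (auto simp: splittings_def)

lemma min_face_nonempty: "min_face c \<noteq> {}"
proof -
  have "\<exists>i\<in>T. \<forall>j\<in>T. c $ i \<le> c $ j" if T: "T \<in> B" for T
  proof -
    have fin: "finite ((\<lambda>i. c $ i) ` T)" "(\<lambda>i. c $ i) ` T \<noteq> {}"
      using building_finite building_nonempty T by auto
    obtain i where i: "i \<in> T" "Min ((\<lambda>i. c $ i) ` T) = c $ i"
      using Min_in[OF fin] by (rule imageE)
    then have "c $ i \<le> c $ j" if "j \<in> T" for j
      using Min_le[OF fin(1), of "c $ j"] that by simp
    then show ?thesis using i(1) by blast
  qed
  then have "\<forall>T\<in>B. \<exists>i. i \<in> T \<and> (\<forall>j\<in>T. c $ i \<le> c $ j)" by blast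
  then obtain e where e: "\<forall>T\<in>B. e T \<in> T \<and> (\<forall>j\<in>T. c $ e T \<le> c $ j)"
    by (rule bchoice[THEN exE])
  let ?y = "\<lambda>T. axis (e T) (1::real)"
  have y: "?y \<in> splittings" using e by (intro splitting_of_choice) blast
  have "(\<Sum>T\<in>B. ?y T) \<in> min_face c"
    unfolding mem_min_face[OF y] using e by (force simp: axis_def)
  then show ?thesis by blast
qed

lemma face_is_min_face:
  assumes F: "F face_of P" "F \<noteq> {}"
  shows "\<exists>c. F = min_face c"
proof -
  have "F exposed_face_of P"
    using exposed_face_of_polyhedron[OF polytope_imp_polyhedron[OF polytope_graph_assoc]] F(1) by simp
  then obtain a b where ab: "P \<subseteq> {x. a \<bullet> x \<le> b}" "F = P \<inter> {x. a \<bullet> x = b}"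
    unfolding exposed_face_of_def by (elim conjE exE)
  obtain x where x: "x \<in> F" using F(2) by blast
  obtain z where z: "z \<in> min_face (- a)" using min_face_nonempty by blast
  have "least_value (- a) \<le> - b" using least_value_le[of x "- a"] x ab(2) by simp
  moreover have "- b \<le> least_value (- a)" using z ab(1) by (auto simp: min_face_def)
  ultimately have "least_value (- a) = - b" by simp
  then have "F = min_face (- a)" unfolding min_face_def ab(2) by auto
  then show ?thesis ..
qed

lemma assoc_facet_min_face: "assoc_facet \<Gamma> S = min_face (\<chi> i. if i \<in> S then 1 else 0)"
proof -
  let ?c = "\<chi> i. if i \<in> S then 1 else (0::real)"
  have c: "(\<Sum>i\<in>S. x $ i) = ?c \<bullet> x" for x :: "real ^ 'v"
  proof -
    have "?c \<bullet> x = (\<Sum>i\<in>UNIV. if i \<in> S then x $ i else 0)"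
      unfolding inner_vec_def by (intro sum.cong) auto
    then show ?thesis by (simp add: sum.If_cases)
  qed
  obtain z where z: "z \<in> min_face ?c" using min_face_nonempty by blast
  show ?thesis
    unfolding assoc_facet_def c
  proof (intro equalityI subsetI)
    fix x assume x: "x \<in> {x \<in> P. \<forall>y\<in>P. ?c \<bullet> x \<le> ?c \<bullet> y}"
    then have "?c \<bullet> x \<le> least_value ?c" using z by (auto simp: min_face_def)
    then show "x \<in> min_face ?c" using x least_value_le[of x ?c] by (auto simp: min_face_def)
  next
    fix x assume "x \<in> min_face ?c"
    then show "x \<in> {x \<in> P. \<forall>y\<in>P. ?c \<bullet> x \<le> ?c \<bullet> y}"
      using least_value_le[of _ ?c] by (auto simp: min_face_def)
  qed
qed

lemma mem_assoc_facet:
  assumes "y \<in> splittings"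
  shows "(\<Sum>T\<in>B. y T) \<in> assoc_facet \<Gamma> S \<longleftrightarrow> (\<forall>T\<in>B. \<not> T \<subseteq> S \<longrightarrow> (\<forall>i\<in>T \<inter> S. y T $ i = 0))"
  unfolding assoc_facet_min_face mem_min_face[OF assms] by auto

lemma mem_cell:
  assumes "y \<in> splittings"
  shows "(\<Sum>T\<in>B. y T) \<in> face A \<longleftrightarrow>
    (\<forall>T\<in>B. \<forall>i\<in>T. i \<notin> free_nodes A T \<longrightarrow> y T $ i = 0)"
  by (simp add: cell_def splitting_sum[OF assms] mem_assoc_facet[OF assms] free_nodes_def) blast

lemma cell_choice:
  assumes A: "A \<in> nested"
  obtains e where "\<And>T. T \<in> B \<Longrightarrow> e T \<in> free_nodes A T"
    "(\<lambda>T. axis (e T) 1) \<in> splittings" "(\<Sum>T\<in>B. axis (e T) 1) \<in> face A"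
proof -
  have "\<forall>T\<in>B. \<exists>i. i \<in> free_nodes A T" using free_nodes_nonempty[OF A] by blast
  then obtain e where e: "\<forall>T\<in>B. e T \<in> free_nodes A T" by (rule bchoice[THEN exE])
  have "(\<lambda>T. axis (e T) (1::real)) \<in> splittings"
    using e by (intro splitting_of_choice) (auto simp: free_nodes_def)
  moreover from this have "(\<Sum>T\<in>B. axis (e T) 1) \<in> face A"
    unfolding mem_cell[OF \<open>(\<lambda>T. axis (e T) (1::real)) \<in> splittings\<close>]
    using e by (auto simp: axis_def)
  ultimately show ?thesis using that e by blast
qed

text \<open>If \<open>S\<close> and \<open>S'\<close> are incompatible, then \<open>S \<union> S'\<close> is a summand, and on the facets of both \<open>S\<close> and
\<open>S'\<close> its point would have to vanish everywhere.\<close>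

lemma nested_if_cell_nonempty:
  assumes A: "A \<subseteq> tubes \<Gamma>" and ne: "face A \<noteq> {}"
  shows "A \<in> nested"
proof -
  obtain x where x: "x \<in> face A" using ne by blast
  then have "x \<in> P" by (simp add: cell_def)
  then obtain y where y: "y \<in> splittings" "x = (\<Sum>T\<in>B. y T)" by (rule graph_assocE)
  have "compatible \<Gamma> S S'" if "S \<in> A" "S' \<in> A" for S S'
  proof (rule ccontr)
    assume inc: "\<not> compatible \<Gamma> S S'"
    let ?T = "S \<union> S'"
    have T: "?T \<in> B" "\<not> ?T \<subseteq> S" "\<not> ?T \<subseteq> S'" using inc by (auto simp: compatible_def)
    then have "free_nodes A ?T = {}" using that unfolding free_nodes_def by blast
    then have "\<forall>i\<in>?T. y ?T $ i = 0" using x T(1) unfolding y(2) mem_cell[OF y(1)] by blast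
    then have "(\<Sum>i\<in>?T. y ?T $ i) = 0" by (intro sum.neutral)
    then show False using splitting_point[OF y(1) T(1)] by (simp add: is_simplex_point_def)
  qed
  then show ?thesis using A by (simp add: nested_def cliques_def)
qed

text \<open>The connected components, other than \<open>N\<close>, of the sets \<open>{i. c i \<ge> r}\<close>.\<close>

definition level_tubes :: "real ^ 'v \<Rightarrow> 'v set set" where
  "level_tubes c = {S \<in> tubes \<Gamma>. \<forall>k\<in>S. \<forall>j. (k, j) \<in> E \<longrightarrow> j \<notin> S \<longrightarrow> (\<forall>i\<in>S. c $ j < c $ i)}"

text \<open>If \<open>c\<close> is larger at \<open>i\<close> than somewhere else in \<open>T\<close>, the component of \<open>i\<close> in the level set of its value
does not contain \<open>T\<close>.  Conversely, \<open>T\<close> leaves each level tube through \<open>i\<close> that does not contain it,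
and it does so towards a smaller value.\<close>

lemma free_nodes_level_tubes:
  assumes T: "T \<in> B" and i: "i \<in> T"
  shows "i \<notin> free_nodes (level_tubes c) T \<longleftrightarrow> (\<exists>j\<in>T. c $ j < c $ i)"
proof
  assume "i \<notin> free_nodes (level_tubes c) T"
  then obtain S where S: "S \<in> level_tubes c" "\<not> T \<subseteq> S" "i \<in> S" using i by (auto simp: free_nodes_def)
  then obtain z where "z \<in> T" "z \<notin> S" by blast
  with T i S(3) obtain k j where kj: "k \<in> T" "k \<in> S" "j \<in> T" "j \<notin> S" "(k, j) \<in> E"
    by (rule exit_edge)
  then have "c $ j < c $ i" using S by (auto simp: level_tubes_def)
  then show "\<exists>j\<in>T. c $ j < c $ i" using kj by blast
next
  assume "\<exists>j\<in>T. c $ j < c $ i"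
  then obtain j where j: "j \<in> T" "c $ j < c $ i" by blast
  define U where "U = {k \<in> N. c $ i \<le> c $ k}"
  have iU: "i \<in> U" "U \<subseteq> N" using i T building_subset by (auto simp: U_def)
  let ?S = "component U i"
  have SU: "?S \<subseteq> U" using component_subset iU by blast
  have SB: "?S \<in> B" using component_building iU by blast
  have jS: "j \<notin> ?S" using SU j(2) by (auto simp: U_def)
  have "?S \<noteq> N" using jS j(1) T building_subset by blast
  moreover have "c $ j' < c $ i'" if "k \<in> ?S" "(k, j') \<in> E" "j' \<notin> ?S" "i' \<in> ?S" for k j' i'
  proof -
    have "j' \<notin> U"
    proof
      assume "j' \<in> U"
      then have "{j'} \<subseteq> ?S"
        using component_absorbs[of "{j'}" U i] iU that(1,2) edge_sym singleton_building
        unfolding touches_def by blast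
      then show False using that(3) by blast
    qed
    moreover have "j' \<in> N" using edge_nodes that(2) by blast
    moreover have "c $ i \<le> c $ i'" using SU that(4) by (auto simp: U_def)
    ultimately show ?thesis by (auto simp: U_def)
  qed
  ultimately have "?S \<in> level_tubes c" using SB unfolding level_tubes_def tubes_def by blast
  moreover have "\<not> T \<subseteq> ?S" using j(1) jS by blast
  ultimately show "i \<notin> free_nodes (level_tubes c) T"
    using component_self[of i U] by (auto simp: free_nodes_def)
qed

lemma min_face_eq_cell: "min_face c = face (level_tubes c)"
proof -
  have *: "(\<Sum>T\<in>B. y T) \<in> min_face c \<longleftrightarrow> (\<Sum>T\<in>B. y T) \<in> face (level_tubes c)"
    if "y \<in> splittings" for y
    unfolding mem_min_face[OF that] mem_cell[OF that]
    by (intro ball_cong refl) (simp add: free_nodes_level_tubes)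
  have "x \<in> min_face c \<longleftrightarrow> x \<in> face (level_tubes c)" for x
  proof (cases "x \<in> P")
    case True
    then show ?thesis using * by (elim graph_assocE) simp
  qed (auto simp: min_face_def cell_def)
  then show ?thesis by blast
qed

text \<open>On \<open>P\<close> the coordinate sum is the number of summands, so \<open>P\<close> lies in a dilated standard simplex.\<close>

lemma aff_dim_graph_assoc_le: "aff_dim P \<le> int (card N - 1)"
proof -
  let ?b = "real (card B)"
  let ?X = "(\<lambda>i. ?b *\<^sub>R axis i 1) ` N :: (real ^ 'v) set"
  have b0: "?b > 0" using nodes_building finite_building_set by (auto simp: card_gt_0_iff)
  have "P \<subseteq> convex hull ?X"
  proof
    fix x assume "x \<in> P"
    then obtain y where y: "y \<in> splittings" "x = (\<Sum>T\<in>B. y T)" by (rule graph_assocE)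
    note pt = splitting_point[OF y(1), unfolded is_simplex_point_def]
    have x0: "0 \<le> x $ i" for i using pt y(2) by (auto simp: sum_component intro: sum_nonneg)
    have xN: "x $ i = 0" if "i \<notin> N" for i
      using pt that building_subset unfolding y(2) sum_component by (intro sum.neutral) blast
    have "(\<Sum>i\<in>N. x $ i) = (\<Sum>T\<in>B. \<Sum>i\<in>N. y T $ i)"
      unfolding y(2) sum_component by (rule sum.swap)
    also have "\<dots> = (\<Sum>T\<in>B. 1)"
    proof (rule sum.cong[OF refl])
      fix T assume T: "T \<in> B"
      have "(\<Sum>i\<in>N. y T $ i) = (\<Sum>i\<in>T. y T $ i)"
        using pt[OF T] building_subset[OF T] finite_nodes by (intro sum.mono_neutral_right) auto
      then show "(\<Sum>i\<in>N. y T $ i) = 1" using pt[OF T] by simp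
    qed
    finally have total: "(\<Sum>i\<in>N. x $ i) = ?b" by simp
    have "(\<Sum>i\<in>N. (x $ i / ?b) *\<^sub>R (?b *\<^sub>R axis i 1)) \<in> convex hull ?X"
      by (rule convex_sum)
        (use finite_nodes total b0 x0 in \<open>auto simp: sum_divide_distrib[symmetric] intro: hull_inc\<close>)
    also have "(\<Sum>i\<in>N. (x $ i / ?b) *\<^sub>R (?b *\<^sub>R axis i (1::real))) = x"
    proof (subst vec_eq_iff, intro allI)
      fix j
      have "(\<Sum>i\<in>N. (x $ i / ?b) *\<^sub>R (?b *\<^sub>R axis i (1::real))) $ j = (\<Sum>i\<in>N. if i = j then x $ i else 0)"
        unfolding sum_component using b0 by (intro sum.cong) (auto simp: axis_def)
      also have "\<dots> = (if j \<in> N then x $ j else 0)" using finite_nodes by simp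
      also have "\<dots> = x $ j" using xN by simp
      finally show "(\<Sum>i\<in>N. (x $ i / ?b) *\<^sub>R (?b *\<^sub>R axis i (1::real))) $ j = x $ j" .
    qed
    finally show "x \<in> convex hull ?X" .
  qed
  then have "aff_dim P \<le> aff_dim ?X" using aff_dim_subset[of P "convex hull ?X"] by (simp add: aff_dim_convex_hull)
  moreover have "aff_dim ?X \<le> int (card ?X) - 1" using finite_nodes by (intro aff_dim_le_card) simp
  moreover have "card ?X \<le> card N" by (rule card_image_le[OF finite_nodes])
  moreover have "int (card N) - 1 = int (card N - 1)"
    using building_nonempty[OF nodes_building] finite_nodes by (simp add: of_nat_diff Suc_leI card_gt_0_iff)
  ultimately show ?thesis by linarith
qed

text \<open>Every face minimises a linear function \<open>c\<close>, and a point of \<open>P\<close> minimises \<open>c\<close> if each of its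
summands does, which is a condition on supports that the level tubes of \<open>c\<close> encode.  Cells of
different nested families differ by \<open>free_nodes_separate\<close>.\<close>

lemma realization_and_dim:
  "realization P (assoc_facet \<Gamma>) nested \<and> aff_dim P = int (card N - 1)"
proof (rule realizationI)
  show "polytope P" by (rule polytope_graph_assoc)
  show "finite nested" by (rule finite_nested)
  show "{} \<in> nested" by (simp add: nested_def cliques_def)
  show "aff_dim P \<le> int (card N - 1)" by (rule aff_dim_graph_assoc_le)
  fix A assume A: "A \<in> nested"
  show "finite A" using nested_finite[OF A] .
  show "A' \<in> nested" if "A' \<subseteq> A" for A' using nested_subset[OF A that] .
  show "face A \<noteq> {}" using cell_choice[OF A] by (metis empty_iff)
  show "face A face_of P"
  proof (cases "A = {}")
    case True
    then show ?thesis using polytope_imp_convex[OF polytope_graph_assoc] by (simp add: face_of_refl)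
  next
    case False
    have "face A = (\<Inter>S\<in>A. assoc_facet \<Gamma> S)"
      using False by (auto simp: cell_def assoc_facet_def)
    also have "\<dots> face_of P"
      using False by (intro face_of_Inter) (auto simp: assoc_facet_min_face min_face_face)
    finally show ?thesis .
  qed
  show "\<exists>M\<in>nested. A \<subseteq> M \<and> card M = card N - 1" using nested_in_maximal[OF A] by metis
  fix A' assume A': "A' \<in> nested" "face A \<subseteq> face A'"
  show "A' \<subseteq> A"
  proof (rule ccontr)
    assume "\<not> A' \<subseteq> A"
    then obtain S where S: "S \<in> A'" "S \<notin> A" by blast
    have sub: "face A \<subseteq> assoc_facet \<Gamma> S" using A'(2) S(1) by (auto simp: cell_def)
    then have "face (insert S A) = face A" by (auto simp: cell_insert)
    then have "face (insert S A) \<noteq> {}"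
      using \<open>face A \<noteq> {}\<close> by simp
    moreover have "insert S A \<subseteq> tubes \<Gamma>" using nestedD(1) A A'(1) S(1) by blast
    ultimately have "insert S A \<in> nested" by (intro nested_if_cell_nonempty)
    with A obtain T i where T: "T \<in> B" "\<not> T \<subseteq> S" "i \<in> free_nodes A T" "i \<in> S"
      using S(2) by (rule free_nodes_separate)
    obtain e where e: "\<And>T. T \<in> B \<Longrightarrow> e T \<in> free_nodes A T" by (rule cell_choice[OF A]) (rule that)
    define e' where "e' = e(T := i)"
    have e': "e' T' \<in> free_nodes A T'" if "T' \<in> B" for T' using e[OF that] T(3) by (simp add: e'_def)
    have e'T: "e' T = i" by (simp add: e'_def)
    let ?y = "\<lambda>T. axis (e' T) (1::real)"
    have y: "?y \<in> splittings"
      using e' by (intro splitting_of_choice) (auto simp: free_nodes_def)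
    have "(\<Sum>T\<in>B. ?y T) \<in> face A"
      unfolding mem_cell[OF y] using e' by (auto simp: axis_def)
    then have "(\<Sum>T\<in>B. ?y T) \<in> assoc_facet \<Gamma> S" using sub by blast
    then have "?y T $ i = 0"
      unfolding mem_assoc_facet[OF y] using T by (auto simp: free_nodes_def)
    then show False by (simp add: axis_def e'T)
  qed
next
  fix F assume F: "F face_of P" "F \<noteq> {}"
  then obtain c where c: "F = min_face c" using face_is_min_face by blast
  then have Fc: "F = face (level_tubes c)" by (simp add: min_face_eq_cell)
  moreover have "level_tubes c \<in> nested"
    by (rule nested_if_cell_nonempty) (use F(2) Fc in \<open>auto simp: level_tubes_def\<close>)
  ultimately show "\<exists>A\<in>nested. F = face A" by blast
qed

lemma pdim_graph_assoc: "pdim P = card N - 1"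
  using realization_and_dim by (simp add: pdim_def)

end

sublocale graph_assoc_loc \<subseteq> realization "graph_assoc \<Gamma>" "assoc_facet \<Gamma>" nested
  using realization_and_dim by blast

section \<open>Flag complexes\<close>

definition sum_rel :: "('l \<Rightarrow> 'l \<Rightarrow> bool) \<Rightarrow> ('m \<Rightarrow> 'm \<Rightarrow> bool) \<Rightarrow> 'l + 'm \<Rightarrow> 'l + 'm \<Rightarrow> bool" where
  "sum_rel R R' x y = (case x of
      Inl a \<Rightarrow> (case y of Inl b \<Rightarrow> R a b | Inr _ \<Rightarrow> True)
    | Inr a \<Rightarrow> (case y of Inl _ \<Rightarrow> True | Inr b \<Rightarrow> R' a b))"

lemma sum_rel_simps [simp]:
  "sum_rel R R' (Inl a) (Inl b) = R a b" "sum_rel R R' (Inl a) (Inr d) = True"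
  "sum_rel R R' (Inr c) (Inl b) = True" "sum_rel R R' (Inr c) (Inr d) = R' c d"
  by (simp_all add: sum_rel_def)

lemma join_cliques: "join (cliques I R) (cliques J R') = cliques (I <+> J) (sum_rel R R')"
proof (intro equalityI subsetI)
  fix C assume "C \<in> join (cliques I R) (cliques J R')"
  then obtain A B where "A \<in> cliques I R" "B \<in> cliques J R'" "C = A <+> B"
    unfolding mem_join by (elim bexE)
  then show "C \<in> cliques (I <+> J) (sum_rel R R')"
    by (auto simp: cliques_def)
next
  fix C assume C: "C \<in> cliques (I <+> J) (sum_rel R R')"
  then obtain A B where AB: "A \<subseteq> I" "B \<subseteq> J" "C = A <+> B"
    unfolding cliques_def using subset_PlusE[of C I J] by blast
  have "R x y" if "x \<in> A" "y \<in> A" for x y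
  proof -
    have "Inl x \<in> C" "Inl y \<in> C" using AB(3) that by auto
    then have "sum_rel R R' (Inl x) (Inl y)" using C unfolding cliques_def by blast
    then show ?thesis by simp
  qed
  moreover have "R' x y" if "x \<in> B" "y \<in> B" for x y
  proof -
    have "Inr x \<in> C" "Inr y \<in> C" using AB(3) that by auto
    then have "sum_rel R R' (Inr x) (Inr y)" using C unfolding cliques_def by blast
    then show ?thesis by simp
  qed
  ultimately have "A \<in> cliques I R" "B \<in> cliques J R'" using AB(1,2) by (simp_all add: cliques_def)
  then show "C \<in> join (cliques I R) (cliques J R')" unfolding mem_join using AB(3) by (intro bexI)
qed

lemma image_cliques:
  assumes "\<And>x y. x \<in> I \<Longrightarrow> y \<in> I \<Longrightarrow> R' (\<sigma> x) (\<sigma> y) \<longleftrightarrow> R x y"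
  shows "(`) \<sigma> ` cliques I R = cliques (\<sigma> ` I) R'"
proof (intro equalityI subsetI)
  fix C assume "C \<in> (`) \<sigma> ` cliques I R"
  then obtain A where "A \<in> cliques I R" "C = \<sigma> ` A" by (elim imageE)
  then show "C \<in> cliques (\<sigma> ` I) R'"
    using assms unfolding cliques_def by (auto simp: subset_iff)
next
  fix C assume C: "C \<in> cliques (\<sigma> ` I) R'"
  then have "C \<subseteq> \<sigma> ` I" by (simp add: cliques_def)
  then obtain A where A: "A \<subseteq> I" "C = \<sigma> ` A" by (auto simp: subset_image_iff)
  have "R x y" if "x \<in> A" "y \<in> A" for x y
    using C assms[of x y] A that unfolding cliques_def by blast
  then have "A \<in> cliques I R" using A(1) by (simp add: cliques_def)
  then show "C \<in> (`) \<sigma> ` cliques I R" using A(2) by (rule image_eqI[rotated])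
qed

lemma Union_cliques: "(\<And>x. x \<in> I \<Longrightarrow> R x x) \<Longrightarrow> \<Union>(cliques I R) = I"
proof (intro equalityI subsetI)
  fix x assume "\<And>x. x \<in> I \<Longrightarrow> R x x" "x \<in> I"
  then have "{x} \<in> cliques I R" by (simp add: cliques_def)
  then show "x \<in> \<Union>(cliques I R)" by blast
qed (auto simp: cliques_def)

lemma segment_cliques: "{{}, {True}, {False}} = cliques UNIV (=)"
proof -
  have "C = {} \<or> C = {True} \<or> C = {False}" if C: "\<forall>x\<in>C. \<forall>y\<in>C. x = y" for C :: "bool set"
  proof (cases "C = {}")
    case False
    then obtain x where "x \<in> C" by blast
    then have "C = {x}" using C by auto
    then show ?thesis by (cases x) simp_all
  qed simp
  then show ?thesis by (auto simp: cliques_def)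
qed

text \<open>The edge \<open>p q\<close> is replaced by a vertex \<open>n\<close> adjacent to \<open>p\<close>, \<open>q\<close> and their common neighbours.
A clique of these neighbours extends by \<open>p\<close> and \<open>q\<close> to a clique of the old relation, so flagness is
inherited.\<close>

lemma stellar_cliques:
  assumes pq: "p \<in> I" "q \<in> I" and n: "n \<notin> I"
    and R: "\<And>x. x \<in> I \<Longrightarrow> R x x" "\<And>x y. R x y \<Longrightarrow> R y x" "R p q"
    and R': "\<And>x y. R' x y \<Longrightarrow> R' y x" "R' n n" "\<not> R' p q"
    and same: "\<And>x y. x \<in> I \<Longrightarrow> y \<in> I \<Longrightarrow> {x, y} \<noteq> {p, q} \<Longrightarrow> R' x y \<longleftrightarrow> R x y"
    and new: "\<And>x. x \<in> I \<Longrightarrow> R' n x \<longleftrightarrow> R p x \<and> R q x"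
  shows "stellar (cliques I R) {p, q} n = cliques (insert n I) R'"
proof (intro equalityI subsetI)
  fix C assume "C \<in> stellar (cliques I R) {p, q} n"
  then consider "C \<in> cliques I R" "\<not> {p, q} \<subseteq> C"
    | B where "C = insert n B" "B \<in> cliques I R" "\<not> {p, q} \<subseteq> B" "{p, q} \<union> B \<in> cliques I R"
    unfolding stellar_def by blast
  then show "C \<in> cliques (insert n I) R'"
  proof cases
    case 1
    have "R' x y" if xy: "x \<in> C" "y \<in> C" for x y
    proof -
      have "{x, y} \<noteq> {p, q}" using 1(2) xy by auto
      then show ?thesis using same[of x y] 1(1) xy unfolding cliques_def by blast
    qed
    then show ?thesis using 1(1) by (auto simp: cliques_def)
  next
    case 2
    have BI: "B \<subseteq> I" using 2(2) by (simp add: cliques_def)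
    have nB: "R' n x" if "x \<in> B" for x
      using new[of x] 2(4) BI that unfolding cliques_def by blast
    have "R' x y" if xy: "x \<in> B" "y \<in> B" for x y
    proof -
      have "{x, y} \<noteq> {p, q}" using 2(3) xy by auto
      then show ?thesis using same[of x y] 2(2) xy unfolding cliques_def by blast
    qed
    then show ?thesis using BI nB R'(1,2) 2(1) by (auto simp: cliques_def)
  qed
next
  fix C assume C: "C \<in> cliques (insert n I) R'"
  let ?B = "C - {n}"
  have BI: "?B \<subseteq> I" using C by (auto simp: cliques_def)
  have CR: "R' x y" if "x \<in> C" "y \<in> C" for x y using C that by (simp add: cliques_def)
  have notpq: "\<not> {p, q} \<subseteq> C" using CR R'(3) by blast
  have Rxy: "R x y" if xy: "x \<in> ?B" "y \<in> ?B" for x y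
  proof -
    have "{x, y} \<noteq> {p, q}" using notpq xy by auto
    then show ?thesis using same[of x y] CR[of x y] BI xy by blast
  qed
  then have B: "?B \<in> cliques I R" using BI by (simp add: cliques_def)
  show "C \<in> stellar (cliques I R) {p, q} n"
  proof (cases "n \<in> C")
    case False
    then show ?thesis using B notpq by (simp add: stellar_def)
  next
    case True
    have "R p x \<and> R q x" if "x \<in> ?B" for x using new[of x] CR[OF True] BI that by blast
    then have "R x y" if "x \<in> {p, q} \<union> ?B" "y \<in> {p, q} \<union> ?B" for x y
      using that Rxy R pq by auto
    then have "{p, q} \<union> ?B \<in> cliques I R" using BI pq unfolding cliques_def by simp
    moreover have "C = insert n ?B" using True by blast
    moreover have "\<not> {p, q} \<subseteq> ?B" using notpq by blast
    ultimately show ?thesis using B unfolding stellar_def by blast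
  qed
qed

lemma link_cliques:
  assumes "p \<in> I" "q \<in> I" "R p q" "\<And>x. x \<in> I \<Longrightarrow> R x x" "\<And>x y. R x y \<Longrightarrow> R y x"
  shows "link (cliques I R) {p, q} = cliques {x \<in> I - {p, q}. R p x \<and> R q x} R"
  using assms unfolding link_def cliques_def by auto

section \<open>Attaching a node to a clique\<close>

lemma connected_if_nodes_building: "nodes G \<in> building_set G \<Longrightarrow> connected_graph G"
proof -
  assume "nodes G \<in> building_set G"
  then have "nodes G \<noteq> {}" "\<And>x y. x \<in> nodes G \<Longrightarrow> y \<in> nodes G \<Longrightarrow> (x, y) \<in> (edges G)\<^sup>*"
    using rtrancl_mono[of "edges G \<inter> nodes G \<times> nodes G" "edges G"] by (auto simp: mem_building_set)
  then show ?thesis by (simp add: connected_graph_def)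
qed

context simple_graph_loc
begin

lemma building_set_induced: "S \<subseteq> N \<Longrightarrow> building_set (induced \<Gamma> S) = {T \<in> B. T \<subseteq> S}"
proof -
  assume S: "S \<subseteq> N"
  have "E \<inter> S \<times> S \<inter> T \<times> T = E \<inter> T \<times> T" if "T \<subseteq> S" for T using that by blast
  then have "T \<in> building_set (induced \<Gamma> S) \<longleftrightarrow> T \<in> B \<and> T \<subseteq> S" for T
    using S by (cases "T \<subseteq> S") (simp_all add: mem_building_set induced_def subset_trans)
  then show ?thesis by blast
qed

lemma building_Un_overlap: "S \<in> B \<Longrightarrow> T \<in> B \<Longrightarrow> S \<inter> T \<noteq> {} \<Longrightarrow> S \<union> T \<in> B"
  using Un_building_iff unfolding touches_def by blast

end

context graph_assoc_loc
begin

lemma induced_loc: "S \<in> B \<Longrightarrow> graph_assoc_loc (induced \<Gamma> S)"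
proof
  assume S: "S \<in> B"
  show "simple_graph (induced \<Gamma> S)"
    using is_simple building_finite[OF S] by (auto simp: simple_graph_def induced_def sym_def irrefl_def)
  show "connected_graph (induced \<Gamma> S)" using S by (simp add: building_set_def)
qed

lemma contraction_loc: "S \<in> B \<Longrightarrow> S \<noteq> N \<Longrightarrow> graph_assoc_loc (contraction \<Gamma> S)"
proof
  assume S: "S \<in> B" "S \<noteq> N"
  show "simple_graph (contraction \<Gamma> S)"
    using finite_nodes edge_sym by (auto simp: simple_graph_def contraction_def sym_def irrefl_def)
  have "N - S \<noteq> {}" "(N - S) \<union> S = N" using building_subset[OF S(1)] S(2) by auto
  then show "connected_graph (contraction \<Gamma> S)"
    using building_set_contraction[OF is_simple S(1)] nodes_building
    by (intro connected_if_nodes_building) (simp add: contraction_def)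
qed

end

locale clique_extension = graph_assoc_loc \<Gamma> for \<Gamma> :: "'v::finite ugraph" +
  fixes V :: "'v set" and w :: 'v
  assumes clique: "is_clique \<Gamma> V" and V_nonempty: "V \<noteq> {}" and w_new: "w \<notin> nodes \<Gamma>"
begin

abbreviation "\<Gamma>' \<equiv> add_node \<Gamma> w V"
abbreviation "B' \<equiv> building_set \<Gamma>'"

lemma V_nodes: "V \<subseteq> N" and V_adjacent: "x \<in> V \<Longrightarrow> y \<in> V \<Longrightarrow> x \<noteq> y \<Longrightarrow> (x, y) \<in> E"
  using clique by (auto simp: is_clique_def)

lemma nodes_ext [simp]: "nodes \<Gamma>' = insert w N"
  by (simp add: add_node_def)

lemma edges_ext: "edges \<Gamma>' = E \<union> {w} \<times> V \<union> V \<times> {w}"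
  by (simp add: add_node_def)

lemma simple_ext: "simple_graph \<Gamma>'"
  using is_simple V_nodes w_new by (auto simp: simple_graph_def add_node_def sym_def irrefl_def)

interpretation Ext: simple_graph_loc \<Gamma>'
  by unfold_locales (rule simple_ext)

lemma old_building_iff: "S \<subseteq> N \<Longrightarrow> S \<in> B' \<longleftrightarrow> S \<in> B"
proof -
  assume S: "S \<subseteq> N"
  then have "edges \<Gamma>' \<inter> S \<times> S = E \<inter> S \<times> S" using w_new by (auto simp: edges_ext)
  then show ?thesis using S by (auto simp: mem_building_set)
qed

text \<open>As \<open>V\<close> is a clique, contracting the new node adds no edges.  The connected sets containing \<open>w\<close> are
thereby described by the connected sets of \<open>\<Gamma>\<close>.\<close>

lemma contraction_ext: "contraction \<Gamma>' {w} = \<Gamma>"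
proof -
  have "nodes (contraction \<Gamma>' {w}) = N" using w_new by (auto simp: contraction_def)
  moreover have "edges (contraction \<Gamma>' {w}) = E"
  proof (intro equalityI subrelI)
    fix x y assume "(x, y) \<in> edges (contraction \<Gamma>' {w})"
    then show "(x, y) \<in> E"
      using V_adjacent edge_nodes w_new by (auto simp: contraction_def edges_ext)
  next
    fix x y assume xy: "(x, y) \<in> E"
    then have "x \<in> N" "y \<in> N" "x \<noteq> y" using edge_nodes edge_irrefl by blast+
    then show "(x, y) \<in> edges (contraction \<Gamma>' {w})"
      using xy w_new by (auto simp: contraction_def edges_ext)
  qed
  ultimately show ?thesis by simp
qed

lemma new_singleton: "{w} \<in> B'"
  by (rule Ext.singleton_building) simp

lemma new_building_iff:
  assumes S: "S \<subseteq> N" "S \<noteq> {}"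
  shows "insert w S \<in> B' \<longleftrightarrow> S \<in> B \<and> S \<inter> V \<noteq> {}"
proof -
  have t: "Ext.touches S {w} \<longleftrightarrow> S \<inter> V \<noteq> {}"
    using S(1) w_new edge_nodes unfolding Ext.touches_def edges_ext by blast
  have "S \<in> B" if "insert w S \<in> B'"
  proof -
    have "S \<in> building_set (contraction \<Gamma>' {w})"
      using building_set_contraction[OF simple_ext new_singleton] S w_new that by auto
    then show ?thesis by (simp add: contraction_ext)
  qed
  moreover have "insert w S \<in> B' \<longleftrightarrow> S \<inter> V \<noteq> {}" if "S \<in> B"
    using Ext.Un_building_iff[of S "{w}"] new_singleton t old_building_iff[OF S(1)] that by simp
  ultimately show ?thesis by blast
qed

sublocale Ext: graph_assoc_loc \<Gamma>'
proof
  have "insert w N \<in> B'"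
    using new_building_iff[of N] nodes_building building_nonempty V_nodes V_nonempty by auto
  then show "connected_graph \<Gamma>'" by (intro connected_if_nodes_building) simp
qed

abbreviation "meeting \<equiv> tubes_meeting \<Gamma> V"

lemma meetingD: "S \<in> meeting \<Longrightarrow> S \<in> B" "S \<in> meeting \<Longrightarrow> S \<noteq> N" "S \<in> meeting \<Longrightarrow> S \<inter> V \<noteq> {}"
  by (auto simp: tubes_meeting_def)

lemma meeting_Un: "S \<in> B \<Longrightarrow> T \<in> B \<Longrightarrow> S \<inter> V \<noteq> {} \<Longrightarrow> T \<inter> V \<noteq> {} \<Longrightarrow> S \<union> T \<in> B"
  using Un_building_iff V_adjacent unfolding touches_def by blast

lemma compatible_old: "S \<in> B \<Longrightarrow> T \<in> B \<Longrightarrow> compatible \<Gamma>' S T \<longleftrightarrow> compatible \<Gamma> S T"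
  using old_building_iff[of "S \<union> T"] building_subset[of S] building_subset[of T]
  by (simp add: compatible_def)

lemma compatible_top: "S \<in> B \<Longrightarrow> compatible \<Gamma>' {w} S \<longleftrightarrow> S \<inter> V = {}"
  using new_building_iff[of S] building_subset[of S] building_nonempty[of S] w_new
  by (auto simp: compatible_def)

lemma compatible_top_new: "compatible \<Gamma>' {w} (insert w S)"
  by (simp add: compatible_def)

lemma compatible_old_new:
  assumes "S \<in> B" "T \<in> B" "T \<inter> V \<noteq> {}"
  shows "compatible \<Gamma>' (insert w T) S \<longleftrightarrow> S \<subseteq> T \<or> S \<union> T \<notin> B"
proof -
  have "S \<subseteq> N" "T \<subseteq> N" "w \<notin> S" "w \<notin> T" using assms building_subset w_new by auto
  then show ?thesis
    using new_building_iff[of "S \<union> T"] assms building_nonempty[of T]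
    by (auto simp: compatible_def Un_commute)
qed

lemma compatible_new_new:
  assumes "S \<in> B" "S \<inter> V \<noteq> {}" "T \<in> B" "T \<inter> V \<noteq> {}"
  shows "compatible \<Gamma>' (insert w S) (insert w T) \<longleftrightarrow> S \<subseteq> T \<or> T \<subseteq> S"
proof -
  have "S \<union> T \<in> B" using meeting_Un assms by blast
  moreover have "w \<notin> S" "w \<notin> T" using assms building_subset w_new by auto
  ultimately have "insert w S \<union> insert w T \<in> B'"
    using new_building_iff[of "S \<union> T"] building_subset[of "S \<union> T"] assms building_nonempty[of S] by auto
  then show ?thesis using \<open>w \<notin> S\<close> \<open>w \<notin> T\<close> by (auto simp: compatible_def)
qed

end

section \<open>The complexes of the shaving process\<close>

lemma cliques_cong: "(\<And>x y. x \<in> I \<Longrightarrow> y \<in> I \<Longrightarrow> R x y \<longleftrightarrow> R' x y) \<Longrightarrow> cliques I R = cliques I R'"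
  unfolding cliques_def by blast

locale clique_shaving = clique_extension \<Gamma> V w for \<Gamma> :: "'v::finite ugraph" and V w +
  fixes Ss :: "'v set list" and a b :: real
  assumes ab: "a \<noteq> b" and distinct: "distinct Ss" and set_Ss: "set Ss = tubes_meeting \<Gamma> V"
    and order: "i < length Ss \<Longrightarrow> j < length Ss \<Longrightarrow> Ss ! j \<subset> Ss ! i \<Longrightarrow> i < j"
begin

text \<open>After \<open>i\<close> shavings the facets are the bases, labelled \<open>{w}\<close> and \<open>N\<close>, the side facets, and one new facet
for each of the first \<open>i\<close> tubes; the bottom base and the side facets together are labelled by \<open>B\<close>.\<close>

definition labels :: "nat \<Rightarrow> 'v set set" where
  "labels i = insert {w} (B \<union> insert w ` set (take i Ss))"

text \<open>The relation of the extended graph, relaxed for the pairs that remain to be separated.\<close>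

definition rel :: "nat \<Rightarrow> 'v set \<Rightarrow> 'v set \<Rightarrow> bool" where
  "rel i S T \<longleftrightarrow> compatible \<Gamma>' S T \<or> S = {w} \<and> T \<in> set (drop i Ss) \<or> T = {w} \<and> S \<in> set (drop i Ss)"

abbreviation "complex i \<equiv> cliques (labels i) (rel i)"

definition facet :: "'v set \<Rightarrow> ((real ^ 'v) \<times> real) set" where
  "facet S = (if S = {w} then P \<times> {b} else if S = N then P \<times> {a}
     else assoc_facet \<Gamma> S \<times> closed_segment a b)"

abbreviation "cylinder \<equiv> P \<times> closed_segment a b"

lemma rel_refl: "rel i S S" and rel_sym: "rel i S T \<Longrightarrow> rel i T S"
  using compatible_sym by (auto simp: rel_def compatible_refl)

lemma not_top: "S \<in> B \<Longrightarrow> w \<notin> S" "S \<in> B \<Longrightarrow> S \<noteq> {w}"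
  using building_subset w_new by auto

lemma mem_Ss: "S \<in> set Ss \<Longrightarrow> S \<in> B" "S \<in> set Ss \<Longrightarrow> S \<noteq> N" "S \<in> set Ss \<Longrightarrow> S \<inter> V \<noteq> {}"
  using meetingD set_Ss by auto

lemma take_drop: "S \<in> set (take i Ss) \<Longrightarrow> S \<in> set Ss" "S \<in> set (drop i Ss) \<Longrightarrow> S \<in> set Ss"
  "S \<in> set (take i Ss) \<Longrightarrow> S \<notin> set (drop i Ss)"
  using set_take_disj_set_drop_if_distinct[OF distinct, of i i] in_set_takeD in_set_dropD by fastforce+

lemma complex_0: "complex 0 = (`) (case_sum id (\<lambda>s. if s then {w} else N)) ` join nested {{}, {True}, {False}}"
proof -
  let ?\<sigma> = "case_sum id (\<lambda>s. if s then {w} else N)"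
  have N: "N \<in> B" "N \<inter> V \<noteq> {}" "N \<noteq> {w}"
    using nodes_building V_nodes V_nonempty w_new by auto
  have tB: "S \<in> B" "S \<subseteq> N" "S \<noteq> N" if "S \<in> tubes \<Gamma>" for S
    using that building_subset by (auto simp: tubes_def)
  have NSs: "N \<notin> set Ss" using mem_Ss by blast
  have top: "rel 0 {w} S" if S: "S \<in> tubes \<Gamma>" for S
  proof (cases "S \<inter> V = {}")
    case True
    then show ?thesis using compatible_top[OF tB(1)[OF S]] by (simp add: rel_def)
  next
    case False
    then show ?thesis using S set_Ss by (simp add: rel_def tubes_meeting_def tubes_def)
  qed
  have topN: "\<not> rel 0 {w} N"
    using compatible_top[OF N(1)] N NSs by (auto simp: rel_def)
  then have botN: "\<not> rel 0 N {w}" using rel_sym by blast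
  have botS: "rel 0 N S" if "S \<in> tubes \<Gamma>" for S
    using tB[OF that] by (simp add: rel_def compatible_def)
  have old: "rel 0 S T \<longleftrightarrow> compatible \<Gamma> S T" if "S \<in> tubes \<Gamma>" "T \<in> tubes \<Gamma>" for S T
    using compatible_old[OF tB(1)[OF that(1)] tB(1)[OF that(2)]] not_top(2)[OF tB(1)] that
    by (auto simp: rel_def)
  have "rel 0 (?\<sigma> x) (?\<sigma> y) \<longleftrightarrow> sum_rel (compatible \<Gamma>) (=) x y"
    if "x \<in> tubes \<Gamma> <+> UNIV" "y \<in> tubes \<Gamma> <+> UNIV" for x y
    using that old top[THEN rel_sym] top topN botN botS botS[THEN rel_sym] rel_refl
    by (auto split: if_splits)
  then have "(`) ?\<sigma> ` cliques (tubes \<Gamma> <+> UNIV) (sum_rel (compatible \<Gamma>) (=))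
      = cliques (?\<sigma> ` (tubes \<Gamma> <+> UNIV)) (rel 0)"
    by (rule image_cliques)
  moreover have "?\<sigma> ` (tubes \<Gamma> <+> UNIV) = labels 0"
    using N(1) unfolding Plus_def image_Un image_image by (auto simp: labels_def tubes_def)
  ultimately show ?thesis by (simp only: segment_cliques nested_def join_cliques)
qed

lemma realization_cylinder: "realization cylinder facet (complex 0)" "pdim cylinder = card N"
proof -
  note seg = realization_segment[OF ab]
  note prod = realization_Times[OF realization_axioms seg(1)]
  let ?\<sigma> = "case_sum id (\<lambda>s. if s then {w} else N)"
  have tB: "S \<noteq> {w}" "S \<noteq> N" if "S \<in> tubes \<Gamma>" for S
    using that not_top by (auto simp: tubes_def)
  have no_tube: "{w} \<notin> tubes \<Gamma>" "N \<notin> tubes \<Gamma>" using tB by blast+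
  have "N \<noteq> {w}" using w_new by auto
  have U: "\<Union>(join nested {{}, {True}, {False}}) \<subseteq> tubes \<Gamma> <+> UNIV"
    using nestedD(1) by (fastforce simp: mem_join)
  show "realization cylinder facet (complex 0)"
    unfolding complex_0
  proof (rule realization_relabel[OF prod(1)])
    show "inj_on ?\<sigma> (\<Union>(join nested {{}, {True}, {False}}))"
      by (rule inj_on_subset[OF _ U])
        (use no_tube \<open>N \<noteq> {w}\<close> in \<open>auto simp: inj_on_def split: if_splits\<close>)
    fix x assume "x \<in> \<Union>(join nested {{}, {True}, {False}})"
    then have x: "x \<in> tubes \<Gamma> <+> UNIV" using U by blast
    have facets: "facet {w} = P \<times> {b}" "facet N = P \<times> {a}"
      "\<And>S. S \<in> tubes \<Gamma> \<Longrightarrow> facet S = assoc_facet \<Gamma> S \<times> closed_segment a b"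
      using tB \<open>N \<noteq> {w}\<close> by (simp_all add: facet_def)
    show "cylinder \<inter> facet (?\<sigma> x) = cylinder \<inter> case_sum (\<lambda>S. assoc_facet \<Gamma> S \<times> UNIV)
        (\<lambda>s. UNIV \<times> (if s then {b} else {a})) x"
    proof (cases x)
      case (Inl S)
      then have "S \<in> tubes \<Gamma>" using x by auto
      then show ?thesis using Inl by (auto simp: facets)
    next
      case (Inr s)
      then show ?thesis by (cases s) (auto simp: facets)
    qed
  qed
  have "card N > 0" using building_nonempty[OF nodes_building] finite_nodes by (simp add: card_gt_0_iff)
  then show "pdim cylinder = card N"
    using prod(2) seg(2) pdim_graph_assoc by simp
qed

context
  fixes i S assumes i: "i < length Ss" and S: "S = Ss ! i"
begin

lemma current: "S \<in> set Ss" "S \<in> B" "S \<noteq> N" "S \<inter> V \<noteq> {}" "S \<noteq> {}" "S \<subseteq> N" "w \<notin> S" "S \<noteq> {w}"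
    "S \<notin> set (take i Ss)" "S \<in> set (drop i Ss)" "S \<notin> set (drop (Suc i) Ss)"
    "set (drop i Ss) = insert S (set (drop (Suc i) Ss))" "set (take (Suc i) Ss) = insert S (set (take i Ss))"
proof -
  show d: "set (drop i Ss) = insert S (set (drop (Suc i) Ss))"
    using Cons_nth_drop_Suc[OF i] S by (metis list.simps(15))
  show t: "set (take (Suc i) Ss) = insert S (set (take i Ss))"
    using take_Suc_conv_app_nth[OF i] S by simp
  show Ss: "S \<in> set Ss" using i S by simp
  then show SB: "S \<in> B" "S \<noteq> N" "S \<inter> V \<noteq> {}" using mem_Ss by auto
  show "S \<noteq> {}" "S \<subseteq> N" using building_nonempty building_subset SB by auto
  show "w \<notin> S" "S \<noteq> {w}" using not_top SB by auto
  show "S \<in> set (drop i Ss)" using d by simp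
  then show "S \<notin> set (take i Ss)" using take_drop(3) by blast
  show "S \<notin> set (drop (Suc i) Ss)" using take_drop(3)[of S "Suc i"] t by blast
qed

lemma before: "T \<in> set Ss \<Longrightarrow> S \<subset> T \<Longrightarrow> T \<in> set (take i Ss)"
proof -
  assume T: "T \<in> set Ss" "S \<subset> T"
  then obtain j where j: "j < length Ss" "T = Ss ! j" by (auto simp: in_set_conv_nth)
  then have "j < i" using order[OF j(1) i] T(2) S by simp
  then show ?thesis using j i by (auto simp: in_set_conv_nth intro!: exI[of _ j])
qed

lemma not_before: "T \<in> set (take i Ss) \<Longrightarrow> \<not> T \<subseteq> S"
proof
  assume T: "T \<in> set (take i Ss)" "T \<subseteq> S"
  then have "T \<subset> S" using current(9) by blast
  obtain j where j: "j < i" "T = Ss ! j" using T(1) i by (auto simp: in_set_conv_nth)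
  then have "i < j" using order[OF i, of j] \<open>T \<subset> S\<close> S i by simp
  then show False using j by simp
qed

text \<open>The right-hand side lists the facets meeting the shaved face, the left-hand side those that have to
meet the new facet.  For an old tube \<open>X\<close> comparable to \<open>S\<close> and meeting \<open>V\<close> the order of the
shavings decides: if \<open>X\<close> is smaller it still meets the top base, as required; if it is larger it has
already been separated from the top base, as required too.\<close>

lemma compatible_new_iff:
  assumes X: "X \<in> labels i"
  shows "compatible \<Gamma>' (insert w S) X \<longleftrightarrow> rel i {w} X \<and> rel i S X"
proof -
  consider "X = {w}" | "X \<in> B" | T where "T \<in> set (take i Ss)" "X = insert w T"
    using X by (auto simp: labels_def)
  then show ?thesis
  proof cases
    case 1
    then show ?thesis
      using compatible_sym[OF compatible_top_new[of S]] current(10) rel_refl by (auto simp: rel_def)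
  next
    case 2
    have X': "X \<noteq> {w}" "w \<notin> X" "X \<subseteq> N" using not_top 2 building_subset by auto
    have L: "compatible \<Gamma>' (insert w S) X \<longleftrightarrow> X \<subseteq> S \<or> X \<union> S \<notin> B"
      by (rule compatible_old_new[OF 2 current(2,4)])
    have R1: "rel i {w} X \<longleftrightarrow> X \<inter> V = {} \<or> X \<in> set (drop i Ss)"
      using compatible_top[OF 2] X' by (auto simp: rel_def)
    have R2: "rel i S X \<longleftrightarrow> S \<subseteq> X \<or> X \<subseteq> S \<or> X \<union> S \<notin> B"
      using compatible_old[OF current(2) 2] X' current(8)
      by (auto simp: rel_def compatible_def Un_commute)
    have "X \<in> set (drop i Ss)" if "X \<subseteq> S" "X \<inter> V \<noteq> {}"
    proof -
      have "X \<noteq> N" using that(1) current(3,6) by blast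
      then have "X \<in> set Ss" using 2 that(2) set_Ss by (simp add: tubes_meeting_def)
      then have "X \<in> set (take i Ss) \<or> X \<in> set (drop i Ss)"
        by (metis Un_iff append_take_drop_id set_append)
      then show ?thesis using not_before[of X] that(1) by blast
    qed
    moreover have "X \<inter> V = {}" if "X \<union> S \<notin> B"
      using meeting_Un[OF 2 current(2)] current(4) that by blast
    moreover have "X \<subseteq> S" if "S \<subseteq> X" "X \<inter> V = {} \<or> X \<in> set (drop i Ss)"
    proof (rule ccontr)
      assume "\<not> X \<subseteq> S"
      then have "S \<subset> X" using that(1) by blast
      moreover have "X \<in> set (drop i Ss)" using that current(4) by blast
      ultimately show False using before[of X] take_drop(2,3)[of X i] by blast
    qed
    ultimately show ?thesis unfolding L R1 R2 by blast
  next
    case 3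
    have T: "T \<in> B" "T \<inter> V \<noteq> {}" "w \<notin> T" "T \<noteq> {}"
      using take_drop(1)[OF 3(1)] mem_Ss not_top building_nonempty by auto
    have TS: "\<not> T \<subseteq> S" using not_before 3 by blast
    have "S \<union> T \<in> B" using meeting_Un T current(2,4) by blast
    then have "compatible \<Gamma>' (insert w T) S \<longleftrightarrow> S \<subseteq> T"
      using compatible_old_new[OF current(2) T(1,2)] by simp
    moreover have "X \<noteq> {w}" "X \<notin> set (drop i Ss)"
      using 3 T take_drop(2)[of X i] mem_Ss(1) not_top(1) by auto
    ultimately have "rel i S X \<longleftrightarrow> S \<subseteq> T"
      using current(8) compatible_sym 3(2) unfolding rel_def by blast
    moreover have "rel i {w} X" using compatible_top_new[of T] 3(2) by (simp add: rel_def)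
    moreover have "compatible \<Gamma>' (insert w S) X \<longleftrightarrow> S \<subseteq> T"
      using compatible_new_new[OF current(2,4) T(1,2)] TS 3(2) by simp
    ultimately show ?thesis by simp
  qed
qed

lemma new_label: "insert w S \<notin> labels i"
proof
  assume "insert w S \<in> labels i"
  then consider "insert w S = {w}" | "insert w S \<in> B" | T where "T \<in> set (take i Ss)" "insert w S = insert w T"
    unfolding labels_def by blast
  then show False
  proof cases
    case 1
    then show False using current(5,7) by auto
  next
    case 2
    then show False using not_top(1) by blast
  next
    case 3
    have "w \<notin> T" using take_drop(1)[OF 3(1)] mem_Ss(1) not_top(1) by blast
    then have "S = T" using 3(2) current(7) insert_ident by metis
    then show False using 3(1) current(9) by blast
  qed
qed

lemma edge_labels: "{w} \<in> labels i" "S \<in> labels i" "rel i {w} S"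
  using current by (auto simp: labels_def rel_def)

lemma complex_Suc: "complex (Suc i) = stellar (complex i) {{w}, S} (insert w S)"
proof -
  have lab: "labels (Suc i) = insert (insert w S) (labels i)"
    using current(13) by (auto simp: labels_def)
  have nw: "insert w S \<noteq> {w}" "insert w S \<notin> set (drop k Ss)" for k
    using current(5,7) take_drop(2)[of "insert w S" k] mem_Ss(1) not_top(1) by auto
  show ?thesis
    unfolding lab
  proof (rule stellar_cliques[symmetric])
    show "{w} \<in> labels i" "S \<in> labels i" "rel i {w} S" by (rule edge_labels)+
    show "insert w S \<notin> labels i" by (rule new_label)
    show "rel i x x" "rel (Suc i) (insert w S) (insert w S)" for x by (rule rel_refl)+
    show "rel i x y \<Longrightarrow> rel i y x" "rel (Suc i) x y \<Longrightarrow> rel (Suc i) y x" for x y by (rule rel_sym; assumption)+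
    show "\<not> rel (Suc i) {w} S"
      using compatible_top[OF current(2)] current by (auto simp: rel_def)
    show "rel (Suc i) x y \<longleftrightarrow> rel i x y" if "{x, y} \<noteq> {{w}, S}" for x y
      using that current(12) by (auto simp: rel_def)
    show "rel (Suc i) (insert w S) x \<longleftrightarrow> rel i {w} x \<and> rel i S x" if "x \<in> labels i" for x
      unfolding compatible_new_iff[OF that, symmetric] using nw by (auto simp: rel_def)
  qed
qed

text \<open>A tube of the contraction that touches \<open>S\<close> represents the larger tube \<open>T \<union> S\<close>, which has already been
shaved and is therefore present in the link through its new facet.\<close>

definition link_label :: "'v set + 'v set \<Rightarrow> 'v set" where
  "link_label = case_sum id (\<lambda>T. if T \<union> S \<in> B then insert w (T \<union> S) else T)"

text \<open>Facets meeting the shaved edge belong to tubes inside \<open>S\<close>, to tubes apart from \<open>S\<close>, or to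
earlier shavings for tubes above \<open>S\<close>.  The first kind gives the restriction, the other two together
the contraction, and members of the two groups are always compatible.\<close>

lemma link_complex:
  "link (complex i) {{w}, S} = (`) link_label `
     join (simple_graph_loc.nested (induced \<Gamma> S)) (simple_graph_loc.nested (contraction \<Gamma> S))"
  "inj_on link_label (tubes (induced \<Gamma> S) <+> tubes (contraction \<Gamma> S))"
proof -
  let ?I = "tubes (induced \<Gamma> S)" and ?C = "tubes (contraction \<Gamma> S)"
  let ?RI = "compatible (induced \<Gamma> S)" and ?RC = "compatible (contraction \<Gamma> S)"
  interpret I: graph_assoc_loc "induced \<Gamma> S" by (rule induced_loc[OF current(2)])
  interpret C: graph_assoc_loc "contraction \<Gamma> S" by (rule contraction_loc[OF current(2,3)])
  let ?J = "{X \<in> labels i - {{w}, S}. compatible \<Gamma>' (insert w S) X}"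
  have tI: "?I = {T \<in> B. T \<subset> S}"
    using building_set_induced[OF current(6)] by (auto simp: tubes_def induced_def)
  have tC: "?C = {T. T \<subset> N - S \<and> T \<noteq> {} \<and> (T \<in> B \<or> T \<union> S \<in> B)}"
    using building_set_contraction[OF is_simple current(2)] by (auto simp: tubes_def contraction_def)
  have above: "T \<union> S \<in> set (take i Ss)" if T: "T \<in> ?C" "T \<union> S \<in> B" for T
  proof -
    have "T \<union> S \<noteq> N" "S \<subset> T \<union> S" "(T \<union> S) \<inter> V \<noteq> {}" using T current(4) by (auto simp: tC)
    then have "T \<union> S \<in> set Ss" using T(2) set_Ss by (simp add: tubes_meeting_def)
    then show ?thesis using before \<open>S \<subset> T \<union> S\<close> by blast
  qed
  have lI: "link_label (Inl T) = T" for T by (simp add: link_label_def)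
  have lC1: "link_label (Inr T) = insert w (T \<union> S)" if "T \<union> S \<in> B" for T using that by (simp add: link_label_def)
  have lC2: "link_label (Inr T) = T" if "T \<union> S \<notin> B" for T using that by (simp add: link_label_def)
  have wT: "w \<notin> T" if "T \<in> ?C" for T using that w_new by (auto simp: tC)
  have TB: "T \<in> B" if "T \<in> ?C" "T \<union> S \<notin> B" for T using that by (auto simp: tC)
  have dis: "T \<inter> S = {}" "T \<noteq> {}" if "T \<in> ?C" for T using that by (auto simp: tC)
  have "link (complex i) {{w}, S} = cliques {X \<in> labels i - {{w}, S}. rel i {w} X \<and> rel i S X} (rel i)"
    by (rule link_cliques) (use edge_labels rel_refl rel_sym in auto)
  also have "\<dots> = cliques ?J (rel i)"
    using compatible_new_iff by (intro arg_cong2[where f = cliques] refl) blast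
  also have "\<dots> = cliques ?J (compatible \<Gamma>')"
    by (rule cliques_cong) (auto simp: rel_def)
  finally have L: "link (complex i) {{w}, S} = cliques ?J (compatible \<Gamma>')" .
  have img: "link_label ` (?I <+> ?C) = ?J"
  proof (intro equalityI subsetI)
    fix X assume "X \<in> link_label ` (?I <+> ?C)"
    then consider "X \<in> ?I"
      | T where "T \<in> ?C" "T \<union> S \<in> B" "X = insert w (T \<union> S)"
      | "X \<in> ?C" "X \<union> S \<notin> B"
      using lI lC1 lC2 by (auto, metis)
    then show "X \<in> ?J"
    proof cases
      case 1
      then have "X \<in> B" "X \<subset> S" by (auto simp: tI)
      then show ?thesis using not_top(2) by (auto simp: labels_def compatible_def)
    next
      case 2
      then show ?thesis using above[OF 2(1,2)] current(5,7) by (auto simp: labels_def compatible_def)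
    next
      case 3
      have "X \<noteq> S" using dis[OF 3(1)] by blast
      then show ?thesis
        using TB[OF 3] not_top(2) compatible_old_new[OF TB[OF 3] current(2,4)] 3(2) by (auto simp: labels_def)
    qed
  next
    fix X assume X: "X \<in> ?J"
    then consider "X \<in> B" | T where "T \<in> set (take i Ss)" "X = insert w T" by (auto simp: labels_def)
    then show "X \<in> link_label ` (?I <+> ?C)"
    proof cases
      case 1
      show ?thesis
      proof (cases "X \<subseteq> S")
        case True
        then have "Inl X \<in> ?I <+> ?C"
          using X 1 by (auto simp: tI)
        then show ?thesis using lI[of X] by (metis image_eqI)
      next
        case False
        then have XS: "X \<union> S \<notin> B" using X compatible_old_new[OF 1 current(2,4)] by blast
        then have "X \<inter> S = {}" using building_Un_overlap[OF 1 current(2)] by blast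
        moreover have "X \<noteq> N - S" using XS nodes_building current(6) by (auto simp: Un_absorb2)
        ultimately have "X \<in> ?C"
          using 1 building_subset[OF 1] building_nonempty[OF 1] by (auto simp: tC)
        then have "Inr X \<in> ?I <+> ?C" by blast
        then show ?thesis using lC2[OF XS] by (metis image_eqI)
      qed
    next
      case 2
      have T: "T \<in> B" "T \<inter> V \<noteq> {}" "T \<noteq> N" using take_drop(1)[OF 2(1)] mem_Ss by auto
      have "S \<subseteq> T \<or> T \<subseteq> S" using X 2(2) compatible_new_new[OF current(2,4) T(1,2)] by blast
      then have ST: "S \<subset> T" using not_before[OF 2(1)] by blast
      have "T - S \<in> ?C"
        using ST T building_subset[OF T(1)] current(6) by (auto simp: tC Un_absorb2)
      then have "Inr (T - S) \<in> ?I <+> ?C" by blast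
      moreover have "link_label (Inr (T - S)) = X"
        using lC1[of "T - S"] ST T(1) 2(2) by (simp add: Un_absorb2 psubset_imp_subset)
      ultimately show ?thesis by (metis image_eqI)
    qed
  qed
  have IC: "compatible \<Gamma>' T (link_label (Inr T'))"
    if T: "T \<in> ?I" and T': "T' \<in> ?C" for T T'
  proof (cases "T' \<union> S \<in> B")
    case True
    then show ?thesis using T by (auto simp: lC1 tI compatible_def)
  next
    case False
    have "\<not> touches T' S" using Un_building_iff[OF TB[OF T' False] current(2)] False by simp
    then have "\<not> touches T T'" using touches_sym touches_mono[of T T' S T'] T by (auto simp: tI)
    then show ?thesis
      using compatible_old[of T T'] compatible_iff[of T T'] TB[OF T' False] T by (auto simp: lC2 False tI)
  qed
  have II: "compatible \<Gamma>' T T' \<longleftrightarrow> ?RI T T'"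
    if "T \<in> ?I" "T' \<in> ?I" for T T'
    using that compatible_old[of T T'] building_set_induced[OF current(6)]
    by (auto simp: tI compatible_def)
  have conC: "?RC T T' \<longleftrightarrow>
      T \<subseteq> T' \<or> T' \<subseteq> T \<or> T \<union> T' \<notin> B \<and> T \<union> T' \<union> S \<notin> B"
    if "T \<in> ?C" "T' \<in> ?C" for T T'
    using that building_set_contraction[OF is_simple current(2)] by (auto simp: compatible_def tC)
  have CC1: "compatible \<Gamma>' (link_label (Inr T)) (link_label (Inr T')) \<longleftrightarrow> ?RC T T'"
    if T: "T \<in> ?C" and T': "T' \<in> ?C"
      and TS: "T \<union> S \<in> B" for T T'
  proof (cases "T' \<union> S \<in> B")
    case True
    have "(T \<union> S) \<inter> (T' \<union> S) \<noteq> {}" using current(5) by blast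
    then have "T \<union> S \<union> (T' \<union> S) \<in> B" by (rule building_Un_overlap[OF TS True])
    then have "T \<union> T' \<union> S \<in> B" by (simp add: Un_ac)
    then have "?RC T T' \<longleftrightarrow> T \<subseteq> T' \<or> T' \<subseteq> T" using conC[OF T T'] by blast
    moreover have "compatible \<Gamma>' (insert w (T \<union> S)) (insert w (T' \<union> S)) \<longleftrightarrow> T \<union> S \<subseteq> T' \<union> S \<or> T' \<union> S \<subseteq> T \<union> S"
      using current(4) by (intro compatible_new_new TS True) auto
    ultimately show ?thesis using dis[OF T] dis[OF T'] unfolding lC1[OF TS] lC1[OF True] by blast
  next
    case False
    have T'B: "T' \<in> B" using TB[OF T' False] .
    have "compatible \<Gamma>' (insert w (T \<union> S)) T' \<longleftrightarrow> T' \<subseteq> T \<union> S \<or> T' \<union> (T \<union> S) \<notin> B"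
      using current(4) by (intro compatible_old_new T'B TS) auto
    moreover have "T' \<subseteq> T \<union> S \<longleftrightarrow> T' \<subseteq> T" using dis[OF T'] by blast
    moreover have "\<not> T \<subseteq> T'"
    proof
      assume "T \<subseteq> T'"
      then have "T' \<inter> (T \<union> S) \<noteq> {}" using dis[OF T] by blast
      then have "T' \<union> (T \<union> S) \<in> B" by (rule building_Un_overlap[OF T'B TS])
      then show False using False \<open>T \<subseteq> T'\<close> by (simp add: Un_absorb2 flip: Un_assoc)
    qed
    moreover have "T \<union> T' \<union> S \<in> B" if "T \<union> T' \<in> B"
    proof -
      have "(T \<union> T') \<inter> (T \<union> S) \<noteq> {}" using dis[OF T] by blast
      then have "T \<union> T' \<union> (T \<union> S) \<in> B" by (rule building_Un_overlap[OF that TS])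
      then show ?thesis by (simp add: Un_ac)
    qed
    moreover have "T' \<union> (T \<union> S) = T \<union> T' \<union> S" by blast
    ultimately show ?thesis unfolding lC1[OF TS] lC2[OF False] conC[OF T T'] by metis
  qed
  have CC: "compatible \<Gamma>' (link_label (Inr T)) (link_label (Inr T')) \<longleftrightarrow> ?RC T T'"
    if T: "T \<in> ?C" and T': "T' \<in> ?C" for T T'
  proof -
    consider "T \<union> S \<in> B" | "T' \<union> S \<in> B" | "T \<union> S \<notin> B" "T' \<union> S \<notin> B" by blast
    then show ?thesis
    proof cases
      case 1
      then show ?thesis by (rule CC1[OF T T'])
    next
      case 2
      then show ?thesis using CC1[OF T' T] compatible_sym by blast
    next
      case 3
      have TT: "T \<in> B" "T' \<in> B" using TB T T' 3 by auto
      have "T \<union> T' \<union> S \<notin> B"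
      proof
        assume U: "T \<union> T' \<union> S \<in> B"
        obtain s t where st: "s \<in> S" "t \<in> T" using current(5) dis(2)[OF T] by blast
        then have "s \<in> T \<union> T' \<union> S" "t \<in> T \<union> T' \<union> S" "t \<notin> S" using dis(1)[OF T] by auto
        with U st(1) obtain x y where "x \<in> S" "y \<in> T \<union> T' \<union> S" "y \<notin> S" "(x, y) \<in> E"
          using exit_edge[of "T \<union> T' \<union> S" s S t] by metis
        then have "touches S T \<or> touches S T'" unfolding touches_def by blast
        then show False
          using Un_building_iff[OF TT(1) current(2)] Un_building_iff[OF TT(2) current(2)] touches_sym 3 by blast
      qed
      then show ?thesis
        unfolding lC2[OF 3(1)] lC2[OF 3(2)] conC[OF T T'] compatible_old[OF TT]
        by (simp add: compatible_def)
    qed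
  qed
  have "(`) link_label ` cliques (?I <+> ?C)
      (sum_rel (?RI) (?RC)) = cliques ?J (compatible \<Gamma>')"
    unfolding img[symmetric]
  proof (rule image_cliques)
    fix x y assume xy: "x \<in> ?I <+> ?C"
      "y \<in> ?I <+> ?C"
    show "compatible \<Gamma>' (link_label x) (link_label y) \<longleftrightarrow>
        sum_rel (?RI) (?RC) x y"
    proof (cases x; cases y)
      fix T T' assume "x = Inl T" "y = Inl T'"
      then show ?thesis using II xy by (auto simp: lI)
    next
      fix T T' assume "x = Inl T" "y = Inr T'"
      then show ?thesis using IC xy by (auto simp: lI)
    next
      fix T T' assume "x = Inr T" "y = Inl T'"
      then show ?thesis using IC[THEN compatible_sym] xy by (auto simp: lI)
    next
      fix T T' assume "x = Inr T" "y = Inr T'"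
      then show ?thesis using CC xy by auto
    qed
  qed
  then show "link (complex i) {{w}, S} = (`) link_label ` join I.nested C.nested"
    unfolding L I.nested_def C.nested_def join_cliques by simp
  show "inj_on link_label (?I <+> ?C)"
  proof (rule inj_onI)
    fix x y assume xy: "x \<in> ?I <+> ?C"
      "y \<in> ?I <+> ?C" "link_label x = link_label y"
    have sep: "link_label (Inl T) \<noteq> link_label (Inr T')"
      if "T \<in> ?I" "T' \<in> ?C" for T T'
    proof (cases "T' \<union> S \<in> B")
      case True
      then show ?thesis using that(1) not_top(1) by (auto simp: lI lC1 tI)
    next
      case False
      then show ?thesis using dis[OF that(2)] that(1) by (auto simp: lI lC2 tI)
    qed
    have inj: "T = T'" if T: "T \<in> ?C" "T' \<in> ?C"
      and eq: "link_label (Inr T) = link_label (Inr T')" for T T'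
    proof -
      have rec: "T = link_label (Inr T) - insert w S" if "T \<in> ?C" for T
        using dis[OF that] wT[OF that] by (cases "T \<union> S \<in> B") (auto simp: lC1 lC2)
      show ?thesis using rec[OF T(1)] rec[OF T(2)] eq by simp
    qed
    show "x = y"
    proof (cases x; cases y)
      fix T T' assume "x = Inl T" "y = Inl T'"
      then show ?thesis using xy(3) by (simp add: lI)
    next
      fix T T' assume "x = Inl T" "y = Inr T'"
      then show ?thesis using sep[of T T'] xy by auto
    next
      fix T T' assume "x = Inr T" "y = Inl T'"
      then show ?thesis using sep[of T' T] xy by auto
    next
      fix T T' assume "x = Inr T" "y = Inr T'"
      then show ?thesis using inj[of T T'] xy by auto
    qed
  qed
qed

end

lemma complex_final: "complex (length Ss) = Ext.nested"
proof -
  have new_label_final: "insert w T \<in> labels (length Ss)" if "T \<in> set Ss" for T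
    using that by (simp add: labels_def)
  have "labels (length Ss) = tubes \<Gamma>'"
  proof (intro equalityI subsetI)
    fix X assume "X \<in> labels (length Ss)"
    then consider "X = {w}" | "X \<in> B" | T where "T \<in> set Ss" "X = insert w T"
      by (auto simp: labels_def)
    then show "X \<in> tubes \<Gamma>'"
    proof cases
      case 1
      have "insert w N \<noteq> {w}" using w_new building_nonempty[OF nodes_building] by auto
      then show ?thesis using 1 new_singleton by (auto simp: tubes_def)
    next
      case 2
      then show ?thesis
        using old_building_iff[OF building_subset[OF 2]] not_top(1)[OF 2] by (auto simp: tubes_def)
    next
      case 3
      have T: "T \<in> B" "T \<noteq> N" "T \<inter> V \<noteq> {}" using mem_Ss 3(1) by auto
      have "insert w T \<noteq> insert w N" using not_top(1)[OF T(1)] w_new T(2) by (metis insert_ident)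
      then show ?thesis
        using T 3(2) new_building_iff[OF building_subset[OF T(1)] building_nonempty[OF T(1)]]
        by (simp add: tubes_def)
    qed
  next
    fix X assume X: "X \<in> tubes \<Gamma>'"
    then have XB: "X \<in> B'" "X \<noteq> insert w N" "X \<subseteq> insert w N" "X \<noteq> {}"
      using Ext.building_subset[of X] Ext.building_nonempty[of X] by (auto simp: tubes_def)
    show "X \<in> labels (length Ss)"
    proof (cases "w \<in> X")
      case False
      then have "X \<in> B" using old_building_iff[of X] XB by blast
      then show ?thesis by (simp add: labels_def)
    next
      case True
      let ?T = "X - {w}"
      have X': "X = insert w ?T" using True by blast
      show ?thesis
      proof (cases "?T = {}")
        case True
        then have "X = {w}" using X' by metis
        then show ?thesis by (simp add: labels_def)
      next
        case False
        have "?T \<subseteq> N" using XB(3) by blast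
        then have "?T \<in> B" "?T \<inter> V \<noteq> {}" using new_building_iff[OF _ False] XB(1) X' by auto
        moreover have "?T \<noteq> N" using XB(2) X' by auto
        ultimately have "?T \<in> set Ss" using set_Ss by (simp add: tubes_meeting_def)
        then have "insert w ?T \<in> labels (length Ss)" by (rule new_label_final)
        then show ?thesis by (simp only: X'[symmetric])
      qed
    qed
  qed
  moreover have "rel (length Ss) = compatible \<Gamma>'" by (intro ext) (simp add: rel_def)
  ultimately show ?thesis by (simp add: Ext.nested_def)
qed

end

section \<open>The shaving process\<close>

context clique_shaving
begin

abbreviation "sub_assoc S \<equiv> graph_assoc (induced \<Gamma> S)"
abbreviation "quot_assoc S \<equiv> graph_assoc (contraction \<Gamma> S)"

definition shaved_faces :: "((real ^ 'v) \<times> real) set list" where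
  "shaved_faces = map (\<lambda>S. (P \<times> {b}) \<inter> assoc_facet \<Gamma> S \<times> closed_segment a b) Ss"

text \<open>The facets present from the start keep their sets, so that what remains of a face to be shaved can
be recognised as a cell.\<close>

definition stage :: "nat \<Rightarrow> ((real ^ 'v) \<times> real) set \<Rightarrow> bool" where
  "stage i R \<longleftrightarrow> (\<exists>f. realization R f (complex i) \<and> pdim R = card N \<and>
     (\<forall>S\<in>insert {w} B. f S = facet S))"

lemma stage_0: "stage 0 cylinder"
  unfolding stage_def using realization_cylinder by blast

lemma edge_in_complex: "i < length Ss \<Longrightarrow> {{w}, Ss ! i} \<in> complex i"
  using edge_labels[OF _ refl, of i] rel_sym rel_refl by (auto simp: cliques_def)

lemma shaved_face_cell:
  assumes "i < length Ss" "\<forall>S\<in>insert {w} B. f S = facet S"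
  shows "shaved_faces ! i \<inter> R = cell R f {{w}, Ss ! i}"
proof -
  note c = current[OF assms(1) refl]
  have "f {w} = P \<times> {b}" using assms(2) by (simp add: facet_def)
  moreover have "f (Ss ! i) = assoc_facet \<Gamma> (Ss ! i) \<times> closed_segment a b"
    using assms(2) c(2,3,8) by (simp add: facet_def)
  ultimately show ?thesis using assms(1) by (auto simp: shaved_faces_def cell_def)
qed

lemma stage_Suc:
  assumes i: "i < length Ss" and R: "stage i R" and sh: "shaving R (shaved_faces ! i \<inter> R) R'"
  shows "stage (Suc i) R'"
proof -
  let ?S = "Ss ! i"
  obtain f where f: "realization R f (complex i)" "pdim R = card N" "\<forall>S\<in>insert {w} B. f S = facet S"
    using R unfolding stage_def by blast
  interpret R: realization R f "complex i" by (rule f(1))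
  have cell: "shaved_faces ! i \<inter> R = cell R f {{w}, ?S}" by (rule shaved_face_cell[OF i f(3)])
  obtain c \<beta> where
    above: "\<And>v. v extreme_point_of R \<Longrightarrow> v \<in> cell R f {{w}, ?S} \<Longrightarrow> \<beta> < c \<bullet> v"
    and below: "\<And>v. v extreme_point_of R \<Longrightarrow> v \<notin> cell R f {{w}, ?S} \<Longrightarrow> c \<bullet> v < \<beta>"
    and R': "R' = R \<inter> {x. c \<bullet> x \<le> \<beta>}"
    using sh unfolding shaving_def cell by blast
  let ?f = "f(insert w ?S := {x. c \<bullet> x = \<beta>})"
  have U: "\<Union>(complex i) = labels i" by (rule Union_cliques) (rule rel_refl)
  have n: "insert w ?S \<notin> \<Union>(complex i)" unfolding U by (rule new_label[OF i refl])
  have R: "realization R' ?f (complex (Suc i))" "aff_dim R' = aff_dim R"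
    unfolding R' complex_Suc[OF i refl]
    by (rule R.realization_shave[OF edge_in_complex[OF i] n above below], simp_all)+
  have agree: "?f S = facet S" if "S \<in> insert {w} B" for S
  proof -
    have "S \<in> labels i" using that by (auto simp: labels_def)
    then have "S \<noteq> insert w ?S" using n unfolding U by metis
    then have "?f S = f S" by (rule fun_upd_other)
    also have "\<dots> = facet S" using f(3) that by (rule bspec)
    finally show ?thesis .
  qed
  have "pdim R' = card N" using R(2) f(2) by (simp add: pdim_def)
  then show ?thesis
    unfolding stage_def using R(1) agree by (intro exI[of _ ?f] conjI ballI)
qed

lemma stage_shaving_exists:
  assumes i: "i < length Ss" and R: "stage i R"
  shows "\<exists>R'. shaving R (shaved_faces ! i \<inter> R) R'"
proof -
  let ?A = "{{w}, Ss ! i}"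
  obtain f where f: "realization R f (complex i)" "\<forall>S\<in>insert {w} B. f S = facet S"
    using R unfolding stage_def by blast
  interpret R: realization R f "complex i" by (rule f(1))
  have cell: "shaved_faces ! i \<inter> R = cell R f ?A" by (rule shaved_face_cell[OF i f(2)])
  note A = edge_in_complex[OF i]
  have "cell R f ?A \<noteq> cell R f {}" using R.cell_eq_iff[OF A R.empty_simplex] by simp
  then have ne: "cell R f ?A \<noteq> R" by simp
  show ?thesis
  proof (rule separating_hyperplane_of_face[OF R.polytope R.cell_face[OF A]])
    fix \<beta> c assume "\<And>v. v \<in> cell R f ?A \<Longrightarrow> \<beta> < c \<bullet> v"
      and "\<And>v. v extreme_point_of R \<Longrightarrow> v \<notin> cell R f ?A \<Longrightarrow> c \<bullet> v < \<beta>"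
    then have "shaving R (cell R f ?A) (R \<inter> {x. c \<bullet> x \<le> \<beta>})"
      unfolding shaving_def using R.simple R.cell_face[OF A] R.cell_nonempty[OF A] ne by blast
    then show ?thesis unfolding cell by blast
  qed
qed

lemma sequence_stage:
  assumes "Q 0 = cylinder" "\<And>i. i < k \<Longrightarrow> shaving (Q i) (shaved_faces ! i \<inter> Q i) (Q (Suc i))"
    and "k \<le> length Ss"
  shows "stage k (Q k)"
  using assms
proof (induction k)
  case 0
  then show ?case using stage_0 by simp
next
  case (Suc k)
  then show ?case by (intro stage_Suc) auto
qed

lemma length_shaved_faces [simp]: "length shaved_faces = length Ss"
  by (simp add: shaved_faces_def)

lemma shaving_sequence_stage:
  "shaving_sequence cylinder shaved_faces Q \<Longrightarrow> k \<le> length Ss \<Longrightarrow> stage k (Q k)"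
  by (rule sequence_stage) (auto simp: shaving_sequence_def)

lemma shaving_sequence_exists: "\<exists>Q. shaving_sequence cylinder shaved_faces Q"
proof -
  have "\<exists>Q. Q 0 = cylinder \<and> (\<forall>i<k. shaving (Q i) (shaved_faces ! i \<inter> Q i) (Q (Suc i)))"
    if "k \<le> length Ss" for k
    using that
  proof (induction k)
    case 0
    show ?case by (intro exI[of _ "\<lambda>_. cylinder"]) simp
  next
    case (Suc k)
    then obtain Q where Q: "Q 0 = cylinder" "\<forall>i<k. shaving (Q i) (shaved_faces ! i \<inter> Q i) (Q (Suc i))"
      by auto
    then have "stage k (Q k)" using Suc.prems by (intro sequence_stage) auto
    then obtain R' where R': "shaving (Q k) (shaved_faces ! k \<inter> Q k) R'"
      using stage_shaving_exists[of k "Q k"] Suc.prems by auto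
    let ?Q = "Q(Suc k := R')"
    have "shaving (?Q i) (shaved_faces ! i \<inter> ?Q i) (?Q (Suc i))" if "i < Suc k" for i
      using that Q(2) R' by (cases "i = k") auto
    then show ?case using Q(1) by (intro exI[of _ ?Q]) simp
  qed
  then show ?thesis unfolding shaving_sequence_def by simp
qed

lemma final_equivalent:
  assumes "shaving_sequence cylinder shaved_faces Q"
  shows "combinatorially_equivalent (graph_assoc \<Gamma>') (Q (length Ss))"
proof -
  obtain f where f: "realization (Q (length Ss)) f Ext.nested"
    using shaving_sequence_stage[OF assms, of "length Ss"] unfolding stage_def complex_final by blast
  show ?thesis
    by (rule combinatorially_equivalentI[where \<tau> = id, OF Ext.realization_axioms f]) auto
qed

lemma realization_link_product:
  assumes i: "i < length Ss" and S: "S = Ss ! i"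
  shows "\<exists>g. realization (sub_assoc S \<times> quot_assoc S) g
      (link (complex i) {{w}, S})"
    and "pdim (sub_assoc S \<times> quot_assoc S) = card N - 2"
    and "simplex_sum (card N - 2) (link (complex i) {{w}, S}) (\<alpha> - t) t =
      H_poly (sub_assoc S) \<alpha> t * H_poly (quot_assoc S) \<alpha> t"
proof -
  note c = current[OF i S]
  interpret I: graph_assoc_loc "induced \<Gamma> S" by (rule induced_loc[OF c(2)])
  interpret C: graph_assoc_loc "contraction \<Gamma> S" by (rule contraction_loc[OF c(2,3)])
  note L = link_complex[OF i S]
  let ?\<tau> = "link_label S"
  let ?f = "case_sum (\<lambda>X. assoc_facet (induced \<Gamma> S) X \<times> UNIV) (\<lambda>Y. UNIV \<times> assoc_facet (contraction \<Gamma> S) Y)"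
  note prod = realization_Times[OF I.realization_axioms C.realization_axioms]
  have "\<Union>(join I.nested C.nested) \<subseteq> tubes (induced \<Gamma> S) <+> tubes (contraction \<Gamma> S)"
    using I.nestedD(1) C.nestedD(1) by (fastforce simp: mem_join)
  with L(2) have inj: "inj_on ?\<tau> (\<Union>(join I.nested C.nested))" by (rule inj_on_subset)
  define g where "g = ?f \<circ> inv_into (\<Union>(join I.nested C.nested)) ?\<tau>"
  have "realization (sub_assoc S \<times> quot_assoc S) g
      (link (complex i) {{w}, S})"
    unfolding L(1) by (rule realization_relabel[OF prod(1) inj]) (simp add: g_def inv_into_f_f[OF inj])
  then show "\<exists>g. realization (sub_assoc S \<times> quot_assoc S) g
      (link (complex i) {{w}, S})" by (rule exI[of _ g])
  have fin: "finite S" using building_finite[OF c(2)] .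
  have cards: "card (N - S) = card N - card S" using fin c(6) by (simp add: card_Diff_subset)
  have "card S < card N" using c(3,6) finite_nodes by (simp add: psubset_card_mono psubsetI)
  moreover have "card S > 0" using c(5) fin by (simp add: card_gt_0_iff)
  ultimately have d: "pdim (sub_assoc S) + pdim (quot_assoc S) = card N - 2"
    unfolding I.pdim_graph_assoc C.pdim_graph_assoc by (simp add: induced_def contraction_def cards)
  then show "pdim (sub_assoc S \<times> quot_assoc S) = card N - 2"
    using prod(2) by simp
  have "simplex_sum (card N - 2) (link (complex i) {{w}, S}) (\<alpha> - t) t
      = simplex_sum (card N - 2) (join I.nested C.nested) (\<alpha> - t) t"
    unfolding L(1) by (rule simplex_sum_relabel[OF inj])
  also have "\<dots> = simplex_sum (pdim (sub_assoc S)) I.nested (\<alpha> - t) t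
      * simplex_sum (pdim (quot_assoc S)) C.nested (\<alpha> - t) t"
    unfolding d[symmetric]
    by (rule simplex_sum_join)
      (simp_all add: I.finite_nested C.finite_nested I.nested_finite C.nested_finite I.card_le_pdim C.card_le_pdim)
  finally show "simplex_sum (card N - 2) (link (complex i) {{w}, S}) (\<alpha> - t) t =
      H_poly (sub_assoc S) \<alpha> t * H_poly (quot_assoc S) \<alpha> t"
    by (simp add: I.H_poly_eq C.H_poly_eq)
qed

lemma shaved_face_equivalent:
  assumes Q: "shaving_sequence cylinder shaved_faces Q" and i: "i < length Ss"
  shows "combinatorially_equivalent (shaved_faces ! i \<inter> Q i)
    (sub_assoc (Ss ! i) \<times> quot_assoc (Ss ! i))"
proof -
  obtain f where f: "realization (Q i) f (complex i)" "\<forall>S\<in>insert {w} B. f S = facet S"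
    using shaving_sequence_stage[OF Q, of i] i unfolding stage_def by auto
  interpret R: realization "Q i" f "complex i" by (rule f(1))
  obtain g where g: "realization (sub_assoc (Ss ! i) \<times> quot_assoc (Ss ! i)) g
      (link (complex i) {{w}, Ss ! i})"
    using realization_link_product(1)[OF i refl] by blast
  show ?thesis
    unfolding shaved_face_cell[OF i f(2)]
    by (rule combinatorially_equivalentI[where \<tau> = id, OF R.realization_link(1)[OF edge_in_complex[OF i]] g])
      auto
qed

text \<open>With \<open>x = \<alpha> - t\<close> the factor \<open>t (x + t)\<close> of a subdivision at an edge becomes \<open>\<alpha> t\<close>.\<close>

lemma simplex_sum_step:
  assumes i: "i < length Ss" and S: "S = Ss ! i"
  shows "simplex_sum (card N) (complex (Suc i)) (\<alpha> - t) t = simplex_sum (card N) (complex i) (\<alpha> - t) t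
    + \<alpha> * t * (H_poly (sub_assoc S) \<alpha> t * H_poly (quot_assoc S) \<alpha> t)"
proof -
  obtain Q where Q: "shaving_sequence cylinder shaved_faces Q" using shaving_sequence_exists by blast
  obtain f where f: "realization (Q i) f (complex i)" "pdim (Q i) = card N"
    using shaving_sequence_stage[OF Q, of i] i unfolding stage_def by auto
  interpret R: realization "Q i" f "complex i" by (rule f(1))
  have n: "insert w S \<notin> \<Union>(complex i)"
    using new_label[OF i S] by (auto simp: cliques_def)
  have "simplex_sum (card N) (complex (Suc i)) (\<alpha> - t) t = simplex_sum (card N) (complex i) (\<alpha> - t) t
    + t * (\<alpha> - t + t) * simplex_sum (card N - 2) (link (complex i) {{w}, S}) (\<alpha> - t) t"
    unfolding complex_Suc[OF i S]
  proof (rule simplex_sum_stellar_edge)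
    show "{w} \<noteq> S" using current(8)[OF i S] by simp
    show "{{w}, S} \<in> complex i" using edge_in_complex[OF i] S by simp
    show "finite A \<and> card A \<le> card N" if "A \<in> complex i" for A
      using R.finite_simplex[OF that] R.card_le_pdim[OF that] f(2) by simp
    show "A' \<in> complex i" if "A \<in> complex i" "A' \<subseteq> A" for A A' using R.subset_simplex[OF that] .
  qed (rule R.finite_complex, rule n)
  then show ?thesis unfolding realization_link_product(3)[OF i S] by (simp add: mult_ac)
qed

lemma H_poly_extension:
  "H_poly (graph_assoc \<Gamma>') \<alpha> t = (\<alpha> + t) * H_poly P \<alpha> t + \<alpha> * t *
    (\<Sum>S\<in>meeting. H_poly (sub_assoc S) \<alpha> t * H_poly (quot_assoc S) \<alpha> t)"
proof -
  let ?h = "\<lambda>S. H_poly (sub_assoc S) \<alpha> t * H_poly (quot_assoc S) \<alpha> t"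
  have "card N > 0" using building_nonempty[OF nodes_building] finite_nodes by (simp add: card_gt_0_iff)
  then have dN: "card N = pdim P + 1" using pdim_graph_assoc by simp
  have start: "simplex_sum (card N) (complex 0) (\<alpha> - t) t = (\<alpha> + t) * H_poly P \<alpha> t"
  proof -
    interpret Cyl: realization cylinder facet "complex 0" by (rule realization_cylinder(1))
    interpret Seg: realization "closed_segment a b" "\<lambda>s. if s then {b} else {a}" "{{}, {True}, {False}}"
      by (rule realization_segment(1)[OF ab])
    interpret Prod: realization "P \<times> closed_segment a b"
      "case_sum (\<lambda>X. assoc_facet \<Gamma> X \<times> UNIV) (\<lambda>s. UNIV \<times> (if s then {b} else {a}))"
      "join nested {{}, {True}, {False}}"
      by (rule realization_Times(1)[OF realization_axioms Seg.realization_axioms])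
    have "simplex_sum (card N) (complex 0) (\<alpha> - t) t = H_poly cylinder \<alpha> t"
      using realization_cylinder(2) by (simp add: Cyl.H_poly_eq)
    also have "\<dots> = simplex_sum (pdim P + 1) (join nested {{}, {True}, {False}}) (\<alpha> - t) t"
      using realization_cylinder(2) dN by (simp add: Prod.H_poly_eq)
    also have "\<dots> = simplex_sum (pdim P) nested (\<alpha> - t) t * simplex_sum 1 {{}, {True}, {False}} (\<alpha> - t) t"
      by (rule simplex_sum_join) (auto simp: finite_nested nested_finite card_le_pdim)
    also have "simplex_sum 1 {{}, {True}, {False}} (\<alpha> - t) t = \<alpha> + t"
      by (simp add: simplex_sum_def)
    finally show ?thesis by (simp add: H_poly_eq)
  qed
  have steps: "simplex_sum (card N) (complex k) (\<alpha> - t) t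
      = simplex_sum (card N) (complex 0) (\<alpha> - t) t + \<alpha> * t * (\<Sum>i<k. ?h (Ss ! i))"
    if "k \<le> length Ss" for k
    using that
  proof (induction k)
    case (Suc k)
    then show ?case using simplex_sum_step[of k "Ss ! k" \<alpha> t] by (simp add: algebra_simps)
  qed simp
  have reindex: "(\<Sum>i<length Ss. ?h (Ss ! i)) = (\<Sum>S\<in>meeting. ?h S)"
    using sum.reindex_bij_betw[OF bij_betw_nth[OF distinct refl set_Ss[symmetric]], of ?h] by simp
  have "pdim (graph_assoc \<Gamma>') = card N"
    using Ext.pdim_graph_assoc finite_nodes w_new by simp
  then have "H_poly (graph_assoc \<Gamma>') \<alpha> t = simplex_sum (card N) (complex (length Ss)) (\<alpha> - t) t"
    unfolding complex_final Ext.H_poly_eq by (simp only:)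
  also have "\<dots> = (\<alpha> + t) * H_poly P \<alpha> t + \<alpha> * t * (\<Sum>S\<in>meeting. ?h S)"
    unfolding steps[OF order_refl] start reindex ..
  finally show ?thesis .
qed

text \<open>If \<open>N\<close> has \<open>n\<close> elements, the two terms in the formula for \<open>H\<close> have expansions of the matching
degrees \<open>1 + (n - 1)\<close> and \<open>2 + (n - 2)\<close>, which add up to one for the extended graph.\<close>

lemma gamma_poly_extension:
  "gamma_poly (graph_assoc \<Gamma>') = gamma_poly P + [:0, 1:] *
    (\<Sum>S\<in>meeting. gamma_poly (sub_assoc S) * gamma_poly (quot_assoc S))"
proof (rule gamma_poly_eqI)
  have dim: "pdim (graph_assoc \<Gamma>') = card N"
    using Ext.pdim_graph_assoc finite_nodes w_new by simp
  have "card N > 0" using building_nonempty[OF nodes_building] finite_nodes by (simp add: card_gt_0_iff)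
  then have dN: "1 + pdim P = card N" using pdim_graph_assoc by simp
  have A: "gamma_expansion (card N) (\<lambda>\<alpha> t. (\<alpha> + t) * H_poly P \<alpha> t) (1 * gamma_poly P)"
    using gamma_expansion_mult[OF gamma_expansion_linear gamma_expansion_gamma_poly] unfolding dN .
  have fin: "finite meeting" using finite_set[of Ss] set_Ss by simp
  have prod: "gamma_expansion (card N) (\<lambda>\<alpha> t. (\<alpha> * t) ^ 1 * (H_poly (sub_assoc S) \<alpha> t * H_poly (quot_assoc S) \<alpha> t))
      (monom 1 1 * (gamma_poly (sub_assoc S) * gamma_poly (quot_assoc S)))" if S: "S \<in> meeting" for S
  proof -
    obtain i where i: "i < length Ss" "S = Ss ! i" using S set_Ss by (metis in_set_conv_nth)
    note c = current[OF i]
    interpret I: graph_assoc_loc "induced \<Gamma> S" by (rule induced_loc[OF c(2)])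
    interpret C: graph_assoc_loc "contraction \<Gamma> S" by (rule contraction_loc[OF c(2,3)])
    have "card S < card N" "card S > 0"
      using c(3,5,6) finite_nodes building_finite[OF c(2)]
      by (auto simp: card_gt_0_iff intro!: psubset_card_mono)
    then have d: "2 * 1 + (pdim (sub_assoc S) + pdim (quot_assoc S)) = card N"
      using realization_link_product(2)[OF i]
        realization_Times(2)[OF I.realization_axioms C.realization_axioms] by simp
    show ?thesis
      using gamma_expansion_mult[OF gamma_expansion_product_power[of 1]
          gamma_expansion_mult[OF I.gamma_expansion_gamma_poly C.gamma_expansion_gamma_poly]]
      unfolding d .
  qed
  have "gamma_expansion (card N)
      (\<lambda>\<alpha> t. (\<alpha> + t) * H_poly P \<alpha> t + (\<Sum>S\<in>meeting. (\<alpha> * t) ^ 1 * (H_poly (sub_assoc S) \<alpha> t * H_poly (quot_assoc S) \<alpha> t)))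
      (1 * gamma_poly P + (\<Sum>S\<in>meeting. monom 1 1 * (gamma_poly (sub_assoc S) * gamma_poly (quot_assoc S))))"
    by (intro gamma_expansion_add A gamma_expansion_sum[OF fin] prod)
  moreover have "(\<lambda>\<alpha> t. (\<alpha> + t) * H_poly P \<alpha> t + (\<Sum>S\<in>meeting. (\<alpha> * t) ^ 1 * (H_poly (sub_assoc S) \<alpha> t * H_poly (quot_assoc S) \<alpha> t)))
      = H_poly (graph_assoc \<Gamma>')"
    by (intro ext) (simp add: H_poly_extension sum_distrib_left)
  moreover have "1 * gamma_poly P + (\<Sum>S\<in>meeting. monom 1 1 * (gamma_poly (sub_assoc S) * gamma_poly (quot_assoc S)))
      = gamma_poly P + [:0, 1:] * (\<Sum>S\<in>meeting. gamma_poly (sub_assoc S) * gamma_poly (quot_assoc S))"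
    by (simp add: sum_distrib_left monom_altdef)
  ultimately show "gamma_expansion (pdim (graph_assoc \<Gamma>')) (H_poly (graph_assoc \<Gamma>'))
      (gamma_poly P + [:0, 1:] * (\<Sum>S\<in>meeting. gamma_poly (sub_assoc S) * gamma_poly (quot_assoc S)))"
    unfolding dim by (simp only:)
qed

end

lemma decreasing_enumeration:
  assumes "finite X" "\<And>S. S \<in> X \<Longrightarrow> finite (S :: 'v set)"
  obtains Ss where "distinct Ss" "set Ss = X"
    "\<And>i j. i < length Ss \<Longrightarrow> j < length Ss \<Longrightarrow> Ss ! j \<subset> Ss ! i \<Longrightarrow> i < j"
proof -
  obtain xs where xs: "set xs = X" "distinct xs" using finite_distinct_list[OF assms(1)] by blast
  let ?m = "Max (insert 0 (card ` X))"
  let ?k = "\<lambda>S. ?m - card S"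
  let ?Ss = "sort_key ?k xs"
  show ?thesis
  proof (rule that[of ?Ss])
    show "distinct ?Ss" "set ?Ss = X" using xs by simp_all
    fix i j assume ij: "i < length ?Ss" "j < length ?Ss" "?Ss ! j \<subset> ?Ss ! i"
    have mem: "?Ss ! i \<in> X" "?Ss ! j \<in> X" using ij xs(1) nth_mem set_sort by metis+
    have "card (?Ss ! j) < card (?Ss ! i)" using ij(3) assms(2)[OF mem(1)] by (rule psubset_card_mono[rotated])
    moreover have "card (?Ss ! i) \<le> ?m" using mem(1) assms(1) by (intro Max_ge) auto
    ultimately have "?k (?Ss ! i) < ?k (?Ss ! j)" by simp
    moreover have "?k (?Ss ! j) \<le> ?k (?Ss ! i)" if "j \<le> i"
      using sorted_nth_mono[OF sorted_sort_key[of ?k xs] that] ij by simp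
    ultimately show "i < j" by (meson leD not_le)
  qed
qed

theorem mainTheorem5:
  fixes \<Gamma> :: "'v::finite ugraph" and V :: "'v set" and w :: 'v and a b :: real
  assumes "simple_graph \<Gamma>" and "connected_graph \<Gamma>"
    and "is_clique \<Gamma> V" and "V \<noteq> {}"
    and "w \<notin> nodes \<Gamma>"
    and "a \<noteq> b"
  shows
    "(\<forall>Ss. distinct Ss \<and> set Ss = tubes_meeting \<Gamma> V \<and>
        (\<forall>i<length Ss. \<forall>j<length Ss. Ss ! j \<subset> Ss ! i \<longrightarrow> i < j) \<longrightarrow>
      (let cylinder = graph_assoc \<Gamma> \<times> closed_segment a b;
           top_base = graph_assoc \<Gamma> \<times> {b};
           Gs = map (\<lambda>S. top_base \<inter> assoc_facet \<Gamma> S \<times> closed_segment a b) Ss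
       in (\<exists>Q. shaving_sequence cylinder Gs Q) \<and>
          (\<forall>Q. shaving_sequence cylinder Gs Q \<longrightarrow>
             combinatorially_equivalent (graph_assoc (add_node \<Gamma> w V)) (Q (length Gs)) \<and>
             (\<forall>i<length Ss. combinatorially_equivalent (Gs ! i \<inter> Q i)
                (graph_assoc (induced \<Gamma> (Ss ! i)) \<times> graph_assoc (contraction \<Gamma> (Ss ! i)))))))
     \<and> gamma_poly (graph_assoc (add_node \<Gamma> w V)) =
        gamma_poly (graph_assoc \<Gamma>) +
        [:0, 1:] * (\<Sum>S\<in>tubes_meeting \<Gamma> V.
           gamma_poly (graph_assoc (induced \<Gamma> S)) * gamma_poly (graph_assoc (contraction \<Gamma> S)))
     \<and> (\<forall>\<alpha> t. H_poly (graph_assoc (add_node \<Gamma> w V)) \<alpha> t =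
        (\<alpha> + t) * H_poly (graph_assoc \<Gamma>) \<alpha> t +
        \<alpha> * t * (\<Sum>S\<in>tubes_meeting \<Gamma> V.
           H_poly (graph_assoc (induced \<Gamma> S)) \<alpha> t * H_poly (graph_assoc (contraction \<Gamma> S)) \<alpha> t))"
proof -
  interpret clique_extension \<Gamma> V w
    by unfold_locales (use assms in auto)
  have shaving_loc: "clique_shaving \<Gamma> V w Ss a b"
    if "distinct Ss" "set Ss = tubes_meeting \<Gamma> V"
      "\<And>i j. i < length Ss \<Longrightarrow> j < length Ss \<Longrightarrow> Ss ! j \<subset> Ss ! i \<Longrightarrow> i < j" for Ss
    by unfold_locales (use assms that in auto)
  show ?thesis
  proof (intro conjI allI impI)
    fix Ss assume Ss: "distinct Ss \<and> set Ss = tubes_meeting \<Gamma> V \<and>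
        (\<forall>i<length Ss. \<forall>j<length Ss. Ss ! j \<subset> Ss ! i \<longrightarrow> i < j)"
    interpret S: clique_shaving \<Gamma> V w Ss a b by (rule shaving_loc) (use Ss in auto)
    show "let cylinder = graph_assoc \<Gamma> \<times> closed_segment a b;
           top_base = graph_assoc \<Gamma> \<times> {b};
           Gs = map (\<lambda>S. top_base \<inter> assoc_facet \<Gamma> S \<times> closed_segment a b) Ss
       in (\<exists>Q. shaving_sequence cylinder Gs Q) \<and>
          (\<forall>Q. shaving_sequence cylinder Gs Q \<longrightarrow>
             combinatorially_equivalent (graph_assoc (add_node \<Gamma> w V)) (Q (length Gs)) \<and>
             (\<forall>i<length Ss. combinatorially_equivalent (Gs ! i \<inter> Q i)
                (graph_assoc (induced \<Gamma> (Ss ! i)) \<times> graph_assoc (contraction \<Gamma> (Ss ! i)))))"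
      unfolding Let_def S.shaved_faces_def[symmetric]
      using S.shaving_sequence_exists S.final_equivalent S.shaved_face_equivalent by simp
  next
    have "finite (tubes_meeting \<Gamma> V)" using finite_building_set by (simp add: tubes_meeting_def)
    then obtain Ss where "distinct Ss" "set Ss = tubes_meeting \<Gamma> V"
      "\<And>i j. i < length Ss \<Longrightarrow> j < length Ss \<Longrightarrow> Ss ! j \<subset> Ss ! i \<Longrightarrow> i < j"
      by (rule decreasing_enumeration) simp_all
    then interpret S: clique_shaving \<Gamma> V w Ss a b by (rule shaving_loc)
    show "gamma_poly (graph_assoc (add_node \<Gamma> w V)) =
        gamma_poly (graph_assoc \<Gamma>) +
        [:0, 1:] * (\<Sum>S\<in>tubes_meeting \<Gamma> V.
           gamma_poly (graph_assoc (induced \<Gamma> S)) * gamma_poly (graph_assoc (contraction \<Gamma> S)))"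
      by (rule S.gamma_poly_extension)
    show "H_poly (graph_assoc (add_node \<Gamma> w V)) \<alpha> t =
        (\<alpha> + t) * H_poly (graph_assoc \<Gamma>) \<alpha> t +
        \<alpha> * t * (\<Sum>S\<in>tubes_meeting \<Gamma> V.
           H_poly (graph_assoc (induced \<Gamma> S)) \<alpha> t * H_poly (graph_assoc (contraction \<Gamma> S)) \<alpha> t)"
      for \<alpha> t
      by (rule S.H_poly_extension)
  qed
qed

end
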